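(* There is a universal constant $\mathsf C>0$ (one may take $\mathsf C=\frac{1}{2^{13}\pi}$) such that the following holds. Let $\pi\in\mathcal P(\mathbb R^d)$ satisfy the standing decomposition assumption with constants $\mathsf M,\mathsf L$, and assume further that $\pi$ is $\mathsf m$-strongly log-concave. Let $\mathsf P$ be the Random–Walk Metropolis kernel for $\pi$ with step size $h$ satisfying $0<h\le \frac{1}{\sqrt d}\min\{\frac{1}{2\sqrt{\mathsf M}},\frac{1}{16\mathsf L}\}$. Then $$\mathrm{Gap}(\mathsf P)\ \ge\ \mathsf C\,\mathsf m\,h^2 .$$
   Context: Standing decomposition assumption: $\pi$ has a positive density with $\log\pi=f+g$, $f$ differentiable with $\|\nabla f(x)-\nabla f(y)\|\le \mathsf M\|x-y\|$, and $|g(x)-g(y)|\le\mathsf L\|x-y\|$ for all $x,y$. $\pi$ is $\mathsf m$-strongly log-concave if for all $x,y$ and $\lambda\in(0,1)$: $\log\pi(\lambda x+(1-\lambda)y)\ge\lambda\log\pi(x)+(1-\lambda)\log\pi(y)+\frac{\mathsf m}{2}\lambda(1-\lambda)\|x-y\|^2$. Metropolis kernel with proposal $\mathsf Q$: $\alpha(x,x')=\min\{1,\frac{\pi(x')\mathsf Q(x',x)}{\pi(x)\mathsf Q(x,x')}\}$, $\mathsf P(x,y)=\alpha(x,y)\mathsf Q(x,y)+(1-\int\alpha(x,x')\mathsf Q(x,x')dx')\delta_x(y)$. RWM with step size $h$: $\mathsf Q(x,\cdot)=\mathcal N(x,h^2I)$. Spectral gap: $\mathrm{Gap}(\mathsf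 P)=\inf\{1-\mathbb E_\pi[u\,\mathsf Pu]/\mathbb E_\pi[u^2]: 0\ne u\in L^2(\pi),\ \mathbb E_\pi u=0\}$, where $\mathsf Pu(x)=\int\mathsf P(x,y)u(y)dy$. *)

theory Defs
  imports "HOL-Analysis.Analysis"
begin

definition rwm_proposal :: "real \<Rightarrow> 'a::euclidean_space \<Rightarrow> 'a \<Rightarrow> real" where
  "rwm_proposal h x y =
     (2 * pi * h\<^sup>2) powr (- real DIM('a) / 2) * exp (- (norm (y - x))\<^sup>2 / (2 * h\<^sup>2))"

definition metropolis_accept ::
  "('a \<Rightarrow> real) \<Rightarrow> ('a \<Rightarrow> 'a \<Rightarrow> real) \<Rightarrow> 'a \<Rightarrow> 'a \<Rightarrow> real" where
  "metropolis_accept p Q x y = min 1 ((p y * Q y x) / (p x * Q x y))"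

definition metropolis_op ::
  "('a::euclidean_space \<Rightarrow> real) \<Rightarrow> ('a \<Rightarrow> 'a \<Rightarrow> real) \<Rightarrow> ('a \<Rightarrow> real) \<Rightarrow> 'a \<Rightarrow> real" where
  "metropolis_op p Q u x =
     (LINT y|lborel. metropolis_accept p Q x y * Q x y * u y)
     + (1 - (LINT y|lborel. metropolis_accept p Q x y * Q x y)) * u x"

definition dens_measure :: "('a::euclidean_space \<Rightarrow> real) \<Rightarrow> 'a measure" where
  "dens_measure p = density lborel (\<lambda>x. ennreal (p x))"

definition spectral_gap :: "'a measure \<Rightarrow> (('a \<Rightarrow> real) \<Rightarrow> 'a \<Rightarrow> real) \<Rightarrow> real" where
  "spectral_gap \<mu> P = Inf {1 - (\<integral>x. u x * P u x \<partial>\<mu>) / (\<integral>x. (u x)\<^sup>2 \<partial>\<mu>) | u.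
      u \<in> borel_measurable \<mu> \<and> integrable \<mu> (\<lambda>x. (u x)\<^sup>2) \<and>
      (\<integral>x. u x \<partial>\<mu>) = 0 \<and> (\<integral>x. (u x)\<^sup>2 \<partial>\<mu>) \<noteq> 0}"

definition strongly_log_concave :: "real \<Rightarrow> ('a::euclidean_space \<Rightarrow> real) \<Rightarrow> bool" where
  "strongly_log_concave m p \<longleftrightarrow> (\<forall>x y t. 0 < t \<and> t < 1 \<longrightarrow>
     ln (p (t *\<^sub>R x + (1 - t) *\<^sub>R y)) \<ge>
       t * ln (p x) + (1 - t) * ln (p y) + m / 2 * t * (1 - t) * (norm (x - y))\<^sup>2)"

end

(*
  Let q be the Gaussian density of the proposal and
    E(u) = double integral of min (p x) (p y) q (x - y) (u x - u y)^2,
  which is twice the Dirichlet form of the chain. We show m h^2 Var(u) <= 8900 E(u) and rescale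
  so that h = 1. The function u need not be differentiable, so it is compared with a local
  average v of u: the variance of u is controlled by that of v and by the integral of (u - v)^2.
  The Poincare inequality m Var(v) <= E |grad v|^2 for strongly log-concave densities follows from
  Prekopa-Leindler applied to p e^{eps v}, p e^{-eps v} and p e^{eps^2 |grad v|^2 / (2 m)}.

  The averages have to be bounded by one step of the chain: |v - u| and |grad v| at z must be at most
  a constant times sqrt (D z), where D z is the integral of k (u (z + x) - u z)^2 against the kernel
  k x = min 1 (p (z + x) / p z) q x of accepted moves. By Cauchy-Schwarz this amounts to chi-square
  bounds, relative to k, for the averaging kernel and its increments. Where the gradient of f is
  large, k is negligible on the half-space where p decreases, so the averaging kernel must vanish
  there, but it may only vary on the scale of the proposal. Both are achieved by
    q x max 0 (exp (t . x + (1 - |t|^2) / 2) - 1)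
  with t the projection of grad f onto the unit ball: t depends on z in a Lipschitz way, and for
  |t| = 1 the support is the half-space t . x >= 0. The lower bound exp r - 1 <= max 0 (exp r - 1)
  shows that the mass of the kernel is at least exp (1/2) - 1 for every t.
*)
theory Submission
  imports Defs "HOL-Probability.Distributions"
begin

section \<open>Prekopa--Leindler inequality\<close>

text \<open>The target has only a smooth part plus a Lipschitz part and \<open>u\<close> is only
  measurable, so no average is ever differentiated. The Poincare inequality asks for a bound on the
  increments of v between z + w and z - w for small w, and Cauchy-Schwarz against the acceptance
  kernel of the single point z provides it. How small w must be depends on the gradient at z, which
  may be unbounded; hence the inequality is proved on convex sets, used on balls and extended by a
  limit. With d the dimension, the conditions at unit step are M \<le> 1 / (4 d) and L \<le> 1 / (16
  sqrt d). A proposal has squared length of order d, so the error in the linear expansion of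
  \<open>ln p\<close> stays bounded in every dimension. For the same reason the terms of first order
  in w keep scalar products with unit vectors instead of the length of x. Constants: the averaging
  kernel has mass at least 5/8 and chi-square bounds 25 and (75 |w|)^2, whence |v - u| \<le> 8 sqrt
  D and |grad v| \<le> 84 sqrt D. Then 8900 = (5/4) 84^2 + 5 (8^2) / 4, where the last 1/4 bounds m
  through m \<le> M.\<close>

lemma brunn_minkowski_real_bounded:
  fixes A B C :: "real set"
  assumes [measurable]: "A \<in> sets borel" "B \<in> sets borel" "C \<in> sets borel"
    and ne: "A \<noteq> {}" "B \<noteq> {}" and bdd: "bdd_above A" "bdd_below B"
    and AB: "\<And>a b. a \<in> A \<Longrightarrow> b \<in> B \<Longrightarrow> a + b \<in> C"
  shows "emeasure lborel A + emeasure lborel B \<le> emeasure lborel C"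
proof (rule ennreal_le_epsilon)
  fix e :: real assume e: "0 < e"
  \<comment> \<open>The translates \<open>A + b\<close> and \<open>a + B\<close> lie in \<open>C\<close> and overlap only near \<open>a + b\<close>
    when \<open>a\<close> is almost maximal and \<open>b\<close> almost minimal.\<close>
  obtain a where a: "a \<in> A" "Sup A - e / 2 < a"
    using less_cSup_iff[of A "Sup A - e / 2"] ne bdd e by auto
  obtain b where b: "b \<in> B" "b < Inf B + e / 2"
    using cInf_less_iff[of B "Inf B + e / 2"] ne bdd e by auto
  define A' where "A' = {x. x - b \<in> A}"
  define B' where "B' = {x. x - a \<in> B}"
  have [measurable]: "A' \<in> sets borel" "B' \<in> sets borel"
    unfolding A'_def B'_def by measurable
  have shift: "emeasure lborel {x. x - c \<in> S} = emeasure lborel S"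
    if [measurable]: "S \<in> sets borel" for c :: real and S
  proof -
    have "emeasure lborel S = emeasure (distr lborel borel ((+) (- c))) S"
      by (simp add: lborel_distr_plus)
    also have "\<dots> = emeasure lborel {x. x - c \<in> S}"
      by (subst emeasure_distr) (auto intro!: arg_cong[where f = "emeasure lborel"])
    finally show ?thesis by simp
  qed
  have sub: "A' \<union> B' \<subseteq> C"
    using AB[of _ b] AB[OF a(1)] b(1) by (force simp: A'_def B'_def)
  have "A' \<inter> B' \<subseteq> {a + Inf B .. Sup A + b}"
  proof
    fix x assume x: "x \<in> A' \<inter> B'"
    have "x - b \<le> Sup A" using x bdd by (auto simp: A'_def intro!: cSup_upper)
    moreover have "Inf B \<le> x - a" using x bdd by (auto simp: B'_def intro!: cInf_lower)
    ultimately show "x \<in> {a + Inf B .. Sup A + b}" by auto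
  qed
  then have "emeasure lborel (A' \<inter> B') \<le> emeasure lborel {a + Inf B .. Sup A + b}"
    by (intro emeasure_mono) auto
  also have "\<dots> \<le> ennreal e"
    using a b by (auto simp: emeasure_lborel_Icc_eq intro!: ennreal_leI)
  finally have int: "emeasure lborel (A' \<inter> B') \<le> ennreal e" .
  have "emeasure lborel A + emeasure lborel B = emeasure lborel A' + emeasure lborel B'"
    by (simp add: A'_def B'_def shift)
  also have "\<dots> = emeasure lborel (A' \<union> B') + emeasure lborel (A' \<inter> B')"
    by (rule emeasure_Un_Int) auto
  also have "\<dots> \<le> emeasure lborel C + ennreal e"
    using sub int by (intro add_mono emeasure_mono) auto
  finally show "emeasure lborel A + emeasure lborel B \<le> emeasure lborel C + ennreal e" .
qed

text \<open>Exhaustion by bounded pieces. The intervals are centred at points of \<open>A\<close>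
  and \<open>B\<close>, so that every truncation remains nonempty.\<close>

lemma brunn_minkowski_real:
  fixes A B C :: "real set"
  assumes [measurable]: "A \<in> sets borel" "B \<in> sets borel" "C \<in> sets borel"
    and ne: "A \<noteq> {}" "B \<noteq> {}"
    and AB: "\<And>a b. a \<in> A \<Longrightarrow> b \<in> B \<Longrightarrow> a + b \<in> C"
  shows "emeasure lborel A + emeasure lborel B \<le> emeasure lborel C"
proof -
  obtain a b where ab: "a \<in> A" "b \<in> B" using ne by auto
  have exhaust: "(\<lambda>n::nat. emeasure lborel (S \<inter> {c - n .. c + n})) \<longlonglongrightarrow> emeasure lborel S"
    if [measurable]: "S \<in> sets borel" for S :: "real set" and c :: real
  proof -
    have U: "(\<Union>n::nat. S \<inter> {c - n .. c + n}) = S"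
    proof (intro equalityI subsetI)
      fix x assume "x \<in> S"
      moreover obtain n :: nat where "\<bar>x - c\<bar> \<le> n" using real_arch_simple by blast
      ultimately show "x \<in> (\<Union>n::nat. S \<inter> {c - n .. c + n})" by (auto intro!: exI[of _ n])
    qed auto
    have "(\<lambda>n::nat. emeasure lborel (S \<inter> {c - n .. c + n})) \<longlonglongrightarrow>
        emeasure lborel (\<Union>n::nat. S \<inter> {c - n .. c + n})"
      by (intro Lim_emeasure_incseq) (auto simp: incseq_def)
    then show ?thesis by (simp only: U)
  qed
  have lim: "(\<lambda>n::nat. emeasure lborel (A \<inter> {a - n .. a + n}) + emeasure lborel (B \<inter> {b - n .. b + n}))
      \<longlonglongrightarrow> emeasure lborel A + emeasure lborel B"
    by (intro tendsto_add exhaust) auto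
  have "emeasure lborel (A \<inter> {a - n .. a + n}) + emeasure lborel (B \<inter> {b - n .. b + n})
      \<le> emeasure lborel C" for n :: nat
  proof (rule brunn_minkowski_real_bounded)
    show "bdd_above (A \<inter> {a - n .. a + n})" by (rule bdd_above_mono[of "{a - n .. a + n}"]) auto
    show "bdd_below (B \<inter> {b - n .. b + n})" by (rule bdd_below_mono[of "{b - n .. b + n}"]) auto
  qed (use ab AB in auto)
  then show ?thesis using lim by (intro LIMSEQ_le_const2) auto
qed

text \<open>Tonelli for the region under the graph. Only levels in (0, 1) are kept, because those
  are the levels at which the superlevel sets of both normalized functions are nonempty.\<close>

lemma nn_integral_layer_cake_unit:
  fixes f :: "real \<Rightarrow> ennreal"
  assumes [measurable]: "f \<in> borel_measurable borel" and le1: "\<And>x. f x \<le> 1"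
  shows "(\<integral>\<^sup>+x. f x \<partial>lborel) =
    (\<integral>\<^sup>+s. indicator {0<..<1} s * emeasure lborel {x. ennreal s < f x} \<partial>lborel)"
proof -
  have slice: "f x = (\<integral>\<^sup>+s. indicator {0<..<1} s * indicator {x. ennreal s < f x} x \<partial>lborel)" for x
  proof -
    have "f x \<noteq> top" using le1[of x] by (metis ennreal_one_neq_top top_unique)
    then obtain r where r: "f x = ennreal r" "0 \<le> r" "r \<le> 1"
      using le1[of x] by (cases "f x") (auto simp: ennreal_le_1)
    have "(\<integral>\<^sup>+s. indicator {0<..<1} s * indicator {x. ennreal s < f x} x \<partial>lborel)
        = (\<integral>\<^sup>+s. indicator {0<..<r} s \<partial>lborel)"
      using r by (intro nn_integral_cong) (auto simp: indicator_def ennreal_less_iff)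
    also have "\<dots> = ennreal r" using r by simp
    finally show ?thesis using r by simp
  qed
  have "(\<integral>\<^sup>+x. f x \<partial>lborel) =
    (\<integral>\<^sup>+x. (\<integral>\<^sup>+s. indicator {0<..<1} s * indicator {x. ennreal s < f x} x \<partial>lborel) \<partial>lborel)"
    by (rule nn_integral_cong) (rule slice)
  also have "\<dots> = (\<integral>\<^sup>+s. (\<integral>\<^sup>+x. indicator {0<..<1} s * indicator {x. ennreal s < f x} x \<partial>lborel) \<partial>lborel)"
  proof -
    have "(\<lambda>p. indicator {0<..<1} (snd p) * (if ennreal (snd p) < f (fst p) then 1 else 0 :: ennreal))
        \<in> borel_measurable (borel \<Otimes>\<^sub>M borel)" by measurable
    then have "(\<lambda>(x, y). indicator {0<..<1} y * indicator {x. ennreal y < f x} x :: ennreal)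
        \<in> borel_measurable (lborel \<Otimes>\<^sub>M lborel)"
      by (simp add: split_beta' indicator_def of_bool_def)
    then show ?thesis by (rule lborel_pair.Fubini'[symmetric])
  qed
  also have "\<dots> = (\<integral>\<^sup>+s. indicator {0<..<1} s * emeasure lborel {x. ennreal s < f x} \<partial>lborel)"
    by (intro nn_integral_cong) (simp add: nn_integral_cmult)
  finally show ?thesis .
qed

text \<open>With both suprema equal to 1, superlevel sets at the same level \<open>s\<close> are
  nonempty and their sum lies in the superlevel set of \<open>h\<close>, so the one-dimensional
  Brunn-Minkowski inequality can be integrated over \<open>s\<close>. The additive conclusion is
  stronger than the multiplicative one wanted in the end.\<close>

lemma prekopa_leindler_real_normalized:
  fixes f g h :: "real \<Rightarrow> ennreal"
  assumes [measurable]: "f \<in> borel_measurable borel" "g \<in> borel_measurable borel"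
      "h \<in> borel_measurable borel"
    and f: "\<And>x. f x \<le> 1" "\<And>s. s < 1 \<Longrightarrow> \<exists>x. s < f x"
    and g: "\<And>x. g x \<le> 1" "\<And>s. s < 1 \<Longrightarrow> \<exists>x. s < g x"
    and fgh: "\<And>x y. f x * g y \<le> (h (x + y))\<^sup>2"
  shows "(\<integral>\<^sup>+x. f x \<partial>lborel) + (\<integral>\<^sup>+x. g x \<partial>lborel) \<le> (\<integral>\<^sup>+x. h x \<partial>lborel)"
proof -
  have level: "emeasure lborel {x. ennreal s < f x} + emeasure lborel {x. ennreal s < g x}
      \<le> emeasure lborel {x. ennreal s < min (h x) 1}" if s: "0 < s" "s < 1" for s :: real
  proof (rule brunn_minkowski_real)
    show "{x. ennreal s < f x} \<noteq> {}" "{x. ennreal s < g x} \<noteq> {}"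
      using f(2)[of "ennreal s"] g(2)[of "ennreal s"] s by (auto simp: ennreal_less_one_iff)
    fix a b assume ab: "a \<in> {x. ennreal s < f x}" "b \<in> {x. ennreal s < g x}"
    have "(ennreal s)\<^sup>2 < ennreal s * g b"
      using ab s unfolding power2_eq_square by (intro ennreal_mult_strict_left_mono) auto
    also have "\<dots> \<le> f a * g b" using ab by (intro mult_right_mono) auto
    also have "\<dots> \<le> (h (a + b))\<^sup>2" by (rule fgh)
    finally have "ennreal s < h (a + b)"
      by (meson not_less power_mono zero_le)
    then show "a + b \<in> {x. ennreal s < min (h x) 1}" using s by (auto simp: ennreal_less_one_iff)
  qed auto
  have "(\<integral>\<^sup>+x. f x \<partial>lborel) + (\<integral>\<^sup>+x. g x \<partial>lborel) =
    (\<integral>\<^sup>+s. indicator {0<..<1} s * (emeasure lborel {x. ennreal s < f x} + emeasure lborel {x. ennreal s < g x}) \<partial>lborel)"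
    using f(1) g(1)
    by (simp add: nn_integral_layer_cake_unit distrib_left nn_integral_add)
  also have "\<dots> \<le> (\<integral>\<^sup>+s. indicator {0<..<1} s * emeasure lborel {x. ennreal s < min (h x) 1} \<partial>lborel)"
    using level by (intro nn_integral_mono) (auto simp: indicator_def)
  also have "\<dots> = (\<integral>\<^sup>+x. min (h x) 1 \<partial>lborel)"
    by (rule nn_integral_layer_cake_unit[symmetric]) auto
  also have "\<dots> \<le> (\<integral>\<^sup>+x. h x \<partial>lborel)" by (intro nn_integral_mono) auto
  finally show ?thesis .
qed

lemma ennreal_four_mult_le_square_add: "4 * (x * y) \<le> (x + y)\<^sup>2" for x y :: ennreal
proof (cases "x = top \<or> y = top")
  case True
  then show ?thesis by (auto simp: power2_eq_square ennreal_top_mult)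
next
  case False
  then obtain a b where "x = ennreal a" "y = ennreal b" "0 \<le> a" "0 \<le> b"
    by (metis ennreal_cases)
  moreover have "4 * (a * b) \<le> (a + b)\<^sup>2"
    using sum_squares_bound[of a b] by (simp add: power2_eq_square algebra_simps)
  ultimately show ?thesis
    by (simp flip: ennreal_mult ennreal_plus ennreal_numeral add: ennreal_power)
qed

text \<open>Dividing by the suprema \<open>a\<close>, \<open>b\<close> and by sqrt (a b) preserves
  the hypothesis, and boundedness makes the suprema finite. The factor 4 comes from passing from the
  sum to the product; it cancels later against the dilation that turns \<open>x + y\<close> into the
  midpoint.\<close>

lemma prekopa_leindler_real_bounded:
  fixes f g h :: "real \<Rightarrow> ennreal"
  assumes [measurable]: "f \<in> borel_measurable borel" "g \<in> borel_measurable borel"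
      "h \<in> borel_measurable borel"
    and bdd: "\<And>x. f x \<le> ennreal c" "\<And>x. g x \<le> ennreal c"
    and fgh: "\<And>x y. f x * g y \<le> (h (x + y))\<^sup>2"
  shows "4 * ((\<integral>\<^sup>+x. f x \<partial>lborel) * (\<integral>\<^sup>+x. g x \<partial>lborel)) \<le> (\<integral>\<^sup>+x. h x \<partial>lborel)\<^sup>2"
proof (cases "(SUP x. f x) = 0 \<or> (SUP x. g x) = 0")
  case True
  then have "(\<forall>x. f x = 0) \<or> (\<forall>x. g x = 0)" by (auto simp: SUP_eq_iff bot_ennreal)
  then show ?thesis by auto
next
  case False
  have "(SUP x. f x) \<le> ennreal c" "(SUP x. g x) \<le> ennreal c"
    using bdd by (auto intro: SUP_least)
  then have "(SUP x. f x) \<noteq> top" "(SUP x. g x) \<noteq> top" by (metis ennreal_neq_top top_unique)+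
  then obtain a b where a: "(SUP x. f x) = ennreal a" "0 < a" and b: "(SUP x. g x) = ennreal b" "0 < b"
    using False by (metis ennreal_cases less_eq_real_def ennreal_0)
  define k where "k = sqrt (a * b)"
  have k: "0 < k" "k * k = a * b" using a b by (auto simp: k_def)
  have norm1: "ennreal (1 / r) * F x \<le> 1" if "(SUP x. F x) = ennreal r" "0 < r" for F :: "real \<Rightarrow> ennreal" and r x
  proof -
    have "ennreal (1 / r) * F x \<le> ennreal (1 / r) * ennreal r"
      using that by (metis SUP_upper UNIV_I mult_left_mono zero_le)
    then show ?thesis using that by (simp flip: ennreal_mult)
  qed
  have norm2: "\<exists>x. s < ennreal (1 / r) * F x" if r: "(SUP x. F x) = ennreal r" "0 < r" and s1: "s < 1"
    for F :: "real \<Rightarrow> ennreal" and r s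
  proof -
    obtain t where t: "s = ennreal t" "0 \<le> t" "t < 1" using s1
      by (cases s) (auto simp: ennreal_less_one_iff)
    have "ennreal (t * r) < (SUP x. F x)" using r t by (auto simp: ennreal_less_iff)
    then obtain x where x: "ennreal (t * r) < F x" by (auto simp: less_SUP_iff)
    have "ennreal t = ennreal (1 / r) * ennreal (t * r)" using r t by (simp flip: ennreal_mult)
    also have "\<dots> < ennreal (1 / r) * F x"
      using x r by (intro ennreal_mult_strict_left_mono) auto
    finally show ?thesis using t by auto
  qed
  have "(\<integral>\<^sup>+x. ennreal (1 / a) * f x \<partial>lborel) + (\<integral>\<^sup>+x. ennreal (1 / b) * g x \<partial>lborel)
      \<le> (\<integral>\<^sup>+x. ennreal (1 / k) * h x \<partial>lborel)"
  proof (rule prekopa_leindler_real_normalized)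
    fix x y
    have "ennreal (1 / a) * f x * (ennreal (1 / b) * g y) = ennreal (1 / a) * ennreal (1 / b) * (f x * g y)"
      by (simp add: ac_simps)
    also have "ennreal (1 / a) * ennreal (1 / b) = (ennreal (1 / k))\<^sup>2"
      using a b k by (simp flip: ennreal_mult add: ennreal_power power2_eq_square)
    also have "(ennreal (1 / k))\<^sup>2 * (f x * g y) \<le> (ennreal (1 / k))\<^sup>2 * (h (x + y))\<^sup>2"
      by (intro mult_left_mono fgh) auto
    finally show "ennreal (1 / a) * f x * (ennreal (1 / b) * g y) \<le> (ennreal (1 / k) * h (x + y))\<^sup>2"
      by (simp add: power_mult_distrib)
    show "\<exists>x. s < ennreal (1 / a) * f x" "\<exists>x. s < ennreal (1 / b) * g x" if "s < 1" for s
      using that norm2[OF a] norm2[OF b] by blast+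
    show "ennreal (1 / a) * f x \<le> 1" "ennreal (1 / b) * g x \<le> 1" for x
      using norm1[OF a] norm1[OF b] by auto
  qed auto
  then have le: "ennreal (1 / a) * (\<integral>\<^sup>+x. f x \<partial>lborel) + ennreal (1 / b) * (\<integral>\<^sup>+x. g x \<partial>lborel)
      \<le> ennreal (1 / k) * (\<integral>\<^sup>+x. h x \<partial>lborel)"
    by (simp add: nn_integral_cmult)
  let ?F = "\<integral>\<^sup>+x. f x \<partial>lborel" and ?G = "\<integral>\<^sup>+x. g x \<partial>lborel" and ?H = "\<integral>\<^sup>+x. h x \<partial>lborel"
  have kk: "(ennreal k)\<^sup>2 * (ennreal (1 / a) * ennreal (1 / b)) = 1"
    using a b k by (simp flip: ennreal_mult add: ennreal_power power2_eq_square)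
  have kk': "ennreal k * ennreal (1 / k) = 1" using k by (simp flip: ennreal_mult)
  have "4 * (?F * ?G) = (ennreal k)\<^sup>2 * (ennreal (1 / a) * ennreal (1 / b)) * (4 * (?F * ?G))"
    by (simp only: kk mult_1)
  also have "\<dots> = (ennreal k)\<^sup>2 * (4 * ((ennreal (1 / a) * ?F) * (ennreal (1 / b) * ?G)))"
    by (simp only: mult.assoc mult.commute mult.left_commute)
  also have "\<dots> \<le> (ennreal k)\<^sup>2 * (ennreal (1 / k) * ?H)\<^sup>2"
    by (intro mult_left_mono order_trans[OF ennreal_four_mult_le_square_add] power_mono le) auto
  also have "\<dots> = (ennreal k * ennreal (1 / k) * ?H)\<^sup>2" by (simp only: power_mult_distrib mult.assoc)
  finally show ?thesis by (simp only: kk' mult_1)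
qed

lemma prekopa_leindler_real:
  fixes f g h :: "real \<Rightarrow> ennreal"
  assumes [measurable]: "f \<in> borel_measurable borel" "g \<in> borel_measurable borel"
      "h \<in> borel_measurable borel"
    and fgh: "\<And>x y. f x * g y \<le> (h ((x + y) / 2))\<^sup>2"
  shows "(\<integral>\<^sup>+x. f x \<partial>lborel) * (\<integral>\<^sup>+x. g x \<partial>lborel) \<le> (\<integral>\<^sup>+x. h x \<partial>lborel)\<^sup>2"
proof -
  have trunc: "(\<lambda>n::nat. \<integral>\<^sup>+x. min (F x) (of_nat n) \<partial>lborel) \<longlonglongrightarrow> (\<integral>\<^sup>+x. F x \<partial>lborel)"
    if [measurable]: "F \<in> borel_measurable borel" for F :: "real \<Rightarrow> ennreal"
  proof (rule nn_integral_LIMSEQ)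
    show "incseq (\<lambda>n x. min (F x) (of_nat n))"
      by (auto simp: incseq_def le_fun_def min_le_iff_disj)
    show "(\<lambda>n. min (F x) (of_nat n)) \<longlonglongrightarrow> F x" for x
    proof -
      have "(\<lambda>n. min (F x) (of_nat n)) \<longlonglongrightarrow> min (F x) top"
        by (intro tendsto_min tendsto_const of_nat_tendsto_top_ennreal)
      then show ?thesis by simp
    qed
  qed auto
  have h2: "(\<integral>\<^sup>+x. h (x / 2) \<partial>lborel) = 2 * (\<integral>\<^sup>+x. h x \<partial>lborel)"
    by (subst nn_integral_real_affine[where c = 2 and t = 0]) auto
  have "4 * ((\<integral>\<^sup>+x. min (f x) (of_nat n) \<partial>lborel) * (\<integral>\<^sup>+x. min (g x) (of_nat n) \<partial>lborel))
      \<le> (\<integral>\<^sup>+x. h (x / 2) \<partial>lborel)\<^sup>2" for n :: nat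
  proof (rule prekopa_leindler_real_bounded[where c = "real n"])
    fix x y
    have "min (f x) (of_nat n) * min (g y) (of_nat n) \<le> f x * g y" by (intro mult_mono) auto
    also note fgh
    finally show "min (f x) (of_nat n) * min (g y) (of_nat n) \<le> (h ((x + y) / 2))\<^sup>2" .
  qed (auto simp: ennreal_of_nat_eq_real_of_nat)
  then have four: "4 * ((\<integral>\<^sup>+x. min (f x) (of_nat n) \<partial>lborel) * (\<integral>\<^sup>+x. min (g x) (of_nat n) \<partial>lborel))
      \<le> 4 * (\<integral>\<^sup>+x. h x \<partial>lborel)\<^sup>2" for n :: nat
    by (simp add: h2 power_mult_distrib)
  \<comment> \<open>Independent truncation levels for the two factors allow the two suprema to be
    taken one after the other.\<close>
  have le: "(\<integral>\<^sup>+x. min (f x) (of_nat n) \<partial>lborel) * (\<integral>\<^sup>+x. min (g x) (of_nat m) \<partial>lborel)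
      \<le> (\<integral>\<^sup>+x. h x \<partial>lborel)\<^sup>2" for n m :: nat
  proof -
    have "(\<integral>\<^sup>+x. min (f x) (of_nat n) \<partial>lborel) * (\<integral>\<^sup>+x. min (g x) (of_nat m) \<partial>lborel)
      \<le> (\<integral>\<^sup>+x. min (f x) (of_nat (max n m)) \<partial>lborel) * (\<integral>\<^sup>+x. min (g x) (of_nat (max n m)) \<partial>lborel)"
      by (intro mult_mono nn_integral_mono min.mono) auto
    also have "\<dots> \<le> (\<integral>\<^sup>+x. h x \<partial>lborel)\<^sup>2"
      using four[of "max n m"] by (subst (asm) ennreal_mult_le_mult_iff) auto
    finally show ?thesis .
  qed
  have sup: "(\<integral>\<^sup>+x. F x \<partial>lborel) = (SUP n::nat. \<integral>\<^sup>+x. min (F x) (of_nat n) \<partial>lborel)"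
    if [measurable]: "F \<in> borel_measurable borel" for F :: "real \<Rightarrow> ennreal"
    by (rule LIMSEQ_unique[OF trunc[OF that] LIMSEQ_SUP])
       (auto simp: incseq_def intro!: nn_integral_mono min.mono)
  have "(\<integral>\<^sup>+x. f x \<partial>lborel) * (\<integral>\<^sup>+x. min (g x) (of_nat m) \<partial>lborel) \<le> (\<integral>\<^sup>+x. h x \<partial>lborel)\<^sup>2" for m :: nat
    by (subst sup) (auto simp: SUP_mult_right_ennreal intro!: SUP_least le)
  then show ?thesis
    by (subst (2) sup) (auto simp: SUP_mult_left_ennreal intro!: SUP_least)
qed

text \<open>Tensorization: the induction hypothesis applied to slices shows that the slice integrals
  satisfy the one-dimensional hypothesis. The midpoint is restricted to \<open>I\<close> because
  points of the product space must be \<open>undefined\<close> outside \<open>I\<close>, which a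
  pointwise midpoint need not be.\<close>

lemma prekopa_leindler_PiM:
  fixes f g h :: "('i \<Rightarrow> real) \<Rightarrow> ennreal"
  assumes "finite I"
    and "f \<in> borel_measurable (Pi\<^sub>M I (\<lambda>_. lborel))" "g \<in> borel_measurable (Pi\<^sub>M I (\<lambda>_. lborel))"
      "h \<in> borel_measurable (Pi\<^sub>M I (\<lambda>_. lborel))"
    and "\<And>x y. x \<in> space (Pi\<^sub>M I (\<lambda>_. lborel)) \<Longrightarrow> y \<in> space (Pi\<^sub>M I (\<lambda>_. lborel)) \<Longrightarrow>
      f x * g y \<le> (h (\<lambda>i\<in>I. (x i + y i) / 2))\<^sup>2"
  shows "(\<integral>\<^sup>+x. f x \<partial>Pi\<^sub>M I (\<lambda>_. lborel)) * (\<integral>\<^sup>+x. g x \<partial>Pi\<^sub>M I (\<lambda>_. lborel))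
    \<le> (\<integral>\<^sup>+x. h x \<partial>Pi\<^sub>M I (\<lambda>_. lborel))\<^sup>2"
  using assms
proof (induction I arbitrary: f g h rule: finite_induct)
  case empty
  have "restrict (\<lambda>i. (undefined + undefined) / 2) {} = (\<lambda>i::'i. undefined :: real)" by auto
  then show ?case
    using empty.prems(4)[of "\<lambda>_. undefined" "\<lambda>_. undefined"]
    by (simp add: PiM_empty nn_integral_count_space_finite)
next
  case (insert i I)
  note [measurable] = insert.prems(1-3)
  interpret product_sigma_finite "\<lambda>_::'i. lborel :: real measure" by standard
  have upd: "(\<lambda>x. F (x(i := y))) \<in> borel_measurable (Pi\<^sub>M I (\<lambda>_. lborel))"
    if F: "F \<in> borel_measurable (Pi\<^sub>M (insert i I) (\<lambda>_. lborel))" for F :: "('i \<Rightarrow> real) \<Rightarrow> ennreal" and y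
    by (rule measurable_compose[OF measurable_fun_upd[where J = I] F]) auto
  have slices: "(\<lambda>y. \<integral>\<^sup>+x. F (x(i := y)) \<partial>Pi\<^sub>M I (\<lambda>_. lborel)) \<in> borel_measurable borel"
    if [measurable]: "F \<in> borel_measurable (Pi\<^sub>M (insert i I) (\<lambda>_. lborel))" for F :: "('i \<Rightarrow> real) \<Rightarrow> ennreal"
  proof -
    interpret I: finite_product_sigma_finite "\<lambda>_::'i. lborel :: real measure" I
      using insert.hyps by unfold_locales
    have "(\<lambda>y. \<integral>\<^sup>+x. F (x(i := y)) \<partial>Pi\<^sub>M I (\<lambda>_. lborel)) \<in> borel_measurable lborel"
      by measurable
    then show ?thesis by simp
  qed
  have "(\<integral>\<^sup>+x. f (x(i := a)) \<partial>Pi\<^sub>M I (\<lambda>_. lborel)) * (\<integral>\<^sup>+x. g (x(i := b)) \<partial>Pi\<^sub>M I (\<lambda>_. lborel))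
    \<le> (\<integral>\<^sup>+x. h (x(i := (a + b) / 2)) \<partial>Pi\<^sub>M I (\<lambda>_. lborel))\<^sup>2" for a b
  proof (rule insert.IH)
    fix x y assume xy: "x \<in> space (Pi\<^sub>M I (\<lambda>_. lborel :: real measure))"
      "y \<in> space (Pi\<^sub>M I (\<lambda>_. lborel :: real measure))"
    have "(\<lambda>j\<in>insert i I. ((x(i := a)) j + (y(i := b)) j) / 2) =
        (\<lambda>j\<in>I. (x j + y j) / 2)(i := (a + b) / 2)"
      using insert.hyps by (auto simp: fun_eq_iff restrict_def)
    moreover have "x(i := a) \<in> space (Pi\<^sub>M (insert i I) (\<lambda>_. lborel :: real measure))"
      "y(i := b) \<in> space (Pi\<^sub>M (insert i I) (\<lambda>_. lborel :: real measure))"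
      using xy by (auto simp: space_PiM PiE_def extensional_def)
    ultimately show "f (x(i := a)) * g (y(i := b)) \<le> (h ((\<lambda>j\<in>I. (x j + y j) / 2)(i := (a + b) / 2)))\<^sup>2"
      using insert.prems(4)[of "x(i := a)" "y(i := b)"] by (simp only:)
  qed (intro upd insert.prems)+
  then have "(\<integral>\<^sup>+a. (\<integral>\<^sup>+x. f (x(i := a)) \<partial>Pi\<^sub>M I (\<lambda>_. lborel)) \<partial>lborel) *
      (\<integral>\<^sup>+b. (\<integral>\<^sup>+x. g (x(i := b)) \<partial>Pi\<^sub>M I (\<lambda>_. lborel)) \<partial>lborel)
    \<le> (\<integral>\<^sup>+c. (\<integral>\<^sup>+x. h (x(i := c)) \<partial>Pi\<^sub>M I (\<lambda>_. lborel)) \<partial>lborel)\<^sup>2"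
    by (intro prekopa_leindler_real slices insert.prems) auto
  then show ?case
    using insert.hyps insert.prems by (simp add: product_nn_integral_insert_rev)
qed

theorem prekopa_leindler:
  fixes f g h :: "'a::euclidean_space \<Rightarrow> ennreal"
  assumes [measurable]: "f \<in> borel_measurable borel" "g \<in> borel_measurable borel"
      "h \<in> borel_measurable borel"
    and fgh: "\<And>x y. f x * g y \<le> (h ((1 / 2) *\<^sub>R (x + y)))\<^sup>2"
  shows "(\<integral>\<^sup>+x. f x \<partial>lborel) * (\<integral>\<^sup>+x. g x \<partial>lborel) \<le> (\<integral>\<^sup>+x. h x \<partial>lborel)\<^sup>2"
proof -
  let ?T = "\<lambda>x. \<Sum>b\<in>Basis. x b *\<^sub>R b :: 'a"
  have int: "(\<integral>\<^sup>+x. F x \<partial>lborel) = (\<integral>\<^sup>+x. F (?T x) \<partial>Pi\<^sub>M Basis (\<lambda>_. lborel))"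
    if [measurable]: "F \<in> borel_measurable borel" for F :: "'a \<Rightarrow> ennreal"
    by (subst lborel_eq, subst nn_integral_distr) auto
  have "(\<integral>\<^sup>+x. f (?T x) \<partial>Pi\<^sub>M Basis (\<lambda>_. lborel)) * (\<integral>\<^sup>+x. g (?T x) \<partial>Pi\<^sub>M Basis (\<lambda>_. lborel))
      \<le> (\<integral>\<^sup>+x. h (?T x) \<partial>Pi\<^sub>M Basis (\<lambda>_. lborel))\<^sup>2"
  proof (rule prekopa_leindler_PiM)
    fix x y :: "'a \<Rightarrow> real"
    have "?T (\<lambda>i\<in>Basis. (x i + y i) / 2) = (1 / 2) *\<^sub>R (?T x + ?T y)"
      by (simp add: scaleR_sum_right sum.distrib[symmetric] algebra_simps add_divide_distrib
        cong: sum.cong)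
    then show "f (?T x) * g (?T y) \<le> (h (?T (\<lambda>i\<in>Basis. (x i + y i) / 2)))\<^sup>2"
      using fgh by simp
  qed auto
  then show ?thesis by (simp add: int)
qed

section \<open>Poincare inequality for strongly log-concave densities\<close>

text \<open>The remainder of order four is nonnegative for either sign of \<open>t\<close>. This
  matters since the bound is used at both \<epsilon> and -\<epsilon>; the quadratic polynomial is
  not a lower bound for negative \<open>t\<close>.\<close>

lemma exp_ge_taylor_cubic: "1 + t + t\<^sup>2 / 2 + t ^ 3 / 6 \<le> exp t" for t :: real
proof -
  obtain s where "exp t = (\<Sum>m<4. t ^ m / fact m) + exp s / fact 4 * t ^ 4"
    using Maclaurin_exp_le[of t 4] by auto
  moreover have "0 \<le> exp s / fact 4 * t ^ 4" by simp
  ultimately show ?thesis by (simp add: eval_nat_numeral fact_numeral)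
qed

context finite_measure begin

lemma integrable_bounded:
  fixes f :: "'a \<Rightarrow> real"
  assumes "f \<in> borel_measurable M" "\<And>x. \<bar>f x\<bar> \<le> c"
  shows "integrable M f"
  by (rule integrable_const_bound[where B = c]) (use assms in auto)

text \<open>Comparison of the coefficients of \<open>\<epsilon>\<^sup>2\<close>.\<close>

lemma centered_second_moment_le_of_exp_le:
  fixes \<phi> \<Gamma> :: "'a \<Rightarrow> real"
  assumes [measurable]: "\<phi> \<in> borel_measurable M" "\<Gamma> \<in> borel_measurable M"
    and bdd: "\<And>x. \<bar>\<phi> x\<bar> \<le> c" "\<And>x. 0 \<le> \<Gamma> x" "\<And>x. \<Gamma> x \<le> c"
    and centered: "(\<integral>x. \<phi> x \<partial>M) = 0"
    and pos: "0 < measure M (space M)"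
    and exp: "eventually (\<lambda>\<epsilon>. (\<integral>x. exp (\<epsilon> * \<phi> x) \<partial>M) * (\<integral>x. exp (- \<epsilon> * \<phi> x) \<partial>M)
      \<le> (\<integral>x. exp (\<epsilon>\<^sup>2 * \<Gamma> x) \<partial>M)\<^sup>2) (at_right 0)"
  shows "(\<integral>x. (\<phi> x)\<^sup>2 \<partial>M) \<le> 2 * (\<integral>x. \<Gamma> x \<partial>M)"
proof -
  define Z S T W V where "Z = measure M (space M)" and "S = (\<integral>x. (\<phi> x)\<^sup>2 \<partial>M)"
    and "T = (\<integral>x. (\<phi> x) ^ 3 \<partial>M)" and "W = (\<integral>x. \<Gamma> x \<partial>M)" and "V = (\<integral>x. (\<Gamma> x)\<^sup>2 \<partial>M)"
  have Z: "0 < Z" using pos by (simp add: Z_def)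
  have pw: "\<bar>\<phi> x ^ n\<bar> \<le> c ^ n" for x n
    using bdd(1)[of x] by (simp add: power_abs power_mono)
  have gw: "\<bar>\<Gamma> x ^ n\<bar> \<le> c ^ n" for x n
    using bdd(2,3)[of x] by (simp add: power_abs power_mono)
  have int: "integrable M (\<lambda>x. \<phi> x ^ n)" "integrable M (\<lambda>x. \<Gamma> x ^ n)" for n
    by (rule integrable_bounded[where c = "c ^ n"], simp, rule pw gw)+
  note int1 = int(1)[of 1, simplified] int(2)[of 1, simplified]
  have int_exp: "integrable M (\<lambda>x. exp (\<epsilon> * \<phi> x))" for \<epsilon>
  proof (rule integrable_bounded[where c = "exp (\<bar>\<epsilon>\<bar> * c)"])
    fix x
    have "\<epsilon> * \<phi> x \<le> \<bar>\<epsilon>\<bar> * \<bar>\<phi> x\<bar>" by (metis abs_ge_self abs_mult)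
    also have "\<dots> \<le> \<bar>\<epsilon>\<bar> * c" by (intro mult_left_mono bdd) auto
    finally show "\<bar>exp (\<epsilon> * \<phi> x)\<bar> \<le> exp (\<bar>\<epsilon>\<bar> * c)" by simp
  qed simp
  have int_expG: "integrable M (\<lambda>x. exp (\<epsilon>\<^sup>2 * \<Gamma> x))" for \<epsilon>
  proof (rule integrable_bounded[where c = "exp (\<epsilon>\<^sup>2 * c)"])
    show "\<bar>exp (\<epsilon>\<^sup>2 * \<Gamma> x)\<bar> \<le> exp (\<epsilon>\<^sup>2 * c)" for x
      using mult_left_mono[OF bdd(3), of "\<epsilon>\<^sup>2"] by simp
  qed simp
  have low: "Z + \<epsilon>\<^sup>2 * S / 2 + \<epsilon> ^ 3 * T / 6 \<le> (\<integral>x. exp (\<epsilon> * \<phi> x) \<partial>M)" for \<epsilon>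
  proof -
    have "(\<integral>x. 1 + \<epsilon> * \<phi> x + \<epsilon>\<^sup>2 / 2 * (\<phi> x)\<^sup>2 + \<epsilon> ^ 3 / 6 * \<phi> x ^ 3 \<partial>M) \<le> (\<integral>x. exp (\<epsilon> * \<phi> x) \<partial>M)"
    proof (rule integral_mono)
      show "1 + \<epsilon> * \<phi> x + \<epsilon>\<^sup>2 / 2 * (\<phi> x)\<^sup>2 + \<epsilon> ^ 3 / 6 * \<phi> x ^ 3 \<le> exp (\<epsilon> * \<phi> x)" for x
        using exp_ge_taylor_cubic[of "\<epsilon> * \<phi> x"] by (simp add: power_mult_distrib)
      show "integrable M (\<lambda>x. 1 + \<epsilon> * \<phi> x + \<epsilon>\<^sup>2 / 2 * (\<phi> x)\<^sup>2 + \<epsilon> ^ 3 / 6 * \<phi> x ^ 3)"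
        by (intro Bochner_Integration.integrable_add integrable_mult_right int int1) simp
    qed (rule int_exp)
    moreover have "(\<integral>x. 1 + \<epsilon> * \<phi> x + \<epsilon>\<^sup>2 / 2 * (\<phi> x)\<^sup>2 + \<epsilon> ^ 3 / 6 * \<phi> x ^ 3 \<partial>M)
        = Z + \<epsilon> * 0 + \<epsilon>\<^sup>2 / 2 * S + \<epsilon> ^ 3 / 6 * T"
      unfolding Z_def S_def T_def centered[symmetric]
      using int int1 by simp
    ultimately show ?thesis by (simp add: field_simps)
  qed
  \<comment> \<open>The restriction keeps the exponent in [0, 1], where exp y \<le> 1 + y +
    y^2.\<close>
  have up: "(\<integral>x. exp (\<epsilon>\<^sup>2 * \<Gamma> x) \<partial>M) \<le> Z + \<epsilon>\<^sup>2 * (W + \<epsilon>\<^sup>2 * V)" if "\<epsilon>\<^sup>2 * c \<le> 1" for \<epsilon>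
  proof -
    have "(\<integral>x. exp (\<epsilon>\<^sup>2 * \<Gamma> x) \<partial>M) \<le> (\<integral>x. 1 + \<epsilon>\<^sup>2 * \<Gamma> x + \<epsilon> ^ 4 * (\<Gamma> x)\<^sup>2 \<partial>M)"
    proof (rule integral_mono)
      show "exp (\<epsilon>\<^sup>2 * \<Gamma> x) \<le> 1 + \<epsilon>\<^sup>2 * \<Gamma> x + \<epsilon> ^ 4 * (\<Gamma> x)\<^sup>2" for x
      proof -
        have "\<epsilon>\<^sup>2 * \<Gamma> x \<le> 1"
          using mult_left_mono[OF bdd(3), of "\<epsilon>\<^sup>2" x] that by simp
        then show ?thesis
          using exp_bound[of "\<epsilon>\<^sup>2 * \<Gamma> x"] bdd(2)[of x] by (simp add: power_mult_distrib)
      qed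
      show "integrable M (\<lambda>x. 1 + \<epsilon>\<^sup>2 * \<Gamma> x + \<epsilon> ^ 4 * (\<Gamma> x)\<^sup>2)"
        by (intro Bochner_Integration.integrable_add integrable_mult_right int int1) simp
    qed (rule int_expG)
    also have "\<dots> = Z + \<epsilon>\<^sup>2 * W + \<epsilon> ^ 4 * V"
      unfolding Z_def W_def V_def using int int1 by simp
    finally show ?thesis by (simp add: algebra_simps power2_eq_square power4_eq_xxxx)
  qed
  \<comment> \<open>The lower bounds at \<epsilon> and -\<epsilon> have to be positive before they
    may be multiplied.\<close>
  have ev1: "eventually (\<lambda>\<epsilon>. 0 < Z + \<epsilon>\<^sup>2 * S / 2 + \<epsilon> ^ 3 * T / 6) (at_right 0)"
  proof (rule order_tendstoD(1)[of _ Z])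
    show "((\<lambda>\<epsilon>. Z + \<epsilon>\<^sup>2 * S / 2 + \<epsilon> ^ 3 * T / 6) \<longlongrightarrow> Z) (at_right 0)"
      by (auto intro!: tendsto_eq_intros)
  qed (rule Z)
  have ev2: "eventually (\<lambda>\<epsilon>. 0 < Z + \<epsilon>\<^sup>2 * S / 2 - \<epsilon> ^ 3 * T / 6) (at_right 0)"
  proof (rule order_tendstoD(1)[of _ Z])
    show "((\<lambda>\<epsilon>. Z + \<epsilon>\<^sup>2 * S / 2 - \<epsilon> ^ 3 * T / 6) \<longlongrightarrow> Z) (at_right 0)"
      by (auto intro!: tendsto_eq_intros)
  qed (rule Z)
  have ev3: "eventually (\<lambda>\<epsilon>. \<epsilon>\<^sup>2 * c < 1) (at_right 0)"
  proof (rule order_tendstoD(2)[of _ 0])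
    show "((\<lambda>\<epsilon>. \<epsilon>\<^sup>2 * c) \<longlongrightarrow> 0) (at_right 0)"
      by (auto intro!: tendsto_eq_intros)
  qed simp
  have ev4: "eventually (\<lambda>\<epsilon>::real. 0 < \<epsilon>) (at_right 0)" by (rule eventually_at_right_less)
  have "eventually (\<lambda>\<epsilon>. Z * S + \<epsilon>\<^sup>2 * (S\<^sup>2 / 4) - \<epsilon> ^ 4 * (T\<^sup>2 / 36)
      \<le> 2 * Z * (W + \<epsilon>\<^sup>2 * V) + \<epsilon>\<^sup>2 * (W + \<epsilon>\<^sup>2 * V)\<^sup>2) (at_right 0)"
    using exp ev1 ev2 ev3 ev4
  proof eventually_elim
    case (elim \<epsilon>)
    have "(Z + \<epsilon>\<^sup>2 * S / 2 + \<epsilon> ^ 3 * T / 6) * (Z + \<epsilon>\<^sup>2 * S / 2 - \<epsilon> ^ 3 * T / 6)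
        \<le> (\<integral>x. exp (\<epsilon> * \<phi> x) \<partial>M) * (\<integral>x. exp (- \<epsilon> * \<phi> x) \<partial>M)"
      using low[of \<epsilon>] low[of "- \<epsilon>"] elim by (intro mult_mono) auto
    also have "\<dots> \<le> (Z + \<epsilon>\<^sup>2 * (W + \<epsilon>\<^sup>2 * V))\<^sup>2"
      using elim up[of \<epsilon>] by (elim order_trans, intro power_mono) auto
    finally have "(Z + \<epsilon>\<^sup>2 * S / 2 + \<epsilon> ^ 3 * T / 6) * (Z + \<epsilon>\<^sup>2 * S / 2 - \<epsilon> ^ 3 * T / 6) - Z\<^sup>2
        \<le> (Z + \<epsilon>\<^sup>2 * (W + \<epsilon>\<^sup>2 * V))\<^sup>2 - Z\<^sup>2" by simp
    \<comment> \<open>A difference of squares: the cubic terms cancel up to order six, so after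
      division by the square of \<epsilon> only \<open>Z * S\<close> survives in the limit.\<close>
    moreover have "(Z + \<epsilon>\<^sup>2 * S / 2 + \<epsilon> ^ 3 * T / 6) * (Z + \<epsilon>\<^sup>2 * S / 2 - \<epsilon> ^ 3 * T / 6) - Z\<^sup>2
        = \<epsilon>\<^sup>2 * (Z * S + \<epsilon>\<^sup>2 * (S\<^sup>2 / 4) - \<epsilon> ^ 4 * (T\<^sup>2 / 36))"
      by (simp add: field_simps eval_nat_numeral)
    moreover have "(Z + \<epsilon>\<^sup>2 * (W + \<epsilon>\<^sup>2 * V))\<^sup>2 - Z\<^sup>2
        = \<epsilon>\<^sup>2 * (2 * Z * (W + \<epsilon>\<^sup>2 * V) + \<epsilon>\<^sup>2 * (W + \<epsilon>\<^sup>2 * V)\<^sup>2)"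
      by (simp add: algebra_simps power2_eq_square)
    ultimately have "\<epsilon>\<^sup>2 * (Z * S + \<epsilon>\<^sup>2 * (S\<^sup>2 / 4) - \<epsilon> ^ 4 * (T\<^sup>2 / 36))
      \<le> \<epsilon>\<^sup>2 * (2 * Z * (W + \<epsilon>\<^sup>2 * V) + \<epsilon>\<^sup>2 * (W + \<epsilon>\<^sup>2 * V)\<^sup>2)"
      by linarith
    then show ?case using elim by (simp add: mult_le_cancel_left)
  qed
  then have "Z * S \<le> 2 * Z * W"
  proof (rule tendsto_le[rotated 3])
    show "((\<lambda>\<epsilon>. Z * S + \<epsilon>\<^sup>2 * (S\<^sup>2 / 4) - \<epsilon> ^ 4 * (T\<^sup>2 / 36)) \<longlongrightarrow> Z * S) (at_right 0)"
      by (auto intro!: tendsto_eq_intros)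
    show "((\<lambda>\<epsilon>. 2 * Z * (W + \<epsilon>\<^sup>2 * V) + \<epsilon>\<^sup>2 * (W + \<epsilon>\<^sup>2 * V)\<^sup>2) \<longlongrightarrow> 2 * Z * W) (at_right 0)"
      by (auto intro!: tendsto_eq_intros)
  qed simp
  then have "Z * S \<le> Z * (2 * W)" by simp
  then show ?thesis using Z unfolding S_def W_def by (simp only: mult_le_cancel_left_pos)
qed

text \<open>Centring \<phi> multiplies the two exponential integrals by reciprocal constants, so the
  hypothesis is invariant under it. Writing the mass as a factor avoids normalization and includes
  the zero measure.\<close>

lemma variance_le_of_exp_le:
  fixes \<phi> \<Gamma> :: "'a \<Rightarrow> real"
  assumes [measurable]: "\<phi> \<in> borel_measurable M" "\<Gamma> \<in> borel_measurable M"
    and bdd: "\<And>x. \<bar>\<phi> x\<bar> \<le> c" "\<And>x. 0 \<le> \<Gamma> x" "\<And>x. \<Gamma> x \<le> c"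
    and exp: "eventually (\<lambda>\<epsilon>. (\<integral>x. exp (\<epsilon> * \<phi> x) \<partial>M) * (\<integral>x. exp (- \<epsilon> * \<phi> x) \<partial>M)
      \<le> (\<integral>x. exp (\<epsilon>\<^sup>2 * \<Gamma> x) \<partial>M)\<^sup>2) (at_right 0)"
  shows "measure M (space M) * (\<integral>x. (\<phi> x)\<^sup>2 \<partial>M) - (\<integral>x. \<phi> x \<partial>M)\<^sup>2
      \<le> 2 * measure M (space M) * (\<integral>x. \<Gamma> x \<partial>M)"
proof (cases "measure M (space M) = 0")
  case True
  then show ?thesis by simp
next
  case False
  define Z where "Z = measure M (space M)"
  have Z: "0 < Z" using False by (simp add: Z_def zero_less_measure_iff)
  define a where "a = (\<integral>x. \<phi> x \<partial>M) / Z"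
  have int: "integrable M \<phi>" "integrable M (\<lambda>x. (\<phi> x)\<^sup>2)"
  proof -
    show "integrable M \<phi>" by (rule integrable_bounded[OF _ bdd(1)]) simp
    show "integrable M (\<lambda>x. (\<phi> x)\<^sup>2)"
      by (rule integrable_bounded[where c = "c\<^sup>2"]) (use bdd(1) in \<open>auto simp: abs_le_square_iff intro!: power2_le_iff_abs_le[THEN iffD2] order_trans[OF abs_ge_zero bdd(1)]\<close>)
  qed
  have "(\<integral>x. (\<phi> x - a)\<^sup>2 \<partial>M) \<le> 2 * (\<integral>x. \<Gamma> x \<partial>M)"
  proof (rule centered_second_moment_le_of_exp_le[where c = "c + \<bar>a\<bar>"])
    show "(\<integral>x. \<phi> x - a \<partial>M) = 0" using int Z by (simp add: a_def Z_def)
    show "\<bar>\<phi> x - a\<bar> \<le> c + \<bar>a\<bar>" for x using bdd(1)[of x] by linarith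
    show "0 \<le> \<Gamma> x" "\<Gamma> x \<le> c + \<bar>a\<bar>" for x using bdd(2,3)[of x] by linarith+
    have "(\<integral>x. exp (\<epsilon> * (\<phi> x - a)) \<partial>M) * (\<integral>x. exp (- \<epsilon> * (\<phi> x - a)) \<partial>M) =
       (\<integral>x. exp (\<epsilon> * \<phi> x) \<partial>M) * (\<integral>x. exp (- \<epsilon> * \<phi> x) \<partial>M)" for \<epsilon>
    proof -
      have "(\<integral>x. exp (\<epsilon> * (\<phi> x - a)) \<partial>M) = exp (- (\<epsilon> * a)) * (\<integral>x. exp (\<epsilon> * \<phi> x) \<partial>M)" for \<epsilon>
        by (subst integral_mult_right_zero[symmetric]) (simp add: right_diff_distrib exp_diff exp_minus field_simps)
      from this[of \<epsilon>] this[of "- \<epsilon>"] show ?thesis by (simp add: exp_minus field_simps)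
    qed
    then show "eventually (\<lambda>\<epsilon>. (\<integral>x. exp (\<epsilon> * (\<phi> x - a)) \<partial>M) * (\<integral>x. exp (- \<epsilon> * (\<phi> x - a)) \<partial>M)
      \<le> (\<integral>x. exp (\<epsilon>\<^sup>2 * \<Gamma> x) \<partial>M)\<^sup>2) (at_right 0)" using exp by simp
    show "0 < measure M (space M)" using Z by (simp add: Z_def)
  qed auto
  then have "Z * (\<integral>x. (\<phi> x - a)\<^sup>2 \<partial>M) \<le> Z * (2 * (\<integral>x. \<Gamma> x \<partial>M))"
    using Z by (intro mult_left_mono) auto
  moreover have "(\<integral>x. (\<phi> x - a)\<^sup>2 \<partial>M) = (\<integral>x. (\<phi> x)\<^sup>2 \<partial>M) - 2 * a * (\<integral>x. \<phi> x \<partial>M) + a\<^sup>2 * Z"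
    using int by (simp add: power2_diff Z_def mult.commute mult.left_commute)
  moreover have "Z * ((\<integral>x. (\<phi> x)\<^sup>2 \<partial>M) - 2 * a * (\<integral>x. \<phi> x \<partial>M) + a\<^sup>2 * Z) =
      Z * (\<integral>x. (\<phi> x)\<^sup>2 \<partial>M) - (\<integral>x. \<phi> x \<partial>M)\<^sup>2"
    using Z by (simp add: a_def field_simps power2_eq_square)
  ultimately show ?thesis by (simp add: Z_def mult_ac)
qed

end

lemma strongly_log_concave_midpoint:
  assumes "strongly_log_concave m p"
  shows "(ln (p (z + w)) + ln (p (z - w))) / 2 + m / 2 * (norm w)\<^sup>2 \<le> ln (p z)"
proof -
  have eq: "(1 / 2) *\<^sub>R (z + w) + (1 - 1 / 2) *\<^sub>R (z - w) = z"
    by (simp add: scaleR_right_diff_distrib scaleR_right_distrib flip: scaleR_left_distrib)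
  have nrm: "norm (z + w - (z - w)) = 2 * norm w"
    by (simp flip: scaleR_2)
  have "1 / 2 * ln (p (z + w)) + (1 - 1 / 2) * ln (p (z - w)) +
      m / 2 * (1 / 2) * (1 - 1 / 2) * (norm (z + w - (z - w)))\<^sup>2
    \<le> ln (p ((1 / 2) *\<^sub>R (z + w) + (1 - 1 / 2) *\<^sub>R (z - w)))"
    using assms unfolding strongly_log_concave_def
    by (elim allE[of _ "z + w"] allE[of _ "z - w"] allE[of _ "1 / 2"]) auto
  then show ?thesis unfolding eq nrm by (simp add: field_simps power2_eq_square)
qed

text \<open>\<open>G\<close> plays the role of |grad \<phi>|, but only through symmetric increments
  of size at most \<rho>. Longer increments are at most 2 c and are outweighed by the strong
  concavity gain m \<rho>^2 once \<epsilon> (2 c) < m \<rho>^2. Convexity of \<open>B\<close> keeps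
  the midpoint of two points of \<open>B\<close> inside, so the restricted density still satisfies
  the Prekopa-Leindler hypothesis; \<open>lip\<close> is required at midpoints in \<open>B\<close>
  only.\<close>

theorem strongly_log_concave_poincare:
  fixes p \<phi> G :: "'a::euclidean_space \<Rightarrow> real" and B :: "'a set"
  assumes [measurable]: "p \<in> borel_measurable borel" "\<phi> \<in> borel_measurable borel"
      "G \<in> borel_measurable borel" "B \<in> sets borel"
    and p_pos: "\<And>x. 0 < p x" and p_int: "integrable lborel p"
    and slc: "strongly_log_concave m p" and m: "0 < m" and B: "convex B"
    and bdd: "\<And>x. \<bar>\<phi> x\<bar> \<le> c" "\<And>x. 0 \<le> G x" "\<And>x. G x \<le> c"
    and \<rho>: "0 < \<rho>"
    and lip: "\<And>z w. z \<in> B \<Longrightarrow> norm w \<le> \<rho> \<Longrightarrow> \<phi> (z + w) - \<phi> (z - w) \<le> 2 * norm w * G z"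
  shows "m * ((LINT x:B|lborel. p x) * (LINT x:B|lborel. p x * (\<phi> x)\<^sup>2) - (LINT x:B|lborel. p x * \<phi> x)\<^sup>2)
    \<le> (LINT x:B|lborel. p x) * (LINT x:B|lborel. p x * (G x)\<^sup>2)"
proof -
  define P where "P x = indicator B x * p x" for x
  have P0: "0 \<le> P x" for x using p_pos[of x] by (simp add: P_def)
  have [measurable]: "P \<in> borel_measurable borel" unfolding P_def by simp
  define \<mu> where "\<mu> = density lborel (\<lambda>x. ennreal (P x))"
  have P_int: "integrable lborel P"
    unfolding P_def using integrable_mult_indicator[OF _ p_int, of B] by simp
  have sets [measurable_cong]: "sets \<mu> = sets borel" by (simp add: \<mu>_def)
  have int_mu: "(\<integral>x. \<psi> x \<partial>\<mu>) = (LINT x:B|lborel. p x * \<psi> x)"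
    if [measurable]: "\<psi> \<in> borel_measurable borel" for \<psi> :: "'a \<Rightarrow> real"
    unfolding \<mu>_def using P0
    by (subst integral_density) (auto simp: P_def set_lebesgue_integral_def mult_ac)
  interpret \<mu>: finite_measure \<mu>
  proof
    have "emeasure \<mu> (space \<mu>) = (\<integral>\<^sup>+x. ennreal (P x) \<partial>lborel)"
      by (simp add: \<mu>_def emeasure_density cong: nn_integral_cong)
    also have "\<dots> \<noteq> \<infinity>" using P_int P0 by (simp add: nn_integral_eq_integral)
    finally show "emeasure \<mu> (space \<mu>) \<noteq> \<infinity>" .
  qed
  have space: "space \<mu> = UNIV" by (simp add: \<mu>_def)
  have Z: "measure \<mu> (space \<mu>) = (LINT x:B|lborel. p x)"
    using int_mu[of "\<lambda>_. 1"] by simp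
  have c: "0 \<le> c" using bdd(1)[of undefined] by linarith
  have nn: "(\<integral>\<^sup>+x. ennreal (P x * \<psi> x) \<partial>lborel) = ennreal (\<integral>x. \<psi> x \<partial>\<mu>)"
    if [measurable]: "\<psi> \<in> borel_measurable borel" and "\<And>x. 0 \<le> \<psi> x" "\<And>x. \<psi> x \<le> b" for \<psi> :: "'a \<Rightarrow> real" and b
  proof -
    have "(\<integral>\<^sup>+x. ennreal (P x * \<psi> x) \<partial>lborel) = (\<integral>\<^sup>+x. ennreal (\<psi> x) \<partial>\<mu>)"
      unfolding \<mu>_def using P0 that by (subst nn_integral_density) (auto simp: ennreal_mult)
    also have "\<dots> = ennreal (\<integral>x. \<psi> x \<partial>\<mu>)"
      using that by (intro nn_integral_eq_integral \<mu>.integrable_bounded[where c = b])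
        (auto simp: abs_of_nonneg measurable_cong_sets[OF sets])
    finally show ?thesis .
  qed
  have exp_le: "(\<integral>x. exp (\<epsilon> * \<phi> x) \<partial>\<mu>) * (\<integral>x. exp (- \<epsilon> * \<phi> x) \<partial>\<mu>)
      \<le> (\<integral>x. exp (\<epsilon>\<^sup>2 * ((G x)\<^sup>2 / (2 * m))) \<partial>\<mu>)\<^sup>2"
    if \<epsilon>: "0 < \<epsilon>" "\<epsilon> * (2 * c) < m * \<rho>\<^sup>2" for \<epsilon>
  proof -
    define H where "H x = exp (\<epsilon>\<^sup>2 * ((G x)\<^sup>2 / (2 * m)))" for x
    have [measurable]: "H \<in> borel_measurable borel" unfolding H_def by measurable
    \<comment> \<open>Strong concavity yields \<open>m |w|\<^sup>2 / 2\<close> at the midpoint, which pays for the increment of \<open>\<phi>\<close>.\<close>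
    have gain: "\<epsilon> * (\<phi> (z + w) - \<phi> (z - w)) / 2 - m / 2 * (norm w)\<^sup>2 \<le> \<epsilon>\<^sup>2 * ((G z)\<^sup>2 / (2 * m))"
      if z: "z \<in> B" for z w
    proof (cases "norm w \<le> \<rho>")
      case True
      have "\<epsilon> * (\<phi> (z + w) - \<phi> (z - w)) \<le> \<epsilon> * (2 * norm w * G z)"
        using lip[OF z True] \<epsilon> by (intro mult_left_mono) auto
      \<comment> \<open>Completing the square, that is, maximizing the left side over the length of
        w.\<close>
      moreover have "0 \<le> (\<epsilon> * G z - m * norm w)\<^sup>2 / (2 * m)" using m by simp
      moreover have "(\<epsilon> * G z - m * norm w)\<^sup>2 / (2 * m) =
          \<epsilon>\<^sup>2 * ((G z)\<^sup>2 / (2 * m)) - \<epsilon> * norm w * G z + m / 2 * (norm w)\<^sup>2"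
        using m by (simp add: field_simps power2_eq_square)
      ultimately show ?thesis by linarith
    next
      case False
      have "\<phi> (z + w) - \<phi> (z - w) \<le> 2 * c" using bdd(1)[of "z + w"] bdd(1)[of "z - w"] by linarith
      then have "\<epsilon> * (\<phi> (z + w) - \<phi> (z - w)) \<le> \<epsilon> * (2 * c)" using \<epsilon> by (intro mult_left_mono) auto
      moreover have "m * \<rho>\<^sup>2 \<le> m * (norm w)\<^sup>2"
        using False m \<rho> by (intro mult_left_mono power_mono) auto
      moreover have "0 \<le> \<epsilon>\<^sup>2 * ((G z)\<^sup>2 / (2 * m))" using m by simp
      ultimately show ?thesis using \<epsilon> by linarith
    qed
    have "(\<integral>\<^sup>+x. ennreal (P x * exp (\<epsilon> * \<phi> x)) \<partial>lborel) * (\<integral>\<^sup>+x. ennreal (P x * exp (- \<epsilon> * \<phi> x)) \<partial>lborel)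
       \<le> (\<integral>\<^sup>+x. ennreal (P x * H x) \<partial>lborel)\<^sup>2"
    proof (rule prekopa_leindler)
      fix x y :: 'a
      define z w where "z = (1 / 2) *\<^sub>R (x + y)" and "w = (1 / 2) *\<^sub>R (x - y)"
      have xy: "x = z + w" "y = z - w"
        by (simp_all add: z_def w_def scaleR_right_diff_distrib scaleR_right_distrib flip: scaleR_left_distrib)
      have "P x * exp (\<epsilon> * \<phi> x) * (P y * exp (- \<epsilon> * \<phi> y)) \<le> (P z * H z)\<^sup>2"
      proof (cases "x \<in> B \<and> y \<in> B")
        case True
        have z: "z \<in> B"
          using convexD[OF B, of x y "1 / 2" "1 / 2"] True by (simp add: z_def scaleR_right_distrib)
        have "p x * exp (\<epsilon> * \<phi> x) * (p y * exp (- \<epsilon> * \<phi> y)) =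
            exp (ln (p x) + ln (p y) + \<epsilon> * (\<phi> x - \<phi> y))"
          using p_pos by (simp add: exp_add right_diff_distrib exp_diff exp_minus field_simps)
        also have "\<dots> \<le> exp (2 * (ln (p z) + \<epsilon>\<^sup>2 * ((G z)\<^sup>2 / (2 * m))))"
        proof -
          have "ln (p x) + ln (p y) + \<epsilon> * (\<phi> x - \<phi> y) \<le> 2 * (ln (p z) + \<epsilon>\<^sup>2 * ((G z)\<^sup>2 / (2 * m)))"
          using strongly_log_concave_midpoint[OF slc, of z w] gain[OF z, of w] unfolding xy by argo
          then show ?thesis by simp
        qed
        also have "\<dots> = (p z * H z)\<^sup>2"
          by (simp only: exp_double exp_add exp_ln[OF p_pos] H_def)
        finally show ?thesis using True z by (simp add: P_def)
      qed (auto simp: P_def)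
      then show "ennreal (P x * exp (\<epsilon> * \<phi> x)) * ennreal (P y * exp (- \<epsilon> * \<phi> y))
          \<le> (ennreal (P ((1 / 2) *\<^sub>R (x + y)) * H ((1 / 2) *\<^sub>R (x + y))))\<^sup>2"
        using P0 unfolding z_def[symmetric]
        by (simp add: ennreal_power H_def flip: ennreal_mult)
    qed measurable
    also have "(\<integral>\<^sup>+x. ennreal (P x * exp (\<epsilon> * \<phi> x)) \<partial>lborel) = ennreal (\<integral>x. exp (\<epsilon> * \<phi> x) \<partial>\<mu>)"
    proof (rule nn[where b = "exp (\<epsilon> * c)"])
      show "exp (\<epsilon> * \<phi> x) \<le> exp (\<epsilon> * c)" for x
        using bdd(1)[of x] \<epsilon> by (auto intro!: mult_left_mono)
    qed auto
    also have "(\<integral>\<^sup>+x. ennreal (P x * exp (- \<epsilon> * \<phi> x)) \<partial>lborel) = ennreal (\<integral>x. exp (- \<epsilon> * \<phi> x) \<partial>\<mu>)"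
    proof (rule nn[where b = "exp (\<epsilon> * c)"])
      have "\<epsilon> * (- \<phi> x) \<le> \<epsilon> * c" for x using bdd(1)[of x] \<epsilon> by (intro mult_left_mono) auto
      then show "exp (- \<epsilon> * \<phi> x) \<le> exp (\<epsilon> * c)" for x by simp
    qed auto
    also have "(\<integral>\<^sup>+x. ennreal (P x * H x) \<partial>lborel) = ennreal (\<integral>x. H x \<partial>\<mu>)"
    proof (rule nn[where b = "exp (\<epsilon>\<^sup>2 * (c\<^sup>2 / (2 * m)))"])
      have "(G x)\<^sup>2 \<le> c\<^sup>2" for x using bdd(2,3) by (intro power_mono) auto
      then show "H x \<le> exp (\<epsilon>\<^sup>2 * (c\<^sup>2 / (2 * m)))" for x
        unfolding H_def using m by (auto intro!: mult_left_mono divide_right_mono)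
    qed (auto simp: H_def)
    finally have "ennreal ((\<integral>x. exp (\<epsilon> * \<phi> x) \<partial>\<mu>) * (\<integral>x. exp (- \<epsilon> * \<phi> x) \<partial>\<mu>)) \<le> ennreal ((\<integral>x. H x \<partial>\<mu>)\<^sup>2)"
      by (simp add: ennreal_power ennreal_mult H_def)
    then show ?thesis unfolding H_def by (subst (asm) ennreal_le_iff) auto
  qed
  have "measure \<mu> (space \<mu>) * (\<integral>x. (\<phi> x)\<^sup>2 \<partial>\<mu>) - (\<integral>x. \<phi> x \<partial>\<mu>)\<^sup>2
      \<le> 2 * measure \<mu> (space \<mu>) * (\<integral>x. (G x)\<^sup>2 / (2 * m) \<partial>\<mu>)"
  proof (rule \<mu>.variance_le_of_exp_le[where c = "max c (c\<^sup>2 / (2 * m))"])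
    show "\<bar>\<phi> x\<bar> \<le> max c (c\<^sup>2 / (2 * m))" for x using bdd(1)[of x] by simp
    show "0 \<le> (G x)\<^sup>2 / (2 * m)" for x using m by simp
    have "(G x)\<^sup>2 \<le> c\<^sup>2" for x using bdd(2,3) by (intro power_mono) auto
    then have "(G x)\<^sup>2 / (2 * m) \<le> c\<^sup>2 / (2 * m)" for x using m by (intro divide_right_mono) auto
    then show "(G x)\<^sup>2 / (2 * m) \<le> max c (c\<^sup>2 / (2 * m))" for x by (simp add: le_max_iff_disj)
    have "eventually (\<lambda>\<epsilon>. \<epsilon> * (2 * c) < m * \<rho>\<^sup>2) (at_right 0)"
    proof (rule order_tendstoD(2)[of _ 0])
      show "((\<lambda>\<epsilon>. \<epsilon> * (2 * c)) \<longlongrightarrow> 0) (at_right 0)" by (auto intro!: tendsto_eq_intros)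
    qed (use m \<rho> in auto)
    then show "eventually (\<lambda>\<epsilon>. (\<integral>x. exp (\<epsilon> * \<phi> x) \<partial>\<mu>) * (\<integral>x. exp (- \<epsilon> * \<phi> x) \<partial>\<mu>)
      \<le> (\<integral>x. exp (\<epsilon>\<^sup>2 * ((G x)\<^sup>2 / (2 * m))) \<partial>\<mu>)\<^sup>2) (at_right 0)"
      using eventually_at_right_less[of 0] by eventually_elim (rule exp_le)
  qed auto
  moreover have "(\<integral>x. (G x)\<^sup>2 / (2 * m) \<partial>\<mu>) = (LINT x:B|lborel. p x * (G x)\<^sup>2) / (2 * m)"
    by (subst integral_divide_zero) (simp add: int_mu)
  ultimately have "(LINT x:B|lborel. p x) * (LINT x:B|lborel. p x * (\<phi> x)\<^sup>2) - (LINT x:B|lborel. p x * \<phi> x)\<^sup>2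
    \<le> (LINT x:B|lborel. p x) * (LINT x:B|lborel. p x * (G x)\<^sup>2) / m"
    by (simp add: Z int_mu)
  then show ?thesis using m by (simp add: pos_le_divide_eq mult.commute)
qed

section \<open>Gaussian integrals\<close>

definition gauss :: "'a::euclidean_space \<Rightarrow> real" where
  "gauss x = (2 * pi) powr (- real DIM('a) / 2) * exp (- (norm x)\<^sup>2 / 2)"

lemma gauss_pos: "0 < gauss x"
  by (simp add: gauss_def)

lemma gauss_nonneg [simp]: "0 \<le> gauss x"
  using gauss_pos[of x] by linarith

lemma gauss_measurable [measurable]: "gauss \<in> borel_measurable borel"
  unfolding gauss_def by measurable

lemma nn_integral_exp_quadratic_real:
  assumes s: "0 < s"
  shows "(\<integral>\<^sup>+x. ennreal (exp (b * x - s * x\<^sup>2 / 2)) \<partial>lborel) =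
    ennreal (exp (b\<^sup>2 / (2 * s)) * (2 * pi / s) powr (1 / 2))"
proof -
  define C where "C = exp (b\<^sup>2 / (2 * s)) * sqrt (2 * pi / s)"
  have eq: "exp (b * x - s * x\<^sup>2 / 2) = C * normal_density (b / s) (1 / sqrt s) x" for x
  proof -
    have "C * normal_density (b / s) (1 / sqrt s) x =
        exp (b\<^sup>2 / (2 * s)) * exp (- ((x - b / s)\<^sup>2 * s / 2))"
      using s by (simp add: C_def normal_density_def real_sqrt_divide field_simps)
    also have "\<dots> = exp (b\<^sup>2 / (2 * s) - (x - b / s)\<^sup>2 * s / 2)"
      by (simp only: mult_exp_exp diff_conv_add_uminus)
    also have "b\<^sup>2 / (2 * s) - (x - b / s)\<^sup>2 * s / 2 = b * x - s * x\<^sup>2 / 2"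
      using s by (simp add: field_simps power2_eq_square)
    finally show ?thesis by simp
  qed
  have C: "0 \<le> C" using s by (simp add: C_def)
  have "(\<integral>\<^sup>+x. ennreal (exp (b * x - s * x\<^sup>2 / 2)) \<partial>lborel)
      = ennreal (\<integral>x. C * normal_density (b / s) (1 / sqrt s) x \<partial>lborel)"
    unfolding eq using s C by (intro nn_integral_eq_integral) (auto intro!: AE_I2)
  also have "\<dots> = ennreal C" using s by simp
  finally show ?thesis using s by (simp add: C_def powr_half_sqrt)
qed

lemma nn_integral_exp_quadratic:
  fixes b :: "'a::euclidean_space"
  assumes s: "0 < s"
  shows "(\<integral>\<^sup>+x. ennreal (exp (b \<bullet> x - s * (norm x)\<^sup>2 / 2)) \<partial>lborel) =
    ennreal (exp ((norm b)\<^sup>2 / (2 * s)) * (2 * pi / s) powr (real DIM('a) / 2))"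
proof -
  interpret product_sigma_finite "\<lambda>_::'a. lborel :: real measure" by standard
  let ?T = "\<lambda>x. \<Sum>i\<in>Basis. x i *\<^sub>R i :: 'a"
  have "(\<integral>\<^sup>+x. ennreal (exp (b \<bullet> x - s * (norm x)\<^sup>2 / 2)) \<partial>lborel) =
      (\<integral>\<^sup>+x. ennreal (exp (b \<bullet> ?T x - s * (norm (?T x))\<^sup>2 / 2)) \<partial>Pi\<^sub>M Basis (\<lambda>_. lborel))"
    by (subst lborel_eq, subst nn_integral_distr) auto
  also have "\<dots> = (\<integral>\<^sup>+x. (\<Prod>i\<in>Basis. ennreal (exp ((b \<bullet> i) * x i - s * (x i)\<^sup>2 / 2))) \<partial>Pi\<^sub>M Basis (\<lambda>_. lborel))"
  proof (rule nn_integral_cong)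
    fix x :: "'a \<Rightarrow> real"
    have "b \<bullet> ?T x = (\<Sum>i\<in>Basis. (b \<bullet> i) * x i)"
      by (simp add: inner_sum_right mult.commute)
    moreover have "(norm (?T x))\<^sup>2 = (\<Sum>i\<in>Basis. (x i)\<^sup>2)"
      by (simp add: norm_eq_sqrt_inner[of "?T x"] euclidean_inner[of "?T x" "?T x"] sum_nonneg power2_eq_square)
    ultimately have "exp (b \<bullet> ?T x - s * (norm (?T x))\<^sup>2 / 2) = (\<Prod>i\<in>Basis. exp ((b \<bullet> i) * x i - s * (x i)\<^sup>2 / 2))"
      by (simp add: exp_sum[symmetric] sum_subtractf sum_distrib_left sum_divide_distrib)
    then show "ennreal (exp (b \<bullet> ?T x - s * (norm (?T x))\<^sup>2 / 2)) =
        (\<Prod>i\<in>Basis. ennreal (exp ((b \<bullet> i) * x i - s * (x i)\<^sup>2 / 2)))"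
      by (simp add: prod_ennreal)
  qed
  also have "\<dots> = (\<Prod>i\<in>(Basis::'a set). ennreal (exp ((b \<bullet> i)\<^sup>2 / (2 * s)) * (2 * pi / s) powr (1 / 2)))"
    using s by (subst product_nn_integral_prod) (auto simp: nn_integral_exp_quadratic_real)
  also have "\<dots> = ennreal (\<Prod>i\<in>(Basis::'a set). exp ((b \<bullet> i)\<^sup>2 / (2 * s)) * (2 * pi / s) powr (1 / 2))"
    using s by (intro prod_ennreal) auto
  also have "(\<Prod>i\<in>(Basis::'a set). exp ((b \<bullet> i)\<^sup>2 / (2 * s)) * (2 * pi / s) powr (1 / 2)) =
      exp (\<Sum>i\<in>Basis. (b \<bullet> i)\<^sup>2 / (2 * s)) * ((2 * pi / s) powr (1 / 2)) ^ DIM('a)"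
    by (simp add: prod.distrib exp_sum)
  also have "(\<Sum>i\<in>Basis. (b \<bullet> i)\<^sup>2 / (2 * s)) = (norm b)\<^sup>2 / (2 * s)"
    unfolding power2_norm_eq_inner
    by (subst (2) euclidean_inner) (simp only: sum_divide_distrib power2_eq_square)
  also have "((2 * pi / s) powr (1 / 2)) ^ DIM('a) = (2 * pi / s) powr (real DIM('a) / 2)"
    using s by (simp add: powr_realpow[symmetric] powr_powr)
  finally show ?thesis .
qed

lemma gauss_exp_quadratic:
  fixes b :: "'a::euclidean_space"
  assumes c: "2 * c < 1"
  shows "has_bochner_integral lborel (\<lambda>x. gauss x * exp (b \<bullet> x + c * (norm x)\<^sup>2))
    ((1 - 2 * c) powr (- real DIM('a) / 2) * exp ((norm b)\<^sup>2 / (2 * (1 - 2 * c))))"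
proof (rule has_bochner_integral_nn_integral)
  let ?s = "1 - 2 * c" and ?k = "(2 * pi) powr (- real DIM('a) / 2)"
  have "(\<integral>\<^sup>+x. ennreal (gauss x * exp (b \<bullet> x + c * (norm x)\<^sup>2)) \<partial>lborel) =
      (\<integral>\<^sup>+x. ennreal ?k * ennreal (exp (b \<bullet> x - ?s * (norm x)\<^sup>2 / 2)) \<partial>lborel)"
  proof (intro nn_integral_cong)
    fix x :: 'a
    have "b \<bullet> x - ?s * (norm x)\<^sup>2 / 2 = - (norm x)\<^sup>2 / 2 + (b \<bullet> x + c * (norm x)\<^sup>2)"
      by (simp add: field_simps)
    then have "gauss x * exp (b \<bullet> x + c * (norm x)\<^sup>2) = ?k * exp (b \<bullet> x - ?s * (norm x)\<^sup>2 / 2)"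
      by (simp only: gauss_def exp_add mult.assoc)
    then show "ennreal (gauss x * exp (b \<bullet> x + c * (norm x)\<^sup>2)) =
        ennreal ?k * ennreal (exp (b \<bullet> x - ?s * (norm x)\<^sup>2 / 2))"
      by (simp add: ennreal_mult)
  qed
  also have "\<dots> = ennreal (?k * (exp ((norm b)\<^sup>2 / (2 * ?s)) * (2 * pi / ?s) powr (real DIM('a) / 2)))"
    using c by (simp add: nn_integral_cmult nn_integral_exp_quadratic ennreal_mult)
  also have "?k * (exp ((norm b)\<^sup>2 / (2 * ?s)) * (2 * pi / ?s) powr (real DIM('a) / 2)) =
      ?s powr (- real DIM('a) / 2) * exp ((norm b)\<^sup>2 / (2 * ?s))"
    using c by (simp add: powr_divide powr_minus field_simps)
  finally show "(\<integral>\<^sup>+x. ennreal (gauss x * exp (b \<bullet> x + c * (norm x)\<^sup>2)) \<partial>lborel) =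
    ennreal ((1 - 2 * c) powr (- real DIM('a) / 2) * exp ((norm b)\<^sup>2 / (2 * (1 - 2 * c))))" .
qed auto

lemma gauss_exp_linear:
  fixes b :: "'a::euclidean_space"
  shows "has_bochner_integral lborel (\<lambda>x. gauss x * exp (b \<bullet> x)) (exp ((norm b)\<^sup>2 / 2))"
  using gauss_exp_quadratic[of 0 b] by simp

lemma gauss_integral: "has_bochner_integral lborel (gauss :: 'a::euclidean_space \<Rightarrow> real) 1"
  using gauss_exp_linear[of "0::'a"] by simp

lemma gauss_exp_quadratic_le:
  fixes b :: "'a::euclidean_space"
  \<comment> \<open>With s = 1 - 5 / (16 d), Bernoulli gives s^d \<ge> 11/16 for every dimension d.
    Hence the prefactor is at most sqrt (16/11) < 121/100, and s \<ge> 11/16 gives 1 / (2 s) \<le>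
    8/11.\<close>
  defines "F \<equiv> \<lambda>x. gauss x * exp (b \<bullet> x + 5 / (32 * real DIM('a)) * (norm x)\<^sup>2)"
  shows "integrable lborel F" "(\<integral>x. F x \<partial>lborel) \<le> 121 / 100 * exp (8 / 11 * (norm b)\<^sup>2)"
proof -
  define d where "d = real DIM('a)"
  define s where "s = 1 - 2 * (5 / (32 * d))"
  have d: "1 \<le> d" unfolding d_def using DIM_positive[where 'a='a] by linarith
  have s: "11 / 16 \<le> s" using d by (simp add: s_def field_simps)
  have c: "2 * (5 / (32 * d)) < 1" using s by (simp add: s_def)
  have F: "has_bochner_integral lborel F (s powr (- d / 2) * exp ((norm b)\<^sup>2 / (2 * s)))"
    using gauss_exp_quadratic[OF c, of b] unfolding F_def s_def d_def .
  then show "integrable lborel F" by (simp add: has_bochner_integral_iff)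
  have "1 + real DIM('a) * (- (5 / (16 * d))) \<le> (1 + - (5 / (16 * d))) ^ DIM('a)"
    using d by (intro Bernoulli_inequality) (simp add: field_simps)
  then have "11 / 16 \<le> s ^ DIM('a)"
    by (simp add: s_def d_def)
  then have sd: "11 / 16 \<le> s powr d" using s by (simp add: d_def powr_realpow)
  have "(s powr (- d / 2))\<^sup>2 = 1 / s powr d"
    using s by (simp add: powr_minus_divide power_divide powr_power)
  also have "\<dots> \<le> 1 / (11 / 16)"
    using sd by (intro divide_left_mono) auto
  also have "\<dots> \<le> (121 / 100)\<^sup>2" by (simp add: power2_eq_square)
  finally have "s powr (- d / 2) \<le> 121 / 100"
    by (rule power2_le_imp_le) simp
  moreover have "(norm b)\<^sup>2 / (2 * s) \<le> 8 / 11 * (norm b)\<^sup>2"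
  proof -
    have "(norm b)\<^sup>2 / (2 * s) \<le> (norm b)\<^sup>2 / (11 / 8)"
      using s by (intro divide_left_mono) auto
    then show ?thesis by simp
  qed
  ultimately have "s powr (- d / 2) * exp ((norm b)\<^sup>2 / (2 * s)) \<le> 121 / 100 * exp (8 / 11 * (norm b)\<^sup>2)"
    by (intro mult_mono) auto
  then show "(\<integral>x. F x \<partial>lborel) \<le> 121 / 100 * exp (8 / 11 * (norm b)\<^sup>2)"
    using has_bochner_integral_integral_eq[OF F] by simp
qed

text \<open>The tangent line inequality for exp, with equality at |x| = a. The choices a = 3 for the
  second moment and a = 1 for the first both lead to exponential tilts by e / 2 and -e / 2.\<close>

lemma one_plus_abs_le_exp: "0 \<le> a \<Longrightarrow> 1 + \<bar>x\<bar> \<le> (a + 1) * exp ((\<bar>x\<bar> - a) / (a + 1))" for x a :: real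
proof -
  assume a: "0 \<le> a"
  have "(a + 1) * (1 + (\<bar>x\<bar> - a) / (a + 1)) \<le> (a + 1) * exp ((\<bar>x\<bar> - a) / (a + 1))"
    using a exp_ge_add_one_self by (intro mult_left_mono) auto
  moreover have "(a + 1) * (1 + (\<bar>x\<bar> - a) / (a + 1)) = 1 + \<bar>x\<bar>"
    using a by (simp add: field_simps)
  ultimately show ?thesis by simp
qed

lemma exp_abs_le: "exp \<bar>x\<bar> \<le> exp x + exp (- x)" for x :: real
  by (cases "0 \<le> x") auto

text \<open>Upper bound for \<open>bump\<^sup>2 / (accept_kernel * gauss)\<close>: the tilt by \<open>2 t\<close> comes from the square of
  the bump, the quadratic term from the errors in the first-order expansion of \<open>ln p\<close>. The factor
  \<open>1 / DIM\<close> keeps its Gaussian integral bounded independently of the dimension.\<close>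

definition tilt_weight :: "'a::euclidean_space \<Rightarrow> 'a \<Rightarrow> real" where
  "tilt_weight t x = exp (3 / 2 * (1 - (norm t)\<^sup>2) + 2 * (t \<bullet> x) + 5 / 64
     + 5 / (32 * real DIM('a)) * (norm x)\<^sup>2)"

lemma tilt_weight_nonneg [simp]: "0 \<le> tilt_weight t x"
  by (simp add: tilt_weight_def)

lemma tilt_weight_measurable [measurable]: "tilt_weight t \<in> borel_measurable borel"
  unfolding tilt_weight_def by measurable

lemma exp_3_le: "exp (3::real) \<le> 2013 / 100"
proof -
  have "exp (3::real) = exp 1 ^ 3" by (simp flip: exp_of_nat_mult)
  also have "\<dots> \<le> (272 / 100) ^ 3" using e_less_272 by (intro power_mono) auto
  also have "\<dots> \<le> 2013 / 100" by (simp add: power3_eq_cube)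
  finally show ?thesis .
qed

text \<open>The exponent 3/2 (1 - |t|^2) + 5/64 + (32/11) |t|^2 is largest at |t| = 1, where it is
  just below 3; and (121/100) exp 3 < 25.\<close>

lemma tilt_weight_integral:
  fixes t :: "'a::euclidean_space"
  assumes t: "norm t \<le> 1"
  shows "integrable lborel (\<lambda>x. gauss x * tilt_weight t x)"
    "(\<integral>x. gauss x * tilt_weight t x \<partial>lborel) \<le> 25"
proof -
  define C where "C = exp (3 / 2 * (1 - (norm t)\<^sup>2) + 5 / 64)"
  define F where "F x = gauss x * exp ((2 *\<^sub>R t) \<bullet> x + 5 / (32 * real DIM('a)) * (norm x)\<^sup>2)" for x
  have eq: "gauss x * tilt_weight t x = C * F x" for x
    by (simp add: C_def F_def tilt_weight_def exp_add mult_ac)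
  have F: "integrable lborel F" "(\<integral>x. F x \<partial>lborel) \<le> 121 / 100 * exp (8 / 11 * (norm (2 *\<^sub>R t))\<^sup>2)"
    unfolding F_def by (rule gauss_exp_quadratic_le)+
  show "integrable lborel (\<lambda>x. gauss x * tilt_weight t x)" unfolding eq using F by simp
  have "(norm t)\<^sup>2 \<le> 1" using t by (simp add: power_le_one)
  then have "3 / 2 * (1 - (norm t)\<^sup>2) + 5 / 64 + 8 / 11 * (4 * (norm t)\<^sup>2) \<le> 3" by argo
  then have "exp (3 / 2 * (1 - (norm t)\<^sup>2) + 5 / 64 + 8 / 11 * (4 * (norm t)\<^sup>2)) \<le> exp 3" by simp
  note le = order_trans[OF this exp_3_le]
  have "(\<integral>x. gauss x * tilt_weight t x \<partial>lborel) = C * (\<integral>x. F x \<partial>lborel)" unfolding eq by simp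
  also have "\<dots> \<le> C * (121 / 100 * exp (8 / 11 * (norm (2 *\<^sub>R t))\<^sup>2))"
    using F by (intro mult_left_mono) (auto simp: C_def)
  also have "\<dots> = 121 / 100 * exp (3 / 2 * (1 - (norm t)\<^sup>2) + 5 / 64 + 8 / 11 * (4 * (norm t)\<^sup>2))"
    by (simp add: C_def exp_add power_mult_distrib)
  also have "\<dots> \<le> 25" using le by simp
  finally show "(\<integral>x. gauss x * tilt_weight t x \<partial>lborel) \<le> 25" .
qed

text \<open>The polynomial factor comes from the increments of the bump. It is dominated by 16 exp
  (-3/2) exp (|e . x| / 2), and the two signs of e . x become two tilted Gaussian integrals, each at
  most 450. Only the direction \<open>e\<close> enters, so the bound is free of the
  dimension.\<close>

lemma tilt_weight_second_moment:
  fixes t e :: "'a::euclidean_space"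
  assumes t: "norm t \<le> 1" and e: "norm e \<le> 1"
  shows "integrable lborel (\<lambda>x. gauss x * (1 + \<bar>e \<bullet> x\<bar>)\<^sup>2 * tilt_weight t x)"
    "(\<integral>x. gauss x * (1 + \<bar>e \<bullet> x\<bar>)\<^sup>2 * tilt_weight t x \<partial>lborel) \<le> 900"
proof -
  define C where "C = 16 * exp (3 / 2 * (1 - (norm t)\<^sup>2) + 5 / 64 - 3 / 2)"
  define F where "F b x = gauss x * exp (b \<bullet> x + 5 / (32 * real DIM('a)) * (norm x)\<^sup>2)" for b x :: 'a
  let ?b = "2 *\<^sub>R t + (1 / 2) *\<^sub>R e" and ?b' = "2 *\<^sub>R t - (1 / 2) *\<^sub>R e"
  have F: "integrable lborel (F b)" "(\<integral>x. F b x \<partial>lborel) \<le> 121 / 100 * exp (8 / 11 * (norm b)\<^sup>2)" for b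
    unfolding F_def by (rule gauss_exp_quadratic_le)+
  have le: "gauss x * (1 + \<bar>e \<bullet> x\<bar>)\<^sup>2 * tilt_weight t x \<le> C * (F ?b x + F ?b' x)" for x
  proof -
    have "(1 + \<bar>e \<bullet> x\<bar>)\<^sup>2 \<le> (4 * exp ((\<bar>e \<bullet> x\<bar> - 3) / 4))\<^sup>2"
      using one_plus_abs_le_exp[of 3 "e \<bullet> x"] by (intro power_mono) auto
    also have "\<dots> = 16 * exp (- 3 / 2) * exp \<bar>(e \<bullet> x) / 2\<bar>"
      by (simp add: power_mult_distrib field_simps flip: exp_double exp_add)
    also have "\<dots> \<le> 16 * exp (- 3 / 2) * (exp ((e \<bullet> x) / 2) + exp (- ((e \<bullet> x) / 2)))"
      by (intro mult_left_mono exp_abs_le) auto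
    finally have "gauss x * (1 + \<bar>e \<bullet> x\<bar>)\<^sup>2 * tilt_weight t x \<le>
      gauss x * (16 * exp (- 3 / 2) * (exp ((e \<bullet> x) / 2) + exp (- ((e \<bullet> x) / 2)))) * tilt_weight t x"
      by (intro mult_left_mono mult_right_mono) auto
    also have "\<dots> = C * (F ?b x + F ?b' x)"
    proof -
      have shift: "16 * exp (- 3 / 2) * exp s * tilt_weight t x =
          C * exp (2 * (t \<bullet> x) + s + 5 / (32 * real DIM('a)) * (norm x)\<^sup>2)" for s :: real
        by (simp add: C_def tilt_weight_def add_ac flip: exp_add)
      have "F ?b x = gauss x * exp (2 * (t \<bullet> x) + (e \<bullet> x) / 2 + 5 / (32 * real DIM('a)) * (norm x)\<^sup>2)"
        "F ?b' x = gauss x * exp (2 * (t \<bullet> x) + - ((e \<bullet> x) / 2) + 5 / (32 * real DIM('a)) * (norm x)\<^sup>2)"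
        by (simp_all add: F_def inner_left_distrib inner_diff_left)
      then have "C * (F ?b x + F ?b' x) = gauss x *
          (C * exp (2 * (t \<bullet> x) + (e \<bullet> x) / 2 + 5 / (32 * real DIM('a)) * (norm x)\<^sup>2) +
           C * exp (2 * (t \<bullet> x) + - ((e \<bullet> x) / 2) + 5 / (32 * real DIM('a)) * (norm x)\<^sup>2))"
        by (simp only: distrib_left mult.left_commute)
      then show ?thesis unfolding shift[symmetric] by (simp only: distrib_left distrib_right mult_ac)
    qed
    finally show ?thesis .
  qed
  have int: "integrable lborel (\<lambda>x. C * (F ?b x + F ?b' x))" using F by simp
  show 1: "integrable lborel (\<lambda>x. gauss x * (1 + \<bar>e \<bullet> x\<bar>)\<^sup>2 * tilt_weight t x)"
    by (rule Bochner_Integration.integrable_bound[OF int]) (use le in \<open>auto intro!: AE_I2 order_trans[OF le]\<close>)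
  have bound: "C * (\<integral>x. F b x \<partial>lborel) \<le> 450" if b: "norm b \<le> 2 * norm t + 1 / 2" for b
  proof -
    define a where "a = norm t"
    have a: "0 \<le> a" "a \<le> 1" using t by (auto simp: a_def)
    have "(norm b)\<^sup>2 \<le> (2 * a + 1 / 2)\<^sup>2" using b by (auto simp: a_def intro!: power_mono)
    also have "\<dots> = 4 * a\<^sup>2 + 2 * a + 1 / 4" by (simp add: power2_eq_square algebra_simps)
    finally have "(norm b)\<^sup>2 \<le> 4 * a\<^sup>2 + 2 * a + 1 / 4" .
    moreover have "a\<^sup>2 \<le> 1" using a by (simp add: power_le_one)
    ultimately have "3 / 2 * (1 - a\<^sup>2) + 5 / 64 - 3 / 2 + 8 / 11 * (norm b)\<^sup>2 \<le> 25 / 8"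
      using a by argo
    then have "exp (3 / 2 * (1 - a\<^sup>2) + 5 / 64 - 3 / 2 + 8 / 11 * (norm b)\<^sup>2) \<le> exp (25 / 8)" by simp
    also have "exp (25 / 8 :: real) = exp 3 * exp (1 / 8)" by (simp flip: exp_add)
    also have "\<dots> \<le> 2013 / 100 * (1 + 1 / 8 + (1 / 8)\<^sup>2)"
      using exp_bound[of "1 / 8"] by (intro mult_mono exp_3_le) auto
    finally have E: "exp (3 / 2 * (1 - a\<^sup>2) + 5 / 64 - 3 / 2 + 8 / 11 * (norm b)\<^sup>2) \<le> 2297 / 100"
      by (simp add: power2_eq_square)
    have "C * (\<integral>x. F b x \<partial>lborel) \<le> C * (121 / 100 * exp (8 / 11 * (norm b)\<^sup>2))"
      using F(2)[of b] by (intro mult_left_mono) (auto simp: C_def)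
    also have "\<dots> = 1936 / 100 * exp (3 / 2 * (1 - a\<^sup>2) + 5 / 64 - 3 / 2 + 8 / 11 * (norm b)\<^sup>2)"
      by (simp add: C_def a_def exp_add)
    also have "\<dots> \<le> 450" using E by simp
    finally show ?thesis .
  qed
  have "(\<integral>x. gauss x * (1 + \<bar>e \<bullet> x\<bar>)\<^sup>2 * tilt_weight t x \<partial>lborel) \<le> (\<integral>x. C * (F ?b x + F ?b' x) \<partial>lborel)"
    by (intro integral_mono 1 int le)
  also have "\<dots> = C * (\<integral>x. F ?b x \<partial>lborel) + C * (\<integral>x. F ?b' x \<partial>lborel)"
    using F by (simp add: distrib_left)
  also have "\<dots> \<le> 450 + 450"
    using e norm_triangle_ineq[of "2 *\<^sub>R t" "(1 / 2) *\<^sub>R e"] norm_triangle_ineq4[of "2 *\<^sub>R t" "(1 / 2) *\<^sub>R e"]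
    by (intro add_mono bound) auto
  finally show "(\<integral>x. gauss x * (1 + \<bar>e \<bullet> x\<bar>)\<^sup>2 * tilt_weight t x \<partial>lborel) \<le> 900" by simp
qed

section \<open>One-sided bump functions\<close>

text \<open>For \<open>k\<close> the acceptance kernel, \<open>a\<close> an averaging kernel and
  \<open>b\<close> an increment of \<open>u\<close>, the two integrals are a chi-square quantity and
  the local energy. The proof uses the discriminant of the nonnegative quadratic \<integral> (s a -
  k b)^2 / k in \<open>s\<close>.\<close>

lemma weighted_cauchy_schwarz:
  fixes a b k :: "'a \<Rightarrow> real"
  assumes [measurable]: "a \<in> borel_measurable M" "b \<in> borel_measurable M"
    and k: "\<And>x. 0 < k x"
    and int: "integrable M (\<lambda>x. (a x)\<^sup>2 / k x)" "integrable M (\<lambda>x. k x * (b x)\<^sup>2)"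
    and le: "(\<integral>x. (a x)\<^sup>2 / k x \<partial>M) \<le> X" "(\<integral>x. k x * (b x)\<^sup>2 \<partial>M) \<le> Y"
  shows "integrable M (\<lambda>x. a x * b x)" "\<bar>\<integral>x. a x * b x \<partial>M\<bar> \<le> sqrt (X * Y)"
proof -
  define A B C where "A = (\<integral>x. (a x)\<^sup>2 / k x \<partial>M)" and "B = (\<integral>x. k x * (b x)\<^sup>2 \<partial>M)"
    and "C = (\<integral>x. a x * b x \<partial>M)"
  have sq: "s\<^sup>2 * ((a x)\<^sup>2 / k x) - 2 * s * (a x * b x) + k x * (b x)\<^sup>2 = (s * a x - k x * b x)\<^sup>2 / k x" for s x
    using k[of x] by (simp add: field_simps power2_eq_square)
  have ge0: "0 \<le> s\<^sup>2 * ((a x)\<^sup>2 / k x) - 2 * s * (a x * b x) + k x * (b x)\<^sup>2" for s x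
    unfolding sq using k[of x] by simp
  show iab: "integrable M (\<lambda>x. a x * b x)"
  proof (rule Bochner_Integration.integrable_bound[OF Bochner_Integration.integrable_add[OF int]])
    have "\<bar>a x * b x\<bar> \<le> (a x)\<^sup>2 / k x + k x * (b x)\<^sup>2" for x
    proof -
      have "0 \<le> (a x)\<^sup>2 / k x" "0 \<le> k x * (b x)\<^sup>2" using k[of x] by simp_all
      then show ?thesis using ge0[of 1 x] ge0[of "-1" x] by (simp add: abs_if)
    qed
    then show "AE x in M. norm (a x * b x) \<le> norm ((a x)\<^sup>2 / k x + k x * (b x)\<^sup>2)"
      by (intro AE_I2) (simp only: real_norm_def order_trans[OF _ abs_ge_self])
  qed measurable
  have A0: "0 \<le> A" and B0: "0 \<le> B" unfolding A_def B_def using k by (auto intro!: Bochner_Integration.integral_nonneg simp: less_imp_le)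
  have quad: "0 \<le> s\<^sup>2 * A - 2 * s * C + B" for s
  proof -
    have "0 \<le> (\<integral>x. s\<^sup>2 * ((a x)\<^sup>2 / k x) - 2 * s * (a x * b x) + k x * (b x)\<^sup>2 \<partial>M)"
      by (intro Bochner_Integration.integral_nonneg ge0)
    also have "\<dots> = (\<integral>x. s\<^sup>2 * ((a x)\<^sup>2 / k x) - 2 * s * (a x * b x) \<partial>M) + B"
      unfolding B_def by (intro Bochner_Integration.integral_add Bochner_Integration.integrable_diff
        integrable_mult_right int iab)
    also have "(\<integral>x. s\<^sup>2 * ((a x)\<^sup>2 / k x) - 2 * s * (a x * b x) \<partial>M) = s\<^sup>2 * A - 2 * s * C"
      unfolding A_def C_def
      by (subst Bochner_Integration.integral_diff)
         (simp_all only: integral_mult_right_zero integrable_mult_right int iab)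
    finally show ?thesis .
  qed
  have "C\<^sup>2 \<le> A * B"
  proof (cases "A = 0")
    case True
    have "C = 0"
    proof (rule ccontr)
      assume "C \<noteq> 0"
      \<comment> \<open>When \<open>A = 0\<close> this value of \<open>s\<close> makes the quadratic
        equal to -1.\<close>
      then show False using quad[of "(B + 1) / (2 * C)"] True by simp
    qed
    then show ?thesis using True by simp
  next
    case False
    have "0 \<le> A * ((C / A)\<^sup>2 * A - 2 * (C / A) * C + B)" by (intro mult_nonneg_nonneg A0 quad)
    also have "\<dots> = A * B - C\<^sup>2" using False by (simp add: field_simps power2_eq_square)
    finally show ?thesis by simp
  qed
  also have "A * B \<le> X * Y" using le A0 B0 by (intro mult_mono) (auto simp: A_def B_def)
  finally show "\<bar>C\<bar> \<le> sqrt (X * Y)" by (metis real_sqrt_abs real_sqrt_le_iff)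
qed

text \<open>The constant term serves two purposes: it gives \<open>exp (tilt_exponent t x)\<close>
  the same Gaussian integral exp (1/2) for all \<open>t\<close>, and it vanishes when |t| =
  1.\<close>

definition tilt_exponent :: "'a::euclidean_space \<Rightarrow> 'a \<Rightarrow> real" where
  "tilt_exponent t x = t \<bullet> x + (1 - (norm t)\<^sup>2) / 2"

text \<open>Subtracting 1 lets the function vanish continuously at the edge of its support. With a
  jump there, the squared difference of two translates would integrate to order |w| instead of the
  required |w|^2.\<close>

definition bump :: "'a::euclidean_space \<Rightarrow> 'a \<Rightarrow> real" where
  "bump t x = gauss x * max 0 (exp (tilt_exponent t x) - 1)"

definition bump_mass :: "'a::euclidean_space \<Rightarrow> real" where
  "bump_mass t = (\<integral>x. bump t x \<partial>lborel)"

lemma tilt_exponent_measurable [measurable]: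
  assumes [measurable]: "t \<in> borel_measurable M" "x \<in> borel_measurable M"
  shows "(\<lambda>w. tilt_exponent (t w) (x w)) \<in> borel_measurable M"
  unfolding tilt_exponent_def by measurable

lemma bump_measurable [measurable]:
  assumes [measurable]: "t \<in> borel_measurable M" "x \<in> borel_measurable M"
  shows "(\<lambda>w. bump (t w) (x w)) \<in> borel_measurable M"
  unfolding bump_def by measurable

lemma bump_nonneg [simp]: "0 \<le> bump t x"
  by (simp add: bump_def)

lemma bump_le: "bump t x \<le> gauss x * exp (tilt_exponent t x)"
  unfolding bump_def by (intro mult_left_mono) auto

lemma gauss_tilt_exponent:
  fixes t :: "'a::euclidean_space"
  shows "has_bochner_integral lborel (\<lambda>x. gauss x * exp (tilt_exponent t x)) (exp (1 / 2))"
proof -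
  have "has_bochner_integral lborel (\<lambda>x. exp ((1 - (norm t)\<^sup>2) / 2) * (gauss x * exp (t \<bullet> x)))
     (exp ((1 - (norm t)\<^sup>2) / 2) * exp ((norm t)\<^sup>2 / 2))"
    by (intro has_bochner_integral_mult_right gauss_exp_linear)
  moreover have "exp ((1 - (norm t)\<^sup>2) / 2) * exp ((norm t)\<^sup>2 / 2) = exp (1 / 2)"
    by (simp add: mult_exp_exp diff_divide_distrib)
  moreover have "exp ((1 - (norm t)\<^sup>2) / 2) * (gauss x * exp (t \<bullet> x)) = gauss x * exp (tilt_exponent t x)" for x
    by (simp add: tilt_exponent_def exp_add)
  ultimately show ?thesis by simp
qed

lemma integrable_gauss_tilt_exponent:
  "integrable lborel (\<lambda>x::'a::euclidean_space. gauss x * exp (tilt_exponent t x))"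
  using gauss_tilt_exponent[of t] by (simp add: has_bochner_integral_iff)

lemma integrable_bump: "integrable lborel (bump t :: 'a::euclidean_space \<Rightarrow> real)"
  by (rule Bochner_Integration.integrable_bound[OF integrable_gauss_tilt_exponent[of t]])
     (auto simp: bump_le)

text \<open>Dropping the positive part leaves full Gaussian integrals; 5/8 = 1/2 + 1/8 is the
  quadratic Taylor bound for exp (1/2) - 1.\<close>

lemma bump_mass_ge: "5 / 8 \<le> bump_mass t"
proof -
  have "exp (1 / 2) - 1 = (\<integral>x. gauss x * exp (tilt_exponent t x) - gauss x \<partial>lborel)"
    using gauss_tilt_exponent[of t] gauss_integral[where 'a='a]
    by (simp add: has_bochner_integral_iff)
  also have "\<dots> \<le> bump_mass t"
    unfolding bump_mass_def
  proof (rule integral_mono)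
    show "gauss x * exp (tilt_exponent t x) - gauss x \<le> bump t x" for x
    proof -
      have "gauss x * (exp (tilt_exponent t x) - 1) \<le> bump t x"
        unfolding bump_def by (intro mult_left_mono) auto
      then show ?thesis by (simp add: right_diff_distrib)
    qed
  qed (use gauss_tilt_exponent[of t] gauss_integral[where 'a='a] integrable_bump[of t]
       in \<open>auto simp: has_bochner_integral_iff\<close>)
  finally have "exp (1 / 2) - 1 \<le> bump_mass t" .
  moreover have "1 + 1 / 2 + (1 / 2)\<^sup>2 / 2 \<le> exp (1 / 2 :: real)"
    by (rule exp_lower_Taylor_quadratic) simp
  ultimately show ?thesis by (simp add: power2_eq_square)
qed

lemma exp_diff_le: "exp a - exp b \<le> (a - b) * exp a" for a b :: real
proof -
  have "exp a * (1 + (b - a)) \<le> exp a * exp (b - a)" by (intro mult_left_mono exp_ge_add_one_self) auto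
  then show ?thesis by (simp add: mult_exp_exp algebra_simps)
qed

text \<open>Only the component of \<open>x\<close> along \<open>t - t'\<close> appears; its moments
  are bounded in every dimension, whereas |x| would cost a factor sqrt d. The constant terms differ
  by at most |t - t'| because both points lie in the unit ball.\<close>

lemma tilt_exponent_diff:
  fixes t t' x :: "'a::euclidean_space"
  assumes "norm t \<le> 1" "norm t' \<le> 1"
  shows "\<bar>tilt_exponent t x - tilt_exponent t' x\<bar> \<le> norm (t - t') * (1 + \<bar>sgn (t - t') \<bullet> x\<bar>)"
proof -
  have "(t - t') \<bullet> x = norm (t - t') * (sgn (t - t') \<bullet> x)"
    by (cases "t = t'") (auto simp: sgn_div_norm)
  moreover have "(norm t)\<^sup>2 - (norm t')\<^sup>2 = (t - t') \<bullet> (t + t')"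
    by (simp add: power2_norm_eq_inner inner_diff_left inner_add_right inner_commute[of t' t])
  moreover have "\<bar>(t - t') \<bullet> (t + t')\<bar> \<le> norm (t - t') * 2"
  proof -
    have "\<bar>(t - t') \<bullet> (t + t')\<bar> \<le> norm (t - t') * norm (t + t')" by (rule Cauchy_Schwarz_ineq2)
    also have "\<dots> \<le> norm (t - t') * 2"
      using assms norm_triangle_ineq[of t t'] by (intro mult_left_mono) auto
    finally show ?thesis .
  qed
  moreover have "tilt_exponent t x - tilt_exponent t' x = (t - t') \<bullet> x - ((norm t)\<^sup>2 - (norm t')\<^sup>2) / 2"
    by (simp add: tilt_exponent_def inner_diff_left field_simps)
  moreover have "\<bar>norm (t - t') * (sgn (t - t') \<bullet> x)\<bar> = norm (t - t') * \<bar>sgn (t - t') \<bullet> x\<bar>"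
    by (simp add: abs_mult)
  moreover have "\<bar>D\<bar> \<le> n + Q" if "D = P - S / 2" "\<bar>S\<bar> \<le> n * 2" "\<bar>P\<bar> = Q" for D P S n Q :: real
    using that by linarith
  ultimately show ?thesis by (simp only: distrib_left mult_1_right)
qed

lemma exp_5_8_le: "exp (5 / 8 :: real) \<le> 15 / 8"
proof (rule power_le_imp_le_base[where n = 7])
  have "exp (5 / 8 :: real) ^ Suc 7 = exp 1 ^ 5"
    by (simp flip: exp_of_nat_mult)
  also have "\<dots> \<le> (272 / 100) ^ 5" using e_less_272 by (intro power_mono) auto
  also have "\<dots> \<le> (15 / 8 :: real) ^ Suc 7" by (simp add: eval_nat_numeral)
  finally show "exp (5 / 8 :: real) ^ Suc 7 \<le> (15 / 8) ^ Suc 7" .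
qed simp

text \<open>After domination by two tilts, each exponent is at most |t| / 2 + 1/8 \<le> 5/8, so each
  of the two integrals contributes at most 2 (15/8).\<close>

lemma gauss_tilt_first_moment:
  fixes t e :: "'a::euclidean_space"
  assumes t: "norm t \<le> 1" and e: "norm e \<le> 1"
  shows "integrable lborel (\<lambda>x. gauss x * exp (tilt_exponent t x) * (1 + \<bar>e \<bullet> x\<bar>))"
    "(\<integral>x. gauss x * exp (tilt_exponent t x) * (1 + \<bar>e \<bullet> x\<bar>) \<partial>lborel) \<le> 15 / 2"
proof -
  define C where "C = 2 * exp (- (norm t)\<^sup>2 / 2)"
  define F where "F b x = gauss x * exp (b \<bullet> x)" for b x :: 'a
  let ?b = "t + (1 / 2) *\<^sub>R e" and ?b' = "t - (1 / 2) *\<^sub>R e"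
  have F: "integrable lborel (F b)" "(\<integral>x. F b x \<partial>lborel) = exp ((norm b)\<^sup>2 / 2)" for b
    using gauss_exp_linear[of b] unfolding F_def by (auto simp: has_bochner_integral_iff)
  have le: "gauss x * exp (tilt_exponent t x) * (1 + \<bar>e \<bullet> x\<bar>) \<le> C * (F ?b x + F ?b' x)" for x
  proof -
    have "1 + \<bar>e \<bullet> x\<bar> \<le> 2 * exp ((\<bar>e \<bullet> x\<bar> - 1) / 2)"
      using one_plus_abs_le_exp[of 1 "e \<bullet> x"] by simp
    also have "\<dots> = 2 * exp (- 1 / 2) * exp \<bar>(e \<bullet> x) / 2\<bar>"
      by (simp add: field_simps flip: exp_add)
    also have "\<dots> \<le> 2 * exp (- 1 / 2) * (exp ((e \<bullet> x) / 2) + exp (- ((e \<bullet> x) / 2)))"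
      by (intro mult_left_mono exp_abs_le) auto
    finally have "gauss x * exp (tilt_exponent t x) * (1 + \<bar>e \<bullet> x\<bar>) \<le>
      gauss x * exp (tilt_exponent t x) * (2 * exp (- 1 / 2) * (exp ((e \<bullet> x) / 2) + exp (- ((e \<bullet> x) / 2))))"
      by (intro mult_left_mono) auto
    also have "\<dots> = C * (F ?b x + F ?b' x)"
    proof -
      have shift: "2 * exp (- 1 / 2) * exp (tilt_exponent t x) * exp s = C * exp (t \<bullet> x + s)" for s :: real
        by (simp add: C_def tilt_exponent_def diff_divide_distrib flip: exp_add)
      have "F ?b x = gauss x * exp (t \<bullet> x + (e \<bullet> x) / 2)"
        "F ?b' x = gauss x * exp (t \<bullet> x + - ((e \<bullet> x) / 2))"
        by (simp_all add: F_def inner_left_distrib inner_diff_left)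
      then have "C * (F ?b x + F ?b' x) = gauss x *
          (C * exp (t \<bullet> x + (e \<bullet> x) / 2) + C * exp (t \<bullet> x + - ((e \<bullet> x) / 2)))"
        by (simp only: distrib_left mult.left_commute)
      then show ?thesis unfolding shift[symmetric] by (simp only: distrib_left distrib_right mult_ac)
    qed
    finally show ?thesis .
  qed
  have int: "integrable lborel (\<lambda>x. C * (F ?b x + F ?b' x))" using F by simp
  show 1: "integrable lborel (\<lambda>x. gauss x * exp (tilt_exponent t x) * (1 + \<bar>e \<bullet> x\<bar>))"
    by (rule Bochner_Integration.integrable_bound[OF int]) (use le in \<open>auto intro!: AE_I2 order_trans[OF le]\<close>)
  have bound: "C * exp ((norm b)\<^sup>2 / 2) \<le> 15 / 4" if b: "norm b \<le> norm t + 1 / 2" for b :: 'a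
  proof -
    have "(norm b)\<^sup>2 \<le> (norm t + 1 / 2)\<^sup>2" using b by (auto intro!: power_mono)
    also have "\<dots> = (norm t)\<^sup>2 + norm t + 1 / 4" by (simp add: power2_eq_square algebra_simps)
    finally have "- (norm t)\<^sup>2 / 2 + (norm b)\<^sup>2 / 2 \<le> 5 / 8" using t by argo
    then have "exp (- (norm t)\<^sup>2 / 2 + (norm b)\<^sup>2 / 2) \<le> 15 / 8"
      by (intro order_trans[OF _ exp_5_8_le]) simp
    then show ?thesis by (simp only: C_def exp_add)
  qed
  have "(\<integral>x. gauss x * exp (tilt_exponent t x) * (1 + \<bar>e \<bullet> x\<bar>) \<partial>lborel) \<le> (\<integral>x. C * (F ?b x + F ?b' x) \<partial>lborel)"
    by (intro integral_mono 1 int le)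
  also have "\<dots> = C * exp ((norm ?b)\<^sup>2 / 2) + C * exp ((norm ?b')\<^sup>2 / 2)"
    using F by (simp add: distrib_left)
  also have "\<dots> \<le> 15 / 4 + 15 / 4"
    using e norm_triangle_ineq[of t "(1 / 2) *\<^sub>R e"] norm_triangle_ineq4[of t "(1 / 2) *\<^sub>R e"]
    by (intro add_mono bound) auto
  finally show "(\<integral>x. gauss x * exp (tilt_exponent t x) * (1 + \<bar>e \<bullet> x\<bar>) \<partial>lborel) \<le> 15 / 2" by simp
qed

text \<open>Needed because the averages are normalized by a mass that changes with the point. The
  one-sided estimate involves the exponential at \<open>t\<close> alone, so exchanging
  \<open>t\<close> and \<open>t'\<close> gives the other side.\<close>

lemma bump_mass_lipschitz:
  fixes t t' :: "'a::euclidean_space"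
  assumes t: "norm t \<le> 1" "norm t' \<le> 1"
  shows "\<bar>bump_mass t - bump_mass t'\<bar> \<le> 15 / 2 * norm (t - t')"
proof -
  have one_sided: "bump_mass t - bump_mass t' \<le> 15 / 2 * norm (t - t')"
    if t: "norm t \<le> 1" "norm t' \<le> 1" for t t' :: 'a
  proof -
    define e where "e = sgn (t - t')"
    have e: "norm e \<le> 1" by (simp add: e_def norm_sgn)
    note mom = gauss_tilt_first_moment[OF t(1) e]
    have "bump_mass t - bump_mass t' = (\<integral>x. bump t x - bump t' x \<partial>lborel)"
      using integrable_bump[of t] integrable_bump[of t'] by (simp add: bump_mass_def)
    also have "\<dots> \<le> (\<integral>x. norm (t - t') * (gauss x * exp (tilt_exponent t x) * (1 + \<bar>e \<bullet> x\<bar>)) \<partial>lborel)"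
    proof (rule integral_mono)
      fix x
      let ?r = "tilt_exponent t x" and ?r' = "tilt_exponent t' x"
      have "max 0 (exp ?r - 1) - max 0 (exp ?r' - 1) \<le> \<bar>?r - ?r'\<bar> * exp ?r"
      proof (cases "?r \<le> ?r'")
        case True
        then have "max 0 (exp ?r - 1) \<le> max 0 (exp ?r' - 1)" by (intro max.mono) auto
        then show ?thesis by (smt (verit) exp_ge_zero mult_nonneg_nonneg)
      next
        case False
        have "max 0 (exp ?r - 1) - max 0 (exp ?r' - 1) \<le> exp ?r - exp ?r'"
          using False by (auto simp: max_def)
        also have "\<dots> \<le> \<bar>?r - ?r'\<bar> * exp ?r" using exp_diff_le[of ?r ?r'] False by simp
        finally show ?thesis .
      qed
      also have "\<dots> \<le> norm (t - t') * (1 + \<bar>e \<bullet> x\<bar>) * exp ?r"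
        unfolding e_def by (intro mult_right_mono tilt_exponent_diff t) auto
      finally have "gauss x * (max 0 (exp ?r - 1) - max 0 (exp ?r' - 1)) \<le>
          gauss x * (norm (t - t') * (1 + \<bar>e \<bullet> x\<bar>) * exp ?r)"
        by (intro mult_left_mono) auto
      then show "bump t x - bump t' x \<le> norm (t - t') * (gauss x * exp ?r * (1 + \<bar>e \<bullet> x\<bar>))"
        unfolding bump_def by (simp only: right_diff_distrib mult_ac)
    qed (intro Bochner_Integration.integrable_diff integrable_bump integrable_mult_right mom)+
    also have "\<dots> \<le> norm (t - t') * (15 / 2)"
      by (subst integral_mult_right_zero) (intro mult_left_mono mom, simp)
    finally show ?thesis by simp
  qed
  show ?thesis using one_sided[OF t] one_sided[OF t(2,1)] unfolding norm_minus_commute[of t' t] by linarith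
qed

lemma gauss_shift: "gauss (x - w) \<le> gauss x * exp (norm w * norm x)"
proof -
  have "- (norm (x - w))\<^sup>2 / 2 \<le> - (norm x)\<^sup>2 / 2 + w \<bullet> x"
    by (simp add: power2_norm_eq_inner inner_diff_left inner_diff_right inner_commute field_simps)
  also have "\<dots> \<le> - (norm x)\<^sup>2 / 2 + norm w * norm x"
    by (intro add_left_mono norm_cauchy_schwarz)
  finally show ?thesis by (simp add: gauss_def mult.assoc flip: exp_add)
qed

text \<open>The first-order factor keeps the scalar product w . x for the sake of the dimension. The
  length of \<open>x\<close> occurs only in an exponent with the small coefficient |w|, which is
  absorbed later by choosing |w| of order 1 / d.\<close>

lemma gauss_diff:
  "\<bar>gauss (x - w) - gauss (x + w)\<bar> \<le> 2 * \<bar>w \<bullet> x\<bar> * (gauss x * exp (norm w * norm x))"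
proof -
  have one_sided: "gauss (x - w) - gauss (x + w) \<le> 2 * \<bar>w \<bullet> x\<bar> * (gauss x * exp (norm w * norm x))" for w
  proof -
    define k where "k = (2 * pi) powr (- real DIM('a) / 2)"
    define a b where "a = - (norm (x - w))\<^sup>2 / 2" and "b = - (norm (x + w))\<^sup>2 / 2"
    have ab: "a - b = 2 * (w \<bullet> x)"
      by (simp add: a_def b_def power2_norm_eq_inner inner_diff_left inner_diff_right
        inner_add_left inner_add_right inner_commute field_simps)
    have g: "gauss (x - w) = k * exp a" "gauss (x + w) = k * exp b"
      by (simp_all add: gauss_def k_def a_def b_def)
    have "gauss (x - w) - gauss (x + w) = k * (exp a - exp b)" by (simp add: g right_diff_distrib)
    also have "\<dots> \<le> k * ((a - b) * exp a)"
      by (intro mult_left_mono exp_diff_le) (simp add: k_def)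
    also have "\<dots> = 2 * (w \<bullet> x) * gauss (x - w)" by (simp add: g ab)
    also have "\<dots> \<le> 2 * \<bar>w \<bullet> x\<bar> * gauss (x - w)" by (intro mult_right_mono) auto
    also have "\<dots> \<le> 2 * \<bar>w \<bullet> x\<bar> * (gauss x * exp (norm w * norm x))"
      by (intro mult_left_mono gauss_shift) auto
    finally show ?thesis .
  qed
  show ?thesis using one_sided[of w] one_sided[of "- w"] by (simp add: abs_le_iff)
qed

text \<open>In contrast to \<open>tilt_exponent_diff\<close> the length of \<open>x\<close> is
  affordable here: the estimate is used only inside exponents and to locate supports, where
  \<open>step_radius_small\<close> absorbs it.\<close>

lemma tilt_exponent_shift:
  fixes t t' w x :: "'a::euclidean_space"
  assumes t: "norm t \<le> 1" "norm t' \<le> 1" "norm (t' - t) \<le> norm w / 4"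
  shows "\<bar>tilt_exponent t' (x - w) - tilt_exponent t x\<bar> \<le> norm w * (norm x + 2)"
proof -
  have "\<bar>tilt_exponent t' x - tilt_exponent t x\<bar> \<le> norm (t' - t) * (1 + \<bar>sgn (t' - t) \<bullet> x\<bar>)"
    by (rule tilt_exponent_diff[OF t(2,1)])
  also have "\<dots> \<le> norm w / 4 * (1 + norm x)"
  proof (intro mult_mono add_left_mono t)
    have "\<bar>sgn (t' - t) \<bullet> x\<bar> \<le> norm (sgn (t' - t)) * norm x" by (rule Cauchy_Schwarz_ineq2)
    also have "\<dots> \<le> 1 * norm x" by (intro mult_right_mono) (auto simp: norm_sgn)
    finally show "\<bar>sgn (t' - t) \<bullet> x\<bar> \<le> norm x" by simp
  qed auto
  finally have 1: "\<bar>tilt_exponent t' x - tilt_exponent t x\<bar> \<le> norm w / 4 * (1 + norm x)" .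
  have "\<bar>t' \<bullet> w\<bar> \<le> norm t' * norm w" by (rule Cauchy_Schwarz_ineq2)
  also have "\<dots> \<le> 1 * norm w" using t by (intro mult_right_mono) auto
  finally have 2: "\<bar>t' \<bullet> w\<bar> \<le> norm w" by simp
  have "tilt_exponent t' (x - w) = tilt_exponent t' x - t' \<bullet> w"
    by (simp add: tilt_exponent_def inner_diff_right)
  moreover have "0 \<le> norm w * norm x" by simp
  ultimately show ?thesis using 1 2 by (simp add: distrib_left)
qed

lemma bump_shift_le:
  fixes t t' w x :: "'a::euclidean_space"
  assumes t: "norm t \<le> 1" "norm t' \<le> 1" "norm (t' - t) \<le> norm w / 4"
  shows "bump t' (x - w) \<le> gauss x * exp (tilt_exponent t x + 2 * (norm w * (norm x + 2)))"
proof -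
  have "bump t' (x - w) \<le> gauss (x - w) * exp (tilt_exponent t' (x - w))" by (rule bump_le)
  also have "\<dots> \<le> (gauss x * exp (norm w * norm x)) * exp (tilt_exponent t x + norm w * (norm x + 2))"
    using tilt_exponent_shift[OF t, of x] by (intro mult_mono gauss_shift) auto
  also have "\<dots> = gauss x * exp (norm w * norm x + (tilt_exponent t x + norm w * (norm x + 2)))"
    by (simp add: exp_add)
  also have "\<dots> \<le> gauss x * exp (tilt_exponent t x + 2 * (norm w * (norm x + 2)))"
    by (intro mult_left_mono) (auto simp: distrib_left)
  finally show ?thesis .
qed

text \<open>The support of a shifted bump protrudes only slightly from that of the bump at
  \<open>t\<close>. The bound has the form under which the acceptance kernel is bounded
  below.\<close>

lemma bump_shift_nonzero:
  fixes t t' w x :: "'a::euclidean_space"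
  assumes t: "norm t \<le> 1" "norm t' \<le> 1" "norm (t' - t) \<le> norm w / 4"
    and nz: "bump t' (x - w) \<noteq> 0"
  shows "- (norm w * (norm x + 2)) \<le> tilt_exponent t x"
proof -
  have "0 \<le> tilt_exponent t' (x - w)" using nz by (auto simp: bump_def max_def split: if_splits)
  then show ?thesis using tilt_exponent_shift[OF t, of x] by linarith
qed

text \<open>Three changes are collected: the Gaussian factor gives |sgn w . x|, the shift inside the
  tilt gives 1, and the change from \<open>t1\<close> to \<open>t2\<close>, of size at most |w| / 2,
  gives the term with weight 1/4. All errors of higher order are moved into the exponent.\<close>

lemma bump_diff:
  fixes t t1 t2 w x :: "'a::euclidean_space"
  assumes t: "norm t \<le> 1" and t1: "norm t1 \<le> 1" "norm (t1 - t) \<le> norm w / 4"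
    and t2: "norm t2 \<le> 1" "norm (t2 - t) \<le> norm w / 4"
  shows "\<bar>bump t1 (x - w) - bump t2 (x + w)\<bar> \<le> 2 * norm w *
    ((1 + \<bar>sgn w \<bullet> x\<bar>) + (1 + \<bar>sgn (t1 - t2) \<bullet> x\<bar>) / 4) *
    (gauss x * exp (tilt_exponent t x + 2 * (norm w * (norm x + 2))))"
proof -
  define r r1 r2 where "r = tilt_exponent t x" and "r1 = tilt_exponent t1 (x - w)"
    and "r2 = tilt_exponent t2 (x + w)"
  define \<psi> where "\<psi> s = max 0 (exp s - 1)" for s :: real
  define E where "E = exp (r + norm w * (norm x + 2))"
  define g where "g = gauss x * exp (norm w * norm x)"
  have r1: "r1 \<le> r + norm w * (norm x + 2)"
    using tilt_exponent_shift[OF t t1, of x] by (simp add: r_def r1_def abs_le_iff)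
  have r2: "r2 \<le> r + norm w * (norm x + 2)"
    using tilt_exponent_shift[of t t2 "- w" x] t t2 by (simp add: r_def r2_def abs_le_iff)
  have "exp r1 \<le> E" using r1 by (simp add: E_def)
  moreover have "\<bar>\<psi> r1\<bar> \<le> exp r1" by (simp add: \<psi>_def max_def)
  ultimately have \<psi>_le: "\<bar>\<psi> r1\<bar> \<le> E" by linarith
  have t12: "norm (t1 - t2) \<le> norm w / 2"
    using norm_triangle_ineq4[of "t1 - t" "t2 - t"] t1 t2 by simp
  have r12: "\<bar>r1 - r2\<bar> \<le> 2 * norm w * (1 + (1 + \<bar>sgn (t1 - t2) \<bullet> x\<bar>) / 4)"
  proof -
    have "r1 - r2 = (tilt_exponent t1 x - tilt_exponent t2 x) - (t1 \<bullet> w + t2 \<bullet> w)"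
      by (simp add: r1_def r2_def tilt_exponent_def inner_diff_right inner_add_right)
    moreover have "\<bar>tilt_exponent t1 x - tilt_exponent t2 x\<bar> \<le> norm w / 2 * (1 + \<bar>sgn (t1 - t2) \<bullet> x\<bar>)"
      by (rule order_trans[OF tilt_exponent_diff[OF t1(1) t2(1)]]) (intro mult_right_mono t12, simp)
    moreover have "\<bar>s \<bullet> w\<bar> \<le> norm w" if "norm s \<le> 1" for s
      using Cauchy_Schwarz_ineq2[of s w] mult_right_mono[OF that, of "norm w"] by simp
    then have "\<bar>t1 \<bullet> w\<bar> \<le> norm w" "\<bar>t2 \<bullet> w\<bar> \<le> norm w" using t1 t2 by auto
    moreover have "\<bar>D\<bar> \<le> 2 * n * (1 + Q / 4)"
      if "D = K - (u + v)" "\<bar>K\<bar> \<le> n / 2 * Q" "\<bar>u\<bar> \<le> n" "\<bar>v\<bar> \<le> n" for D K u v n Q :: real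
    proof -
      have "2 * n * (1 + Q / 4) = n / 2 * Q + 2 * n" by (simp add: distrib_left mult.commute)
      then show ?thesis using that by linarith
    qed
    ultimately show ?thesis by blast
  qed
  have \<psi>_diff: "\<bar>\<psi> r1 - \<psi> r2\<bar> \<le> \<bar>r1 - r2\<bar> * E"
  proof -
    have one: "\<psi> a - \<psi> b \<le> \<bar>a - b\<bar> * E" if "a \<le> r + norm w * (norm x + 2)" for a b
    proof (cases "a \<le> b")
      case True
      then have "\<psi> a \<le> \<psi> b" unfolding \<psi>_def by (intro max.mono) auto
      moreover have "0 \<le> \<bar>a - b\<bar> * E" by (simp add: E_def)
      ultimately show ?thesis by linarith
    next
      case False
      have "\<psi> a - \<psi> b \<le> exp a - exp b" using False by (auto simp: \<psi>_def max_def)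
      also have "\<dots> \<le> (a - b) * exp a" by (rule exp_diff_le)
      also have "\<dots> \<le> \<bar>a - b\<bar> * E" unfolding E_def using False that by (intro mult_mono) auto
      finally show ?thesis .
    qed
    show ?thesis using one[OF r1, of r2] one[OF r2, of r1] by (simp add: abs_le_iff abs_minus_commute)
  qed
  have g: "gauss (x + w) \<le> g" using gauss_shift[of x "- w"] by (simp add: g_def)
  have wx: "\<bar>w \<bullet> x\<bar> = norm w * \<bar>sgn w \<bullet> x\<bar>"
    by (cases "w = 0") (auto simp: sgn_div_norm abs_mult)
  have "bump t1 (x - w) - bump t2 (x + w) =
      (gauss (x - w) - gauss (x + w)) * \<psi> r1 + gauss (x + w) * (\<psi> r1 - \<psi> r2)"
    by (simp add: bump_def \<psi>_def r1_def r2_def algebra_simps)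
  also have "\<bar>\<dots>\<bar> \<le> \<bar>gauss (x - w) - gauss (x + w)\<bar> * \<bar>\<psi> r1\<bar> + gauss (x + w) * \<bar>\<psi> r1 - \<psi> r2\<bar>"
    by (rule order_trans[OF abs_triangle_ineq]) (simp add: abs_mult)
  also have "\<dots> \<le> (2 * \<bar>w \<bullet> x\<bar> * g) * E + g * ((2 * norm w * (1 + (1 + \<bar>sgn (t1 - t2) \<bullet> x\<bar>) / 4)) * E)"
    using gauss_diff[of x w] \<psi>_le g
    by (intro add_mono mult_mono order_trans[OF \<psi>_diff] mult_right_mono r12) (auto simp: g_def E_def)
  also have "\<dots> = 2 * norm w * ((1 + \<bar>sgn w \<bullet> x\<bar>) + (1 + \<bar>sgn (t1 - t2) \<bullet> x\<bar>) / 4) * (g * E)"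
    by (simp add: wx algebra_simps)
  also have "\<dots> \<le> 2 * norm w * ((1 + \<bar>sgn w \<bullet> x\<bar>) + (1 + \<bar>sgn (t1 - t2) \<bullet> x\<bar>) / 4) *
    (gauss x * exp (tilt_exponent t x + 2 * (norm w * (norm x + 2))))"
  proof (rule mult_left_mono)
    have "g * E = gauss x * exp (norm w * norm x + (r + norm w * (norm x + 2)))"
      by (simp add: g_def E_def exp_add)
    also have "\<dots> \<le> gauss x * exp (tilt_exponent t x + 2 * (norm w * (norm x + 2)))"
      by (intro mult_left_mono) (auto simp: distrib_left r_def)
    finally show "g * E \<le> gauss x * exp (tilt_exponent t x + 2 * (norm w * (norm x + 2)))" .
  qed auto
  finally show ?thesis .
qed

section \<open>Smoothing at the scale of one proposal\<close>

text \<open>The defect from the linear expansion is nondecreasing along the segment from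
  \<open>z\<close> to \<open>z + x\<close>, since the Lipschitz bound makes its derivative
  nonnegative.\<close>

lemma gradient_lower_bound:
  fixes f :: "'a::euclidean_space \<Rightarrow> real"
  assumes grad: "\<And>x. (f has_derivative (\<lambda>v. gradf x \<bullet> v)) (at x)"
    and smooth: "\<And>x y. norm (gradf x - gradf y) \<le> M * norm (x - y)"
  shows "f z + gradf z \<bullet> x - M / 2 * (norm x)\<^sup>2 \<le> f (z + x)"
proof -
  define F where "F s = f (z + s *\<^sub>R x) - s * (gradf z \<bullet> x) + M / 2 * s\<^sup>2 * (norm x)\<^sup>2" for s
  have deriv: "(F has_real_derivative (gradf (z + s *\<^sub>R x) - gradf z) \<bullet> x + M * s * (norm x)\<^sup>2) (at s)" for s
  proof -
    have "((\<lambda>s. f (z + s *\<^sub>R x)) has_derivative (\<lambda>r. gradf (z + s *\<^sub>R x) \<bullet> (r *\<^sub>R x))) (at s)"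
      by (rule has_derivative_compose[OF _ grad]) (auto intro!: derivative_eq_intros)
    then have "((\<lambda>s. f (z + s *\<^sub>R x)) has_real_derivative gradf (z + s *\<^sub>R x) \<bullet> x) (at s)"
      by (simp add: has_field_derivative_def mult.commute[of _ "gradf (z + s *\<^sub>R x) \<bullet> x"])
    note [derivative_intros] = this
    show ?thesis unfolding F_def
      by (rule derivative_eq_intros refl)+ (simp add: inner_diff_left)
  qed
  have "F 0 \<le> F 1"
  proof (rule DERIV_nonneg_imp_nondecreasing[of 0 1 F])
    fix s :: real assume s: "0 \<le> s" "s \<le> 1"
    have "\<bar>(gradf (z + s *\<^sub>R x) - gradf z) \<bullet> x\<bar> \<le> norm (gradf (z + s *\<^sub>R x) - gradf z) * norm x"
      by (rule Cauchy_Schwarz_ineq2)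
    also have "\<dots> \<le> (M * norm (z + s *\<^sub>R x - z)) * norm x" by (intro mult_right_mono smooth) auto
    also have "\<dots> = M * s * (norm x)\<^sup>2" using s by (simp add: power2_eq_square)
    finally show "\<exists>y. (F has_real_derivative y) (at s) \<and> 0 \<le> y"
      using deriv[of s] by (intro exI conjI) (assumption, linarith)
  qed simp
  then show ?thesis by (simp add: F_def)
qed

lemma closest_point_unit_ball:
  fixes a :: "'a::euclidean_space"
  assumes "1 < norm a"
  shows "closest_point (cball 0 1) a = sgn a"
proof (rule closest_point_unique[symmetric])
  show "\<forall>z\<in>cball 0 1. dist a (sgn a) \<le> dist a z"
  proof
    fix z :: 'a assume "z \<in> cball 0 1"
    then have "norm a - 1 \<le> dist a z"
      using norm_triangle_sub[of a z] by (simp add: dist_norm)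
    have "a - sgn a = (1 - 1 / norm a) *\<^sub>R a"
      by (simp add: sgn_div_norm scaleR_left_diff_distrib inverse_eq_divide)
    then have "dist a (sgn a) = \<bar>1 - 1 / norm a\<bar> * norm a"
      by (simp only: dist_norm norm_scaleR)
    moreover have n: "norm a \<noteq> 0" using assms by linarith
    then have "1 / norm a \<le> 1" using assms by (simp add: divide_le_eq)
    then have "\<bar>1 - 1 / norm a\<bar> = 1 - 1 / norm a" by simp
    moreover have "(1 - 1 / norm a) * norm a = norm a - 1" using n by (simp add: left_diff_distrib)
    ultimately have "dist a (sgn a) = norm a - 1" by (simp only:)
    with \<open>norm a - 1 \<le> dist a z\<close> show "dist a (sgn a) \<le> dist a z" by simp
  qed
qed (auto simp: norm_sgn)

text \<open>The target after rescaling to unit step, where the step size condition turns into the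
  last two assumptions.\<close>

locale rwm_target =
  fixes p f g :: "'a::euclidean_space \<Rightarrow> real" and gradf :: "'a \<Rightarrow> 'a" and M L :: real
  assumes p_measurable [measurable]: "p \<in> borel_measurable borel"
    and p_pos: "\<And>x. 0 < p x"
    and p_int: "integrable lborel p"
    and p_one: "(\<integral>x. p x \<partial>lborel) = 1"
    and decomp: "\<And>x. ln (p x) = f x + g x"
    and f_grad: "\<And>x. (f has_derivative (\<lambda>v. gradf x \<bullet> v)) (at x)"
    and f_smooth: "\<And>x y. norm (gradf x - gradf y) \<le> M * norm (x - y)"
    and g_lip: "\<And>x y. \<bar>g x - g y\<bar> \<le> L * norm (x - y)"
    and M_dim: "M * real DIM('a) \<le> 1 / 4"
    and L_dim: "L * sqrt (real DIM('a)) \<le> 1 / 16"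
begin

definition drift :: "'a \<Rightarrow> 'a" where
  "drift x = closest_point (cball 0 1) (gradf x)"

definition accept_kernel :: "'a \<Rightarrow> 'a \<Rightarrow> real" where
  "accept_kernel z x = min 1 (p (z + x) / p z) * gauss x"

text \<open>Radius within which the kernels at \<open>z + w\<close> and \<open>z - w\<close> are still comparable with the acceptance
  kernel at \<open>z\<close>. It depends on the size of the gradient, but only its positivity on bounded sets matters
  for the Poincare inequality.\<close>

definition step_radius :: "real \<Rightarrow> real" where
  "step_radius a = 1 / (160 * real DIM('a) * (4 + max 1 a))"

lemma dim_ge_1: "1 \<le> real DIM('a)"
  using DIM_positive[where 'a='a] by linarith

lemma M_le: "M \<le> 1 / (4 * real DIM('a))" "M \<le> 1 / 4"
proof -
  show "M \<le> 1 / (4 * real DIM('a))" using M_dim dim_ge_1 by (simp add: field_simps)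
  also have "\<dots> \<le> 1 / 4" using dim_ge_1 by (simp add: field_simps)
  finally show "M \<le> 1 / 4" .
qed

lemma norm_drift: "norm (drift x) \<le> 1"
  using closest_point_in_set[of "cball 0 1" "gradf x"] by (simp add: drift_def)

lemma drift_lipschitz: "norm (drift x - drift y) \<le> norm (x - y) / 4"
proof -
  have "dist (drift x) (drift y) \<le> dist (gradf x) (gradf y)"
    unfolding drift_def by (rule closest_point_lipschitz) auto
  also have "\<dots> \<le> M * norm (x - y)" using f_smooth[of x y] by (simp add: dist_norm)
  also have "\<dots> \<le> 1 / 4 * norm (x - y)" by (intro mult_right_mono M_le) auto
  finally show ?thesis by (simp add: dist_norm)
qed

lemma continuous_drift: "continuous_on UNIV drift"
proof (rule continuous_onI)
  fix x and e :: real assume "0 < e"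
  then show "\<exists>d>0. \<forall>x'\<in>UNIV. dist x' x < d \<longrightarrow> dist (drift x') (drift x) \<le> e"
    using drift_lipschitz[of _ x] by (intro exI[of _ e]) (auto simp: dist_norm intro!: order_trans[OF drift_lipschitz])
qed

lemma drift_measurable [measurable]: "drift \<in> borel_measurable borel"
  by (rule borel_measurable_continuous_onI[OF continuous_drift])

lemma accept_kernel_pos: "0 < accept_kernel z x"
  unfolding accept_kernel_def using p_pos by (intro mult_pos_pos gauss_pos) simp

lemma accept_kernel_nonneg [simp]: "0 \<le> accept_kernel z x"
  using accept_kernel_pos[of z x] by linarith

lemma accept_kernel_le: "accept_kernel z x \<le> gauss x"
  unfolding accept_kernel_def by (rule mult_left_le_one_le) (use p_pos in \<open>auto simp: less_imp_le\<close>)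

lemma accept_kernel_measurable [measurable]:
  assumes [measurable]: "a \<in> borel_measurable N" "b \<in> borel_measurable N"
  shows "(\<lambda>w. accept_kernel (a w) (b w)) \<in> borel_measurable N"
  unfolding accept_kernel_def by measurable

lemma p_ratio_ge: "exp (gradf z \<bullet> x - M / 2 * (norm x)\<^sup>2 - L * norm x) \<le> p (z + x) / p z"
proof -
  have "gradf z \<bullet> x - M / 2 * (norm x)\<^sup>2 - L * norm x \<le> ln (p (z + x)) - ln (p z)"
    using gradient_lower_bound[OF f_grad f_smooth, of z x] g_lip[of "z + x" z]
    unfolding decomp by (simp add: abs_le_iff)
  then have "exp (gradf z \<bullet> x - M / 2 * (norm x)\<^sup>2 - L * norm x) \<le> exp (ln (p (z + x)) - ln (p z))"
    by simp
  also have "\<dots> = p (z + x) / p z" using p_pos by (simp add: exp_diff)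
  finally show ?thesis .
qed

text \<open>On the support of the bump, up to a slack \<open>s\<close>, the first-order loss of
  \<open>ln p\<close> is bounded independently of the size of the gradient. For a gradient of norm
  at most 1 the drift is the gradient and the constant in \<open>tilt_exponent\<close> is the loss;
  for a larger one the drift is a unit vector, this constant is 0 and only the slack is multiplied
  by the gradient norm.\<close>

lemma gradient_drift:
  assumes s: "0 \<le> s" "- s \<le> tilt_exponent (drift z) x"
  shows "- (gradf z \<bullet> x) \<le> (1 - (norm (drift z))\<^sup>2) / 2 + max 1 (norm (gradf z)) * s"
proof (cases "norm (gradf z) \<le> 1")
  case True
  then have "drift z = gradf z" by (simp add: drift_def closest_point_self)
  then show ?thesis using s True by (simp add: tilt_exponent_def)
next
  case False
  then have "drift z = sgn (gradf z)" by (simp add: drift_def closest_point_unit_ball)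
  moreover have "norm (gradf z) \<noteq> 0" using False by linarith
  then have "norm (gradf z) *\<^sub>R sgn (gradf z) = gradf z" by (simp add: sgn_div_norm)
  then have "norm (gradf z) * (sgn (gradf z) \<bullet> x) = gradf z \<bullet> x" by (metis inner_scaleR_left)
  moreover have "norm (gradf z) * - s \<le> norm (gradf z) * tilt_exponent (drift z) x"
    using s by (intro mult_left_mono) auto
  ultimately show ?thesis using False by (auto simp: tilt_exponent_def norm_sgn)
qed

text \<open>The smooth remainder costs |x|^2 / (8 d) and the Lipschitz part at most 1/16 + |x|^2 /
  (64 d), the latter by y \<le> 1 + y^2 / 4 for y = |x| / sqrt d. Together this is 1/16 + 9 |x|^2 /
  (64 d).\<close>

lemma accept_kernel_ge:
  assumes s: "0 \<le> s" "- s \<le> tilt_exponent (drift z) x"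
  defines "Y \<equiv> (1 - (norm (drift z))\<^sup>2) / 2 + max 1 (norm (gradf z)) * s +
    1 / 16 + 9 / (64 * real DIM('a)) * (norm x)\<^sup>2"
  shows "gauss x \<le> accept_kernel z x * exp Y"
proof -
  let ?d = "real DIM('a)"
  have "(norm (drift z))\<^sup>2 \<le> 1" using norm_drift by (simp add: power_le_one)
  then have Y0: "0 \<le> Y" unfolding Y_def using s by (intro add_nonneg_nonneg mult_nonneg_nonneg) auto
  have "M / 2 * (norm x)\<^sup>2 \<le> 1 / (4 * ?d) / 2 * (norm x)\<^sup>2"
    by (intro mult_right_mono divide_right_mono M_le) auto
  moreover have "L * norm x \<le> 1 / 16 * (1 + (norm x)\<^sup>2 / (4 * ?d))"
  proof -
    define y where "y = norm x / sqrt ?d"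
    have "0 \<le> (1 - y / 2)\<^sup>2" by simp
    then have y: "y \<le> 1 + y\<^sup>2 / 4" by (simp add: power2_eq_square algebra_simps)
    have "L * norm x = (L * sqrt ?d) * y" by (simp add: y_def)
    also have "\<dots> \<le> 1 / 16 * y" by (intro mult_right_mono L_dim) (simp add: y_def)
    also have "\<dots> \<le> 1 / 16 * (1 + y\<^sup>2 / 4)" using y by simp
    also have "y\<^sup>2 = (norm x)\<^sup>2 / ?d" by (simp add: y_def power_divide)
    finally show ?thesis by (simp add: mult.commute)
  qed
  moreover have "1 / (4 * ?d) / 2 * (norm x)\<^sup>2 + 1 / 16 * (1 + (norm x)\<^sup>2 / (4 * ?d)) =
      1 / 16 + 9 / (64 * ?d) * (norm x)\<^sup>2"
    by (simp add: field_simps)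
  ultimately have "- Y \<le> gradf z \<bullet> x - M / 2 * (norm x)\<^sup>2 - L * norm x"
    using gradient_drift[OF s] unfolding Y_def by argo
  then have "exp (- Y) \<le> p (z + x) / p z"
    by (intro order_trans[OF _ p_ratio_ge]) simp
  \<comment> \<open>The cap 1 in the acceptance probability is harmless because \<open>Y\<close> is
    nonnegative.\<close>
  then have "exp (- Y) \<le> min 1 (p (z + x) / p z)" using Y0 by simp
  then have "exp (- Y) * (gauss x * exp Y) \<le> min 1 (p (z + x) / p z) * (gauss x * exp Y)"
    by (intro mult_right_mono) auto
  then show ?thesis by (simp add: accept_kernel_def exp_minus field_simps)
qed

lemma step_radius_pos: "0 < step_radius a"
  using dim_ge_1 by (simp add: step_radius_def)

text \<open>The slack gets the same shape as the errors in \<open>accept_kernel_ge\<close>. In the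
  factor \<open>4 + max 1 a\<close> the 4 is due to squaring the shifted bump and the rest to the
  gradient; 160 = 64 (5/2).\<close>

lemma step_radius_small:
  fixes x :: 'a
  assumes w: "0 \<le> w" "w \<le> step_radius a"
  shows "(4 + max 1 a) * (w * (norm x + 2)) \<le> 1 / 64 + 1 / (64 * real DIM('a)) * (norm x)\<^sup>2"
proof -
  let ?d = "real DIM('a)" and ?c = "4 + max 1 a"
  have c: "0 < ?c" by simp
  have "0 \<le> (norm x - 1)\<^sup>2" by simp
  then have "2 * norm x \<le> (norm x)\<^sup>2 + 1" by (simp add: power2_diff)
  then have "norm x + 2 \<le> 5 / 2 + 5 / 2 * (norm x)\<^sup>2"
    using zero_le_power2[of "norm x"] by argo
  also have "\<dots> \<le> 5 / 2 * ?d + 5 / 2 * (norm x)\<^sup>2" using dim_ge_1 by simp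
  finally have x: "norm x + 2 \<le> 5 / 2 * ?d + 5 / 2 * (norm x)\<^sup>2" .
  have "?c * (w * (norm x + 2)) \<le> ?c * (step_radius a * (5 / 2 * ?d + 5 / 2 * (norm x)\<^sup>2))"
    using w c x step_radius_pos[of a] by (intro mult_left_mono mult_mono) auto
  also have "\<dots> = (?c / ?c) * ((5 / 2 * ?d + 5 / 2 * (norm x)\<^sup>2) / (160 * ?d))"
    by (simp add: step_radius_def)
  also have "\<dots> = (5 / 2 * ?d + 5 / 2 * (norm x)\<^sup>2) / (160 * ?d)" using c by simp
  also have "\<dots> = 1 / 64 + 1 / (64 * ?d) * (norm x)\<^sup>2"
    using dim_ge_1 by (simp add: field_simps)
  finally show ?thesis .
qed

text \<open>This produces the constants of \<open>tilt_weight\<close>. The coefficient 3/2 is 1 from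
  the squared tilt plus 1/2 from the kernel bound; 5/64 = 1/64 + 1/16, and 5/32 = 1/64 +
  9/64.\<close>

lemma gauss_square_le:
  assumes w: "norm w \<le> step_radius (norm (gradf z))"
    and s: "- (norm w * (norm x + 2)) \<le> tilt_exponent (drift z) x"
  shows "(gauss x * exp (tilt_exponent (drift z) x + 2 * (norm w * (norm x + 2))))\<^sup>2
    \<le> accept_kernel z x * (gauss x * tilt_weight (drift z) x)"
proof -
  let ?d = "real DIM('a)" and ?r = "tilt_exponent (drift z) x" and ?a = "max 1 (norm (gradf z))"
  define s where "s = norm w * (norm x + 2)"
  define Y where "Y = (1 - (norm (drift z))\<^sup>2) / 2 + ?a * s + 1 / 16 + 9 / (64 * ?d) * (norm x)\<^sup>2"
  have s0: "0 \<le> s" by (simp add: s_def)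
  have "(4 + ?a) * s \<le> 1 / 64 + 1 / (64 * ?d) * (norm x)\<^sup>2"
    unfolding s_def by (rule step_radius_small[OF norm_ge_zero w])
  then have "4 * s + ?a * s \<le> 1 / 64 + 1 / (64 * ?d) * (norm x)\<^sup>2" by (simp only: distrib_right)
  moreover have "1 / (64 * ?d) * (norm x)\<^sup>2 + 9 / (64 * ?d) * (norm x)\<^sup>2 = 5 / (32 * ?d) * (norm x)\<^sup>2"
    by (simp add: field_simps)
  ultimately have E: "2 * (?r + 2 * s) + Y \<le> 3 / 2 * (1 - (norm (drift z))\<^sup>2) + 2 * (drift z \<bullet> x) + 5 / 64
     + 5 / (32 * ?d) * (norm x)\<^sup>2"
    unfolding Y_def tilt_exponent_def by argo
  have "gauss x * (gauss x * exp (2 * (?r + 2 * s))) \<le> (accept_kernel z x * exp Y) * (gauss x * exp (2 * (?r + 2 * s)))"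
    using accept_kernel_ge[of s z x] s s0 unfolding Y_def s_def[symmetric]
    by (intro mult_right_mono) auto
  also have "\<dots> = accept_kernel z x * (gauss x * exp (2 * (?r + 2 * s) + Y))"
    by (simp add: exp_add)
  also have "\<dots> \<le> accept_kernel z x * (gauss x * tilt_weight (drift z) x)"
    unfolding tilt_weight_def using E by (intro mult_left_mono) auto
  also have "gauss x * (gauss x * exp (2 * (?r + 2 * s))) = (gauss x * exp (?r + 2 * s))\<^sup>2"
    by (simp only: power_mult_distrib exp_double power2_eq_square mult_ac)
  finally show ?thesis unfolding s_def .
qed

lemma bump_square_le:
  assumes w: "norm w \<le> step_radius (norm (gradf z))"
  shows "(bump (drift (z + w)) (x - w))\<^sup>2 \<le> accept_kernel z x * (gauss x * tilt_weight (drift z) x)"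
proof (cases "bump (drift (z + w)) (x - w) = 0")
  \<comment> \<open>Away from its support the bump needs no bound, and there the acceptance kernel
    may be arbitrarily small relative to the Gaussian.\<close>
  case True
  then show ?thesis by simp
next
  case False
  have lip: "norm (drift (z + w) - drift z) \<le> norm w / 4" using drift_lipschitz[of "z + w" z] by simp
  note t = norm_drift[of z] norm_drift[of "z + w"] lip
  have "(bump (drift (z + w)) (x - w))\<^sup>2 \<le>
      (gauss x * exp (tilt_exponent (drift z) x + 2 * (norm w * (norm x + 2))))\<^sup>2"
    by (intro power_mono bump_shift_le t) simp
  also have "\<dots> \<le> accept_kernel z x * (gauss x * tilt_weight (drift z) x)"
    by (intro gauss_square_le w bump_shift_nonzero[OF t False])
  finally show ?thesis .
qed

lemma bump_diff_square_le:
  assumes w: "norm w \<le> step_radius (norm (gradf z))"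
  shows "(bump (drift (z + w)) (x - w) - bump (drift (z - w)) (x + w))\<^sup>2 \<le>
    accept_kernel z x * ((2 * norm w)\<^sup>2 *
      ((1 + \<bar>sgn w \<bullet> x\<bar>) + (1 + \<bar>sgn (drift (z + w) - drift (z - w)) \<bullet> x\<bar>) / 4)\<^sup>2 *
      (gauss x * tilt_weight (drift z) x))"
    (is "(?b1 - ?b2)\<^sup>2 \<le> _ * (_ * ?Q\<^sup>2 * _)")
proof (cases "?b1 = 0 \<and> ?b2 = 0")
  case True
  then show ?thesis by simp
next
  case False
  have lip: "norm (drift (z + w) - drift z) \<le> norm w / 4" "norm (drift (z - w) - drift z) \<le> norm w / 4"
    using drift_lipschitz[of "z + w" z] drift_lipschitz[of "z - w" z] by simp_all
  have s: "- (norm w * (norm x + 2)) \<le> tilt_exponent (drift z) x"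
    using False bump_shift_nonzero[OF norm_drift norm_drift lip(1), of x]
      bump_shift_nonzero[of "drift z" "drift (z - w)" "- w" x] lip(2) norm_drift by auto
  have "\<bar>?b1 - ?b2\<bar> \<le> 2 * norm w * ?Q * (gauss x * exp (tilt_exponent (drift z) x + 2 * (norm w * (norm x + 2))))"
    by (intro bump_diff norm_drift lip)
  then have "(?b1 - ?b2)\<^sup>2 \<le> (2 * norm w * ?Q * (gauss x * exp (tilt_exponent (drift z) x + 2 * (norm w * (norm x + 2)))))\<^sup>2"
    by (rule power2_le_iff_abs_le[THEN iffD2, rotated]) simp
  also have "\<dots> = (2 * norm w)\<^sup>2 * ?Q\<^sup>2 * (gauss x * exp (tilt_exponent (drift z) x + 2 * (norm w * (norm x + 2))))\<^sup>2"
    by (simp only: power_mult_distrib)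
  also have "\<dots> \<le> (2 * norm w)\<^sup>2 * ?Q\<^sup>2 * (accept_kernel z x * (gauss x * tilt_weight (drift z) x))"
    by (intro mult_left_mono gauss_square_le w s) auto
  finally show ?thesis by (simp only: mult_ac)
qed

text \<open>The kernel used at \<open>z + w\<close> is measured against accepted moves from
  \<open>z\<close>. The case w = 0 controls v - u, the general case is needed for increments of
  v.\<close>

lemma bump_chi_square:
  assumes w: "norm w \<le> step_radius (norm (gradf z))"
  shows "integrable lborel (\<lambda>x. (bump (drift (z + w)) (x - w))\<^sup>2 / accept_kernel z x)"
    "(\<integral>x. (bump (drift (z + w)) (x - w))\<^sup>2 / accept_kernel z x \<partial>lborel) \<le> 25"
proof -
  note T = tilt_weight_integral[OF norm_drift[of z]]
  have le: "(bump (drift (z + w)) (x - w))\<^sup>2 / accept_kernel z x \<le> gauss x * tilt_weight (drift z) x" for x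
    using bump_square_le[OF w, of x] accept_kernel_pos[of z x] by (simp add: divide_le_eq mult.commute)
  show 1: "integrable lborel (\<lambda>x. (bump (drift (z + w)) (x - w))\<^sup>2 / accept_kernel z x)"
    by (rule Bochner_Integration.integrable_bound[OF T(1)]) (use le in \<open>auto\<close>)
  show "(\<integral>x. (bump (drift (z + w)) (x - w))\<^sup>2 / accept_kernel z x \<partial>lborel) \<le> 25"
    by (rule order_trans[OF integral_mono[OF 1 T(1) le] T(2)])
qed

text \<open>The split (P + Q / 4)^2 \<le> (5/4) P^2 + (5/16) Q^2 is sharp for P = Q, which fits
  since both second moments have the bound 900; and (25/16) 900 = (75/2)^2.\<close>

lemma bump_diff_chi_square:
  assumes w: "norm w \<le> step_radius (norm (gradf z))"
  defines "F \<equiv> \<lambda>x. (bump (drift (z + w)) (x - w) - bump (drift (z - w)) (x + w))\<^sup>2 / accept_kernel z x"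
  shows "integrable lborel F" "(\<integral>x. F x \<partial>lborel) \<le> (2 * norm w * (75 / 2))\<^sup>2"
proof -
  define e1 e2 where "e1 = sgn w" and "e2 = sgn (drift (z + w) - drift (z - w))"
  have e: "norm e1 \<le> 1" "norm e2 \<le> 1" by (auto simp: e1_def e2_def norm_sgn)
  define H where "H e x = gauss x * (1 + \<bar>e \<bullet> x\<bar>)\<^sup>2 * tilt_weight (drift z) x" for e x :: 'a
  have H: "integrable lborel (H e)" "(\<integral>x. H e x \<partial>lborel) \<le> 900" if "norm e \<le> 1" for e
    unfolding H_def by (rule tilt_weight_second_moment[OF norm_drift that])+
  define U where "U x = (2 * norm w)\<^sup>2 * (5 / 4 * H e1 x + 5 / 16 * H e2 x)" for x
  have le: "F x \<le> U x" for x
  proof -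
    let ?P = "1 + \<bar>e1 \<bullet> x\<bar>" and ?Q = "1 + \<bar>e2 \<bullet> x\<bar>" and ?G = "gauss x * tilt_weight (drift z) x"
    have "F x \<le> (2 * norm w)\<^sup>2 * (?P + ?Q / 4)\<^sup>2 * ?G"
      using bump_diff_square_le[OF w, of x] accept_kernel_pos[of z x]
      unfolding F_def e1_def e2_def by (simp only: divide_le_eq mult.commute if_True)
    also have "\<dots> \<le> (2 * norm w)\<^sup>2 * (5 / 4 * ?P\<^sup>2 + 5 / 16 * ?Q\<^sup>2) * ?G"
    proof (intro mult_right_mono mult_left_mono)
      have "(P + Q / 4)\<^sup>2 \<le> 5 / 4 * P\<^sup>2 + 5 / 16 * Q\<^sup>2" for P Q :: real
      proof -
        have "5 / 4 * P\<^sup>2 + 5 / 16 * Q\<^sup>2 - (P + Q / 4)\<^sup>2 = (P - Q)\<^sup>2 / 4"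
          by (simp add: power2_eq_square field_simps)
        then show ?thesis using zero_le_power2[of "P - Q"] by linarith
      qed
      then show "(?P + ?Q / 4)\<^sup>2 \<le> 5 / 4 * ?P\<^sup>2 + 5 / 16 * ?Q\<^sup>2" .
    qed auto
    also have "\<dots> = U x" by (simp add: U_def H_def algebra_simps)
    finally show ?thesis .
  qed
  have intU: "integrable lborel U" unfolding U_def using H[OF e(1)] H[OF e(2)] by simp
  show 1: "integrable lborel F"
  proof (rule Bochner_Integration.integrable_bound[OF intU])
    show "F \<in> borel_measurable lborel" unfolding F_def by measurable
    have "0 \<le> F x" for x by (simp add: F_def)
    then show "AE x in lborel. norm (F x) \<le> norm (U x)" by (auto intro!: AE_I2 order_trans[OF le])
  qed
  have "(\<integral>x. F x \<partial>lborel) \<le> (\<integral>x. U x \<partial>lborel)" by (rule integral_mono[OF 1 intU le])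
  also have "\<dots> = (2 * norm w)\<^sup>2 * (5 / 4 * (\<integral>x. H e1 x \<partial>lborel) + 5 / 16 * (\<integral>x. H e2 x \<partial>lborel))"
    unfolding U_def using H[OF e(1)] H[OF e(2)] by simp
  also have "\<dots> \<le> (2 * norm w)\<^sup>2 * (5 / 4 * 900 + 5 / 16 * 900)"
    by (intro mult_left_mono add_mono H e) auto
  also have "\<dots> = (2 * norm w * (75 / 2))\<^sup>2" by (simp add: power2_eq_square)
  finally show "(\<integral>x. F x \<partial>lborel) \<le> (2 * norm w * (75 / 2))\<^sup>2" .
qed

end

section \<open>Translation of Lebesgue integrals and exhaustion by balls\<close>

lemma lborel_integral_shift:
  fixes F :: "'a::euclidean_space \<Rightarrow> real"
  assumes [measurable]: "F \<in> borel_measurable borel"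
  shows "(\<integral>x. F (z + x) \<partial>lborel) = (\<integral>x. F x \<partial>lborel)"
proof -
  have "(\<integral>x. F x \<partial>lborel) = (\<integral>x. F x \<partial>distr lborel borel ((+) z))" by (simp add: lborel_distr_plus)
  also have "\<dots> = (\<integral>x. F (z + x) \<partial>lborel)" by (rule integral_distr) auto
  finally show ?thesis by simp
qed

lemma lborel_integrable_shift:
  fixes F :: "'a::euclidean_space \<Rightarrow> real"
  assumes F: "integrable lborel F"
  shows "integrable lborel (\<lambda>x. F (z + x))"
proof -
  have [measurable]: "F \<in> borel_measurable borel" using F by auto
  have "integrable (distr lborel borel ((+) z)) F" using F by (simp add: lborel_distr_plus)
  then show ?thesis by (subst (asm) integrable_distr_eq) auto
qed

lemma set_integral_cball_tendsto:
  fixes F :: "'a::euclidean_space \<Rightarrow> real"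
  assumes F: "integrable lborel F"
  shows "(\<lambda>n::nat. LINT x:cball 0 (real n)|lborel. F x) \<longlonglongrightarrow> (\<integral>x. F x \<partial>lborel)"
  unfolding set_lebesgue_integral_def
proof (rule integral_dominated_convergence[where w = "\<lambda>x. \<bar>F x\<bar>"])
  have [measurable]: "F \<in> borel_measurable borel" using F by auto
  show "(\<lambda>x. indicat_real (cball 0 (real n)) x *\<^sub>R F x) \<in> borel_measurable lborel" for n
    using F by (intro borel_measurable_scaleR borel_measurable_indicator) auto
  show "AE x in lborel. (\<lambda>n. indicat_real (cball 0 (real n)) x *\<^sub>R F x) \<longlonglongrightarrow> F x"
  proof (rule AE_I2)
    fix x :: 'a
    obtain N :: nat where N: "norm x \<le> N" using real_arch_simple by blast
    have "eventually (\<lambda>n. indicat_real (cball 0 (real n)) x *\<^sub>R F x = F x) sequentially"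
      using eventually_ge_at_top[of N] by eventually_elim (use N in auto)
    then show "(\<lambda>n. indicat_real (cball 0 (real n)) x *\<^sub>R F x) \<longlonglongrightarrow> F x"
      by (rule tendsto_eventually)
  qed
  show "AE x in lborel. norm (indicat_real (cball 0 (real n)) x *\<^sub>R F x) \<le> \<bar>F x\<bar>" for n
    by (intro AE_I2) (simp add: indicator_def)
qed (use F in auto)

section \<open>The local average and the inequality for bounded functions\<close>

context rwm_target begin

definition energy_density :: "('a \<Rightarrow> real) \<Rightarrow> 'a \<Rightarrow> real" where
  "energy_density u z = (\<integral>x. accept_kernel z x * (u (z + x) - u z)\<^sup>2 \<partial>lborel)"

definition smoothing :: "('a \<Rightarrow> real) \<Rightarrow> 'a \<Rightarrow> real" where
  "smoothing u z = (\<integral>x. bump (drift z) x * u (z + x) \<partial>lborel) / bump_mass (drift z)"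

lemma integrable_p_bounded:
  fixes F :: "'a \<Rightarrow> real"
  assumes [measurable]: "F \<in> borel_measurable borel" and F: "\<And>x. \<bar>F x\<bar> \<le> b"
  shows "integrable lborel (\<lambda>x. p x * F x)"
proof (rule Bochner_Integration.integrable_bound)
  show "integrable lborel (\<lambda>x. b * p x)" using p_int by simp
  have "\<bar>p x * F x\<bar> \<le> \<bar>b * p x\<bar>" for x
    using F[of x] p_pos[of x] by (simp add: abs_mult mult.commute mult_left_mono)
  then show "AE x in lborel. norm (p x * F x) \<le> norm (b * p x)" by simp
qed measurable

lemma bump_mass_pos: "0 < bump_mass t"
  using bump_mass_ge[of t] by linarith

lemma strong_concavity_le:
  assumes slc: "strongly_log_concave m p"
  shows "m \<le> M"
proof (rule ccontr)
  assume mM: "\<not> m \<le> M"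
  obtain e :: 'a where e: "norm e = 1" using vector_choose_size[of 1] by auto
  define s where "s = (2 * \<bar>L\<bar> + 1) / (m - M)"
  have s: "0 < s" using mM by (simp add: s_def)
  have ns: "norm (s *\<^sub>R e) = s" "norm (- (s *\<^sub>R e)) = s" using e s by simp_all
  have f1: "f 0 + gradf 0 \<bullet> (s *\<^sub>R e) - M / 2 * s\<^sup>2 \<le> f (s *\<^sub>R e)"
    using gradient_lower_bound[OF f_grad f_smooth, of 0 "s *\<^sub>R e"] ns by simp
  have f2: "f 0 - gradf 0 \<bullet> (s *\<^sub>R e) - M / 2 * s\<^sup>2 \<le> f (- (s *\<^sub>R e))"
    using gradient_lower_bound[OF f_grad f_smooth, of 0 "- (s *\<^sub>R e)"] ns by simp
  have g12: "g 0 - L * s \<le> g (s *\<^sub>R e)" "g 0 - L * s \<le> g (- (s *\<^sub>R e))"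
    using g_lip[of 0 "s *\<^sub>R e"] g_lip[of 0 "- (s *\<^sub>R e)"] ns by (simp_all add: abs_le_iff)
  have "(f (s *\<^sub>R e) + g (s *\<^sub>R e) + (f (- (s *\<^sub>R e)) + g (- (s *\<^sub>R e)))) / 2 + m / 2 * s\<^sup>2 \<le> f 0 + g 0"
    using strongly_log_concave_midpoint[OF slc, of 0 "s *\<^sub>R e"] ns by (simp add: decomp)
  then have "m / 2 * s\<^sup>2 \<le> M / 2 * s\<^sup>2 + L * s" using f1 f2 g12 by argo
  then have "s * ((m - M) * s) \<le> s * (2 * L)" by (simp add: power2_eq_square algebra_simps)
  then have "(m - M) * s \<le> 2 * L" using s by (simp only: mult_le_cancel_left_pos)
  moreover have "(m - M) * s = 2 * \<bar>L\<bar> + 1" using mM by (simp add: s_def)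
  ultimately show False by linarith
qed

context
  fixes u :: "'a \<Rightarrow> real" and c :: real
  assumes u_measurable [measurable]: "u \<in> borel_measurable borel" and u_bdd: "\<And>x. \<bar>u x\<bar> \<le> c"
begin

lemma c_nonneg: "0 \<le> c"
  using u_bdd[of undefined] by linarith

lemma u_diff_square_le: "(u x - u z)\<^sup>2 \<le> (2 * c)\<^sup>2"
proof -
  have "\<bar>u x - u z\<bar> \<le> 2 * c" using u_bdd[of x] u_bdd[of z] by linarith
  then show ?thesis using c_nonneg by (intro power2_le_iff_abs_le[THEN iffD2]) auto
qed

lemma energy_integrable: "integrable lborel (\<lambda>x. accept_kernel z x * (u (z + x) - u z)\<^sup>2)"
proof (rule Bochner_Integration.integrable_bound)
  show "integrable lborel (\<lambda>x::'a. gauss x * (2 * c)\<^sup>2)"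
    using gauss_integral[where 'a='a] by (simp add: has_bochner_integral_iff)
  have "\<bar>accept_kernel z x * (u (z + x) - u z)\<^sup>2\<bar> \<le> \<bar>gauss x * (2 * c)\<^sup>2\<bar>" for x
    unfolding abs_mult by (intro mult_mono) (use accept_kernel_le u_diff_square_le in auto)
  then show "AE x in lborel. norm (accept_kernel z x * (u (z + x) - u z)\<^sup>2) \<le> norm (gauss x * (2 * c)\<^sup>2)" by simp
qed measurable

lemma energy_density_nonneg: "0 \<le> energy_density u z"
  unfolding energy_density_def by (intro Bochner_Integration.integral_nonneg) auto

lemma energy_density_le: "energy_density u z \<le> (2 * c)\<^sup>2"
proof -
  have "energy_density u z \<le> (\<integral>x. gauss (x :: 'a) * (2 * c)\<^sup>2 \<partial>lborel)"
    unfolding energy_density_def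
  proof (rule integral_mono[OF energy_integrable])
    show "accept_kernel z x * (u (z + x) - u z)\<^sup>2 \<le> gauss x * (2 * c)\<^sup>2" for x
      by (intro mult_mono accept_kernel_le u_diff_square_le) auto
  qed (use gauss_integral[where 'a='a] in \<open>simp add: has_bochner_integral_iff\<close>)
  also have "\<dots> = (2 * c)\<^sup>2"
    using gauss_integral[where 'a='a] by (simp add: has_bochner_integral_iff)
  finally show ?thesis .
qed

lemma energy_density_measurable [measurable]: "energy_density u \<in> borel_measurable borel"
  unfolding energy_density_def by measurable

lemma smoothing_measurable [measurable]: "smoothing u \<in> borel_measurable borel"
  unfolding smoothing_def bump_mass_def by measurable

lemma bump_mult_integrable: "integrable lborel (\<lambda>x. bump t (x - w) * u (z + x))"
  "integrable lborel (\<lambda>x. bump t (x - w))"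
proof -
  have 1: "integrable lborel (\<lambda>x. bump t (- w + x))"
    by (rule lborel_integrable_shift[OF integrable_bump])
  then show 2: "integrable lborel (\<lambda>x. bump t (x - w))" by simp
  show "integrable lborel (\<lambda>x. bump t (x - w) * u (z + x))"
  proof (rule Bochner_Integration.integrable_bound)
    show "integrable lborel (\<lambda>x. bump t (x - w) * c)" using 2 by simp
    have "\<bar>bump t (x - w) * u (z + x)\<bar> \<le> \<bar>bump t (x - w) * c\<bar>" for x
      unfolding abs_mult using u_bdd[of "z + x"] by (intro mult_left_mono) auto
    then show "AE x in lborel. norm (bump t (x - w) * u (z + x)) \<le> norm (bump t (x - w) * c)" by simp
  qed measurable
qed

text \<open>A translation expresses the average at \<open>z + w\<close> through the values u (z +
  x), so that averages at different points are integrated against increments of \<open>u\<close>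
  from the same \<open>z\<close>. Any constant \<open>k\<close> may be subtracted because the kernel
  has mass \<open>bump_mass\<close>.\<close>

lemma smoothing_minus:
  "bump_mass (drift (z + w)) * (smoothing u (z + w) - k) =
    (\<integral>x. bump (drift (z + w)) (x - w) * (u (z + x) - k) \<partial>lborel)"
proof -
  let ?t = "drift (z + w)"
  have "(\<integral>x. bump ?t x * u (z + w + x) \<partial>lborel) = (\<integral>x. bump ?t (w + x - w) * u (z + (w + x)) \<partial>lborel)"
    by (simp add: add.assoc)
  also have "\<dots> = (\<integral>x. bump ?t (x - w) * u (z + x) \<partial>lborel)"
    by (rule lborel_integral_shift[of "\<lambda>x. bump ?t (x - w) * u (z + x)"]) measurable
  finally have 1: "bump_mass ?t * smoothing u (z + w) = (\<integral>x. bump ?t (x - w) * u (z + x) \<partial>lborel)"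
    using bump_mass_pos[of ?t] by (simp add: smoothing_def)
  have "bump_mass ?t = (\<integral>x. bump ?t (w + x - w) \<partial>lborel)" by (simp add: bump_mass_def)
  also have "\<dots> = (\<integral>x. bump ?t (x - w) \<partial>lborel)"
    by (rule lborel_integral_shift[of "\<lambda>x. bump ?t (x - w)"]) measurable
  finally have 2: "bump_mass ?t = (\<integral>x. bump ?t (x - w) \<partial>lborel)" .
  have "(\<integral>x. bump ?t (x - w) * (u (z + x) - k) \<partial>lborel) =
      (\<integral>x. bump ?t (x - w) * u (z + x) - bump ?t (x - w) * k \<partial>lborel)"
    by (simp add: right_diff_distrib)
  also have "\<dots> = bump_mass ?t * smoothing u (z + w) - bump_mass ?t * k"
    using bump_mult_integrable by (simp add: 1[symmetric] 2[symmetric])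
  finally show ?thesis by (simp add: right_diff_distrib)
qed

text \<open>The constant is sqrt 25 divided by the least mass 5/8.\<close>

lemma smoothing_near:
  assumes w: "norm w \<le> step_radius (norm (gradf z))"
  shows "\<bar>smoothing u (z + w) - u z\<bar> \<le> 8 * sqrt (energy_density u z)"
proof -
  let ?N = "bump_mass (drift (z + w))"
  have "\<bar>?N * (smoothing u (z + w) - u z)\<bar> \<le> sqrt (25 * energy_density u z)"
    unfolding smoothing_minus
    by (rule weighted_cauchy_schwarz[where k = "accept_kernel z", OF _ _ _ bump_chi_square(1)[OF w] energy_integrable
        bump_chi_square(2)[OF w]])
       (auto simp: accept_kernel_pos energy_density_def)
  also have "\<dots> = 5 * sqrt (energy_density u z)" by (simp add: real_sqrt_mult)
  finally have "?N * \<bar>smoothing u (z + w) - u z\<bar> \<le> 5 * sqrt (energy_density u z)"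
    using bump_mass_pos[of "drift (z + w)"] by (simp add: abs_mult)
  moreover have "5 / 8 * \<bar>smoothing u (z + w) - u z\<bar> \<le> ?N * \<bar>smoothing u (z + w) - u z\<bar>"
    by (intro mult_right_mono bump_mass_ge) auto
  ultimately show ?thesis by argo
qed

text \<open>With masses \<open>N1\<close>, \<open>N2\<close> and deviations \<open>v1\<close>,
  \<open>v2\<close> from \<open>u z\<close>, one has N1 (v1 - v2) = J + (N2 - N1) v2. The change of
  the kernel gives 75 |w| S and the change of the mass 30 |w| S; their sum 105 |w| S is (5/8) 168
  |w| S.\<close>

lemma smoothing_lipschitz:
  assumes w: "norm w \<le> step_radius (norm (gradf z))"
  shows "smoothing u (z + w) - smoothing u (z - w) \<le> 2 * norm w * (84 * sqrt (energy_density u z))"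
proof -
  define S where "S = sqrt (energy_density u z)"
  define N1 N2 where "N1 = bump_mass (drift (z + w))" and "N2 = bump_mass (drift (z - w))"
  define v1 v2 where "v1 = smoothing u (z + w) - u z" and "v2 = smoothing u (z - w) - u z"
  define J where "J = (\<integral>x. (bump (drift (z + w)) (x - w) - bump (drift (z - w)) (x + w)) * (u (z + x) - u z) \<partial>lborel)"
  have S0: "0 \<le> S" by (simp add: S_def energy_density_nonneg)
  have int: "integrable lborel (\<lambda>x. bump t (x - w') * (u (z + x) - k))" for t w' k
    using bump_mult_integrable by (simp add: right_diff_distrib)
  have "\<bar>J\<bar> \<le> sqrt ((2 * norm w * (75 / 2))\<^sup>2 * energy_density u z)"
    unfolding J_def
    by (rule weighted_cauchy_schwarz[where k = "accept_kernel z", OF _ _ _ bump_diff_chi_square(1)[OF w] energy_integrable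
        bump_diff_chi_square(2)[OF w]])
       (auto simp: accept_kernel_pos energy_density_def)
  also have "\<dots> = 2 * norm w * (75 / 2) * S" by (simp add: real_sqrt_mult S_def)
  finally have J: "\<bar>J\<bar> \<le> 2 * norm w * (75 / 2) * S" .
  have "J = (\<integral>x. bump (drift (z + w)) (x - w) * (u (z + x) - u z) \<partial>lborel) -
      (\<integral>x. bump (drift (z - w)) (x - - w) * (u (z + x) - u z) \<partial>lborel)"
    unfolding J_def
    by (subst Bochner_Integration.integral_diff[symmetric]) (auto intro: int simp: left_diff_distrib int[of _ "- w", simplified])
  also have "\<dots> = N1 * v1 - N2 * v2"
    using smoothing_minus[of z w "u z"] smoothing_minus[of z "- w" "u z"]
    by (simp add: N1_def N2_def v1_def v2_def)
  finally have eq: "N1 * (v1 - v2) = J + (N2 - N1) * v2" by (simp add: algebra_simps)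
  have v2: "\<bar>v2\<bar> \<le> 8 * S" using smoothing_near[of "- w" z] w by (simp add: v2_def S_def)
  have "norm (drift (z - w) - drift (z + w)) \<le> norm (z - w - (z + w)) / 4" by (rule drift_lipschitz)
  also have "z - w - (z + w) = - (2 *\<^sub>R w)" by (simp add: scaleR_2)
  finally have "norm (drift (z - w) - drift (z + w)) \<le> norm w / 2" by simp
  then have "\<bar>N2 - N1\<bar> \<le> 15 / 2 * (norm w / 2)"
    using bump_mass_lipschitz[OF norm_drift norm_drift, of "z - w" "z + w"] by (simp add: N1_def N2_def)
  then have "\<bar>(N2 - N1) * v2\<bar> \<le> 15 / 2 * (norm w / 2) * (8 * S)"
    unfolding abs_mult using v2 by (intro mult_mono) auto
  moreover have "15 / 2 * (norm w / 2) * (8 * S) = 30 * (norm w * S)"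
    "2 * norm w * (75 / 2) * S = 75 * (norm w * S)"
    "5 / 8 * (2 * norm w * (84 * S)) = 105 * (norm w * S)" by simp_all
  ultimately have N1: "N1 * (v1 - v2) \<le> 5 / 8 * (2 * norm w * (84 * S))"
    unfolding eq using J by linarith
  show ?thesis
  proof (cases "v1 - v2 \<le> 0")
    case True
    moreover have "0 \<le> 2 * norm w * (84 * S)" using S0 by simp
    ultimately show ?thesis by (simp add: v1_def v2_def S_def)
  next
    case False
    then have "5 / 8 * (v1 - v2) \<le> N1 * (v1 - v2)"
      unfolding N1_def by (intro mult_right_mono bump_mass_ge) auto
    then have "v1 - v2 \<le> 2 * norm w * (84 * S)" using N1 by argo
    then show ?thesis by (simp add: v1_def v2_def S_def)
  qed
qed

lemma smoothing_bounded: "\<bar>smoothing u z\<bar> \<le> c"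
proof -
  have "\<bar>\<integral>x. bump (drift z) x * u (z + x) \<partial>lborel\<bar> \<le> (\<integral>x. bump (drift z) x * c \<partial>lborel)"
  proof (rule order_trans[OF integral_abs_bound integral_mono])
    show "integrable lborel (\<lambda>x. \<bar>bump (drift z) x * u (z + x)\<bar>)"
      using bump_mult_integrable(1)[of "drift z" 0 z] by simp
    show "integrable lborel (\<lambda>x. bump (drift z) x * c)" using integrable_bump[of "drift z"] by simp
    show "\<bar>bump (drift z) x * u (z + x)\<bar> \<le> bump (drift z) x * c" for x
      using u_bdd[of "z + x"] by (simp add: abs_mult mult_left_mono)
  qed
  also have "\<dots> = bump_mass (drift z) * c" by (simp add: bump_mass_def)
  finally show ?thesis using bump_mass_pos[of "drift z"]
    by (simp add: smoothing_def divide_le_eq mult.commute)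
qed

text \<open>On a ball the gradient is bounded by its value at 0 plus |M| n, so one radius serves all
  its points. The radius shrinks as the ball grows, but it does not enter the resulting inequality,
  so the limit is harmless. The constant is 84^2.\<close>

lemma smoothing_poincare:
  assumes slc: "strongly_log_concave m p" and m: "0 < m"
  shows "m * ((\<integral>x. p x * (smoothing u x)\<^sup>2 \<partial>lborel) - (\<integral>x. p x * smoothing u x \<partial>lborel)\<^sup>2)
    \<le> 7056 * (\<integral>x. p x * energy_density u x \<partial>lborel)"
proof -
  let ?v = "smoothing u" and ?G = "\<lambda>x. 84 * sqrt (energy_density u x)"
  let ?I = "\<lambda>(F :: 'a \<Rightarrow> real) n. LINT x:cball 0 (real n)|lborel. F x"
  have G2: "(?G x)\<^sup>2 = 7056 * energy_density u x" for x
    using energy_density_nonneg[of x] by (simp add: power_mult_distrib)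
  have ball: "m * (?I p n * ?I (\<lambda>x. p x * (?v x)\<^sup>2) n - (?I (\<lambda>x. p x * ?v x) n)\<^sup>2)
      \<le> ?I p n * ?I (\<lambda>x. p x * (?G x)\<^sup>2) n" for n :: nat
  proof (rule strongly_log_concave_poincare[where c = "max c (84 * (2 * c))" and \<rho> = "step_radius (norm (gradf 0) + \<bar>M\<bar> * real n)"])
    show "\<bar>?v x\<bar> \<le> max c (84 * (2 * c))" for x using smoothing_bounded[of x] by simp
    show "0 \<le> ?G x" for x by (simp add: energy_density_nonneg)
    have "sqrt (energy_density u x) \<le> 2 * c" for x
      by (intro real_le_lsqrt energy_density_le) (simp add: c_nonneg)
    then show "?G x \<le> max c (84 * (2 * c))" for x by (simp add: le_max_iff_disj)
    show "0 < step_radius (norm (gradf 0) + \<bar>M\<bar> * real n)" by (rule step_radius_pos)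
    fix z w :: 'a
    assume z: "z \<in> cball 0 (real n)" and w: "norm w \<le> step_radius (norm (gradf 0) + \<bar>M\<bar> * real n)"
    have "norm (gradf z) \<le> norm (gradf 0) + norm (gradf z - gradf 0)" by (rule norm_triangle_sub)
    also have "norm (gradf z - gradf 0) \<le> M * norm (z - 0)" by (rule f_smooth)
    also have "\<dots> \<le> \<bar>M\<bar> * real n" using z by (intro mult_mono) auto
    finally have "step_radius (norm (gradf 0) + \<bar>M\<bar> * real n) \<le> step_radius (norm (gradf z))"
      unfolding step_radius_def using dim_ge_1 by (intro divide_left_mono mult_left_mono mult_pos_pos) auto
    then show "?v (z + w) - ?v (z - w) \<le> 2 * norm w * ?G z"
      by (intro smoothing_lipschitz order_trans[OF w])
  qed (use p_pos p_int slc m in auto)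
  have b1: "\<bar>(?v x)\<^sup>2\<bar> \<le> c\<^sup>2" for x
    using smoothing_bounded[of x] c_nonneg by (simp add: abs_le_square_iff[symmetric])
  have b2: "\<bar>(?G x)\<^sup>2\<bar> \<le> 7056 * (2 * c)\<^sup>2" for x
    unfolding G2 using energy_density_nonneg[of x] energy_density_le[of x] by simp
  have "m * (1 * (\<integral>x. p x * (?v x)\<^sup>2 \<partial>lborel) - (\<integral>x. p x * ?v x \<partial>lborel)\<^sup>2)
      \<le> 1 * (\<integral>x. p x * (?G x)\<^sup>2 \<partial>lborel)"
  proof (rule LIMSEQ_le)
    note lims = set_integral_cball_tendsto[OF p_int, unfolded p_one]
      set_integral_cball_tendsto[OF integrable_p_bounded[OF _ b1]]
      set_integral_cball_tendsto[OF integrable_p_bounded[OF _ smoothing_bounded]]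
      set_integral_cball_tendsto[OF integrable_p_bounded[OF _ b2]]
    show "(\<lambda>n. m * (?I p n * ?I (\<lambda>x. p x * (?v x)\<^sup>2) n - (?I (\<lambda>x. p x * ?v x) n)\<^sup>2))
      \<longlonglongrightarrow> m * (1 * (\<integral>x. p x * (?v x)\<^sup>2 \<partial>lborel) - (\<integral>x. p x * ?v x \<partial>lborel)\<^sup>2)"
      by (intro tendsto_intros lims) measurable
    show "(\<lambda>n. ?I p n * ?I (\<lambda>x. p x * (?G x)\<^sup>2) n) \<longlonglongrightarrow> 1 * (\<integral>x. p x * (?G x)\<^sup>2 \<partial>lborel)"
      by (intro tendsto_intros lims) measurable
    show "\<exists>N. \<forall>n\<ge>N. m * (?I p n * ?I (\<lambda>x. p x * (?v x)\<^sup>2) n - (?I (\<lambda>x. p x * ?v x) n)\<^sup>2)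
      \<le> ?I p n * ?I (\<lambda>x. p x * (?G x)\<^sup>2) n"
      using ball by blast
  qed
  also have "1 * (\<integral>x. p x * (?G x)\<^sup>2 \<partial>lborel) = 7056 * (\<integral>x. p x * energy_density u x \<partial>lborel)"
    unfolding G2 by (simp add: mult.left_commute[of _ 7056])
  finally show ?thesis by simp
qed

theorem rwm_poincare_bounded:
  assumes slc: "strongly_log_concave m p" and m: "0 < m"
  shows "m * ((\<integral>x. p x * (u x)\<^sup>2 \<partial>lborel) - (\<integral>x. p x * u x \<partial>lborel)\<^sup>2)
    \<le> 8900 * (\<integral>x. p x * energy_density u x \<partial>lborel)"
proof -
  let ?v = "smoothing u"
  define E where "E = (\<integral>x. p x * energy_density u x \<partial>lborel)"
  define a where "a = (\<integral>x. p x * ?v x \<partial>lborel)"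
  have intE: "integrable lborel (\<lambda>x. p x * energy_density u x)"
    by (rule integrable_p_bounded[where b = "(2 * c)\<^sup>2"])
       (use energy_density_nonneg energy_density_le in auto)
  have E0: "0 \<le> E" unfolding E_def using p_pos
    by (intro Bochner_Integration.integral_nonneg mult_nonneg_nonneg energy_density_nonneg) (simp add: less_imp_le)
  have quad: "integrable lborel (\<lambda>x. p x * (F x - k)\<^sup>2)"
    "(\<integral>x. p x * (F x - k)\<^sup>2 \<partial>lborel) = (\<integral>x. p x * (F x)\<^sup>2 \<partial>lborel) - 2 * k * (\<integral>x. p x * F x \<partial>lborel) + k\<^sup>2"
    if [measurable]: "F \<in> borel_measurable borel" and F: "\<And>x. \<bar>F x\<bar> \<le> c" for F :: "'a \<Rightarrow> real" and k
  proof -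
    have i1: "integrable lborel (\<lambda>x. p x * F x)" by (rule integrable_p_bounded[OF _ F]) measurable
    have i2: "integrable lborel (\<lambda>x. p x * (F x)\<^sup>2)"
    proof (rule integrable_p_bounded[where b = "c\<^sup>2"])
      show "\<bar>(F x)\<^sup>2\<bar> \<le> c\<^sup>2" for x using F[of x] c_nonneg by (simp add: abs_le_square_iff[symmetric])
    qed measurable
    have eq: "p x * (F x - k)\<^sup>2 = p x * (F x)\<^sup>2 - 2 * k * (p x * F x) + k\<^sup>2 * p x" for x
      by (simp add: power2_diff algebra_simps)
    show "integrable lborel (\<lambda>x. p x * (F x - k)\<^sup>2)"
      unfolding eq using i1 i2 p_int by simp
    show "(\<integral>x. p x * (F x - k)\<^sup>2 \<partial>lborel) = (\<integral>x. p x * (F x)\<^sup>2 \<partial>lborel) - 2 * k * (\<integral>x. p x * F x \<partial>lborel) + k\<^sup>2"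
      unfolding eq using i1 i2 p_int p_one by simp
  qed
  have near: "(u x - ?v x)\<^sup>2 \<le> 64 * energy_density u x" for x
  proof -
    have "\<bar>?v x - u x\<bar> \<le> 8 * sqrt (energy_density u x)"
      using smoothing_near[of 0 x] step_radius_pos[of "norm (gradf x)"] by simp
    then have "(?v x - u x)\<^sup>2 \<le> (8 * sqrt (energy_density u x))\<^sup>2"
      by (rule power2_le_iff_abs_le[THEN iffD2, rotated]) (simp add: energy_density_nonneg)
    then show ?thesis using energy_density_nonneg[of x]
      by (simp add: power_mult_distrib power2_commute)
  qed
  \<comment> \<open>The variance is at most the second moment about any constant; with the mean
    \<open>a\<close> of the average, the variance of the average appears next.\<close>
  have "(\<integral>x. p x * (u x)\<^sup>2 \<partial>lborel) - (\<integral>x. p x * u x \<partial>lborel)\<^sup>2 \<le> (\<integral>x. p x * (u x - a)\<^sup>2 \<partial>lborel)"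
    using zero_le_power2[of "(\<integral>x. p x * u x \<partial>lborel) - a"]
    by (subst quad(2)[OF u_measurable u_bdd]) (simp add: power2_diff mult_ac)
  also have "\<dots> \<le> (\<integral>x. 5 / 4 * (p x * (?v x - a)\<^sup>2) + 320 * (p x * energy_density u x) \<partial>lborel)"
  proof (rule integral_mono)
    show "p x * (u x - a)\<^sup>2 \<le> 5 / 4 * (p x * (?v x - a)\<^sup>2) + 320 * (p x * energy_density u x)" for x
    proof -
      \<comment> \<open>The uneven weights 5/4 and 5 spare the term that carries the large constant
        7056; 5 (8^2) = 320.\<close>
      have "5 / 4 * (?v x - a)\<^sup>2 + 5 * (u x - ?v x)\<^sup>2 - (u x - a)\<^sup>2 = ((?v x - a) / 2 - 2 * (u x - ?v x))\<^sup>2"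
        by (simp add: power2_eq_square field_simps)
      then have "(u x - a)\<^sup>2 \<le> 5 / 4 * (?v x - a)\<^sup>2 + 5 * (u x - ?v x)\<^sup>2"
        using zero_le_power2[of "(?v x - a) / 2 - 2 * (u x - ?v x)"] by argo
      then have "(u x - a)\<^sup>2 \<le> 5 / 4 * (?v x - a)\<^sup>2 + 320 * energy_density u x"
        using near[of x] by argo
      then have "p x * (u x - a)\<^sup>2 \<le> p x * (5 / 4 * (?v x - a)\<^sup>2 + 320 * energy_density u x)"
        using p_pos[of x] by (intro mult_left_mono) auto
      then show ?thesis by (simp add: distrib_left mult.left_commute)
    qed
    show "integrable lborel (\<lambda>x. 5 / 4 * (p x * (?v x - a)\<^sup>2) + 320 * (p x * energy_density u x))"
      by (intro Bochner_Integration.integrable_add integrable_mult_right intE quad smoothing_bounded) measurable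
  qed (rule quad(1)[OF u_measurable u_bdd])
  also have "\<dots> = 5 / 4 * (\<integral>x. p x * (?v x - a)\<^sup>2 \<partial>lborel) + 320 * E"
    unfolding E_def
    by (subst Bochner_Integration.integral_add)
       (auto intro!: integrable_mult_right intE quad smoothing_bounded smoothing_measurable)
  also have "(\<integral>x. p x * (?v x - a)\<^sup>2 \<partial>lborel) = (\<integral>x. p x * (?v x)\<^sup>2 \<partial>lborel) - a\<^sup>2"
    by (subst quad(2)[OF smoothing_measurable smoothing_bounded]) (simp add: a_def power2_eq_square)
  finally have le: "(\<integral>x. p x * (u x)\<^sup>2 \<partial>lborel) - (\<integral>x. p x * u x \<partial>lborel)\<^sup>2
      \<le> 5 / 4 * ((\<integral>x. p x * (?v x)\<^sup>2 \<partial>lborel) - a\<^sup>2) + 320 * E" .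
  have "m * ((\<integral>x. p x * (u x)\<^sup>2 \<partial>lborel) - (\<integral>x. p x * u x \<partial>lborel)\<^sup>2)
      \<le> m * (5 / 4 * ((\<integral>x. p x * (?v x)\<^sup>2 \<partial>lborel) - a\<^sup>2) + 320 * E)"
    using m le by (intro mult_left_mono) auto
  also have "\<dots> = 5 / 4 * (m * ((\<integral>x. p x * (?v x)\<^sup>2 \<partial>lborel) - a\<^sup>2)) + 320 * (m * E)"
    by (simp add: algebra_simps)
  \<comment> \<open>The error from u - v carries a factor \<open>m\<close>, which is removed by m
    \<le> M \<le> 1/4.\<close>
  also have "\<dots> \<le> 5 / 4 * (7056 * E) + 320 * (1 / 4 * E)"
    using smoothing_poincare[OF slc m] strong_concavity_le[OF slc] M_le(2) E0
    unfolding E_def[symmetric] a_def[symmetric]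
    by (intro add_mono mult_left_mono mult_right_mono) auto
  also have "\<dots> \<le> 8900 * E" using E0 by simp
  finally show ?thesis unfolding E_def .
qed

end

end

section \<open>Dirichlet form and spectral gap\<close>

locale symmetric_metropolis =
  fixes p :: "'a::euclidean_space \<Rightarrow> real" and Q :: "'a \<Rightarrow> 'a \<Rightarrow> real"
  assumes p_measurable [measurable]: "p \<in> borel_measurable borel"
    and p_pos: "\<And>x. 0 < p x"
    and p_int: "integrable lborel p"
    and p_one: "(\<integral>x. p x \<partial>lborel) = 1"
    and Q_measurable [measurable]: "(\<lambda>z. Q (fst z) (snd z)) \<in> borel_measurable (borel \<Otimes>\<^sub>M borel)"
    and Q_pos: "\<And>x y. 0 < Q x y"
    and Q_sym: "\<And>x y. Q x y = Q y x"
    and Q_int: "\<And>x. integrable lborel (Q x)"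
    and Q_one: "\<And>x. (\<integral>y. Q x y \<partial>lborel) = 1"
begin

definition edge :: "'a \<Rightarrow> 'a \<Rightarrow> real" where
  "edge x y = min (p x) (p y) * Q x y"

definition energy :: "('a \<Rightarrow> real) \<Rightarrow> real" where
  "energy u = (\<integral>z. edge (fst z) (snd z) * (u (snd z) - u (fst z))\<^sup>2 \<partial>(lborel \<Otimes>\<^sub>M lborel))"

lemma Q_measurable2 [measurable]:
  assumes [measurable]: "a \<in> borel_measurable M" "b \<in> borel_measurable M"
  shows "(\<lambda>w. Q (a w) (b w)) \<in> borel_measurable M"
proof -
  have "(\<lambda>w. (a w, b w)) \<in> measurable M (borel \<Otimes>\<^sub>M borel)" by measurable
  from measurable_compose[OF this Q_measurable] show ?thesis by simp
qed

lemma edge_measurable [measurable]: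
  assumes [measurable]: "a \<in> borel_measurable M" "b \<in> borel_measurable M"
  shows "(\<lambda>w. edge (a w) (b w)) \<in> borel_measurable M"
  unfolding edge_def by measurable

lemma edge_nonneg [simp]: "0 \<le> edge x y"
  unfolding edge_def using p_pos[of x] p_pos[of y] Q_pos[of x y] by (intro mult_nonneg_nonneg) auto

lemma edge_sym: "edge x y = edge y x"
  by (simp add: edge_def min.commute Q_sym[of x y])

lemma edge_le: "edge x y \<le> p x * Q x y"
  unfolding edge_def using Q_pos[of x y] by (intro mult_right_mono) auto

text \<open>Detailed balance: the proposal densities cancel by symmetry, and the resulting flow is
  symmetric in \<open>x\<close> and \<open>y\<close>.\<close>

lemma p_accept: "p x * (metropolis_accept p Q x y * Q x y) = edge x y"
proof -
  have "metropolis_accept p Q x y = min 1 (p y / p x)"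
    using Q_pos[of x y] unfolding metropolis_accept_def Q_sym[of y x] by simp
  moreover have "p x * min 1 (p y / p x) = min (p x) (p y)"
    using p_pos[of x] by (auto simp: min_def field_simps)
  ultimately show ?thesis by (simp add: edge_def flip: mult.assoc)
qed

lemma integrable_edge: "integrable lborel (edge x)"
proof (rule Bochner_Integration.integrable_bound)
  show "integrable lborel (\<lambda>y. p x * Q x y)" using Q_int by simp
  show "AE y in lborel. norm (edge x y) \<le> norm (p x * Q x y)"
    using edge_le by (auto intro!: AE_I2 order_trans[OF edge_le abs_ge_self])
qed measurable

lemma edge_mass: "0 \<le> (\<integral>y. edge x y \<partial>lborel)" "(\<integral>y. edge x y \<partial>lborel) \<le> p x"
proof -
  show "0 \<le> (\<integral>y. edge x y \<partial>lborel)" by (intro Bochner_Integration.integral_nonneg) simp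
  have "(\<integral>y. edge x y \<partial>lborel) \<le> (\<integral>y. p x * Q x y \<partial>lborel)"
    by (intro integral_mono integrable_edge edge_le) (use Q_int in simp)
  then show "(\<integral>y. edge x y \<partial>lborel) \<le> p x" by (simp add: Q_one)
qed

context
  fixes u :: "'a \<Rightarrow> real"
  assumes u_measurable [measurable]: "u \<in> borel_measurable borel"
    and u_L2: "integrable lborel (\<lambda>x. p x * (u x)\<^sup>2)"
begin

lemma edge_square_integrable:
  "integrable (lborel \<Otimes>\<^sub>M lborel) (\<lambda>z. edge (fst z) (snd z) * (u (fst z))\<^sup>2)"
  "integrable (lborel \<Otimes>\<^sub>M lborel) (\<lambda>z. edge (fst z) (snd z) * (u (snd z))\<^sup>2)"
proof -
  have "integrable (lborel \<Otimes>\<^sub>M lborel) (\<lambda>(x, y). edge x y * (u x)\<^sup>2)"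
  proof (rule lborel_pair.Fubini_integrable)
    have "integrable lborel (\<lambda>x. (\<integral>y. edge x y \<partial>lborel) * (u x)\<^sup>2)"
    proof (rule Bochner_Integration.integrable_bound[OF u_L2])
      show "AE x in lborel. norm ((\<integral>y. edge x y \<partial>lborel) * (u x)\<^sup>2) \<le> norm (p x * (u x)\<^sup>2)"
        using edge_mass by (intro AE_I2) (auto simp: abs_mult intro!: mult_right_mono order_trans[OF edge_mass(2)])
    qed measurable
    then show "integrable lborel (\<lambda>x. \<integral>y. norm (case (x, y) of (x, y) \<Rightarrow> edge x y * (u x)\<^sup>2) \<partial>lborel)"
      by (simp add: abs_mult)
    show "AE x in lborel. integrable lborel (\<lambda>y. case (x, y) of (x, y) \<Rightarrow> edge x y * (u x)\<^sup>2)"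
      using integrable_edge by simp
  qed (simp add: split_beta')
  then have 1: "integrable (lborel \<Otimes>\<^sub>M lborel) (\<lambda>z. edge (fst z) (snd z) * (u (fst z))\<^sup>2)"
    by (simp only: split_beta')
  then show "integrable (lborel \<Otimes>\<^sub>M lborel) (\<lambda>z. edge (fst z) (snd z) * (u (fst z))\<^sup>2)" .
  have "integrable (lborel \<Otimes>\<^sub>M lborel) (\<lambda>(x, y). edge (fst (y, x)) (snd (y, x)) * (u (fst (y, x)))\<^sup>2)"
    by (rule lborel_pair.integrable_product_swap[OF 1])
  then show "integrable (lborel \<Otimes>\<^sub>M lborel) (\<lambda>z. edge (fst z) (snd z) * (u (snd z))\<^sup>2)"
    by (simp add: split_beta' edge_sym[of "snd _"])
qed

lemma edge_square_swap:
  "(\<integral>z. edge (fst z) (snd z) * (u (snd z))\<^sup>2 \<partial>(lborel \<Otimes>\<^sub>M lborel)) =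
   (\<integral>z. edge (fst z) (snd z) * (u (fst z))\<^sup>2 \<partial>(lborel \<Otimes>\<^sub>M lborel))"
proof -
  have "(\<integral>(x, y). edge (fst (y, x)) (snd (y, x)) * (u (fst (y, x)))\<^sup>2 \<partial>(lborel \<Otimes>\<^sub>M lborel)) =
   (\<integral>z. edge (fst z) (snd z) * (u (fst z))\<^sup>2 \<partial>(lborel \<Otimes>\<^sub>M lborel))"
    by (rule lborel_pair.integral_product_swap) measurable
  then show ?thesis by (simp add: split_beta' edge_sym[of "snd _"])
qed

lemma edge_cross_integrable:
  "integrable (lborel \<Otimes>\<^sub>M lborel) (\<lambda>z. edge (fst z) (snd z) * (u (fst z) * u (snd z)))"
proof (rule Bochner_Integration.integrable_bound[OF Bochner_Integration.integrable_add[OF edge_square_integrable]])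
  show "AE z in lborel \<Otimes>\<^sub>M lborel. norm (edge (fst z) (snd z) * (u (fst z) * u (snd z)))
      \<le> norm (edge (fst z) (snd z) * (u (fst z))\<^sup>2 + edge (fst z) (snd z) * (u (snd z))\<^sup>2)"
  proof (rule AE_I2)
    fix z :: "'a \<times> 'a"
    have "\<bar>a * b\<bar> \<le> a\<^sup>2 + b\<^sup>2" for a b :: real
      using sum_squares_bound[of "\<bar>a\<bar>" "\<bar>b\<bar>"] abs_ge_zero[of "a * b"]
      unfolding abs_mult mult.assoc power2_abs by linarith
    then have "edge (fst z) (snd z) * \<bar>u (fst z) * u (snd z)\<bar>
        \<le> edge (fst z) (snd z) * ((u (fst z))\<^sup>2 + (u (snd z))\<^sup>2)"
      by (intro mult_left_mono) auto
    then show "norm (edge (fst z) (snd z) * (u (fst z) * u (snd z)))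
      \<le> norm (edge (fst z) (snd z) * (u (fst z))\<^sup>2 + edge (fst z) (snd z) * (u (snd z))\<^sup>2)"
      by (simp add: abs_mult distrib_left)
  qed
qed measurable

lemma energy_integrable:
  "integrable (lborel \<Otimes>\<^sub>M lborel) (\<lambda>z. edge (fst z) (snd z) * (u (snd z) - u (fst z))\<^sup>2)"
  and energy_expand: "energy u = 2 * (\<integral>z. edge (fst z) (snd z) * (u (fst z))\<^sup>2 \<partial>(lborel \<Otimes>\<^sub>M lborel))
    - 2 * (\<integral>z. edge (fst z) (snd z) * (u (fst z) * u (snd z)) \<partial>(lborel \<Otimes>\<^sub>M lborel))"
proof -
  let ?W = "lborel \<Otimes>\<^sub>M lborel :: ('a \<times> 'a) measure"
  have eq: "edge (fst z) (snd z) * (u (snd z) - u (fst z))\<^sup>2 =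
    edge (fst z) (snd z) * (u (snd z))\<^sup>2 + edge (fst z) (snd z) * (u (fst z))\<^sup>2 -
    2 * (edge (fst z) (snd z) * (u (fst z) * u (snd z)))" for z
    by (simp add: power2_eq_square algebra_simps)
  have int: "integrable ?W (\<lambda>z. edge (fst z) (snd z) * (u (snd z))\<^sup>2 + edge (fst z) (snd z) * (u (fst z))\<^sup>2)"
    "integrable ?W (\<lambda>z. 2 * (edge (fst z) (snd z) * (u (fst z) * u (snd z))))"
    by (intro Bochner_Integration.integrable_add integrable_mult_right edge_square_integrable edge_cross_integrable)+
  show "integrable ?W (\<lambda>z. edge (fst z) (snd z) * (u (snd z) - u (fst z))\<^sup>2)"
    unfolding eq by (intro Bochner_Integration.integrable_diff int)
  have "energy u = (\<integral>z. edge (fst z) (snd z) * (u (snd z))\<^sup>2 + edge (fst z) (snd z) * (u (fst z))\<^sup>2 \<partial>?W)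
    - (\<integral>z. 2 * (edge (fst z) (snd z) * (u (fst z) * u (snd z))) \<partial>?W)"
    unfolding energy_def eq by (intro Bochner_Integration.integral_diff int)
  also have "(\<integral>z. edge (fst z) (snd z) * (u (snd z))\<^sup>2 + edge (fst z) (snd z) * (u (fst z))\<^sup>2 \<partial>?W) =
     2 * (\<integral>z. edge (fst z) (snd z) * (u (fst z))\<^sup>2 \<partial>?W)"
    by (subst Bochner_Integration.integral_add[OF edge_square_integrable(2,1)]) (simp only: edge_square_swap mult_2)
  also have "(\<integral>z. 2 * (edge (fst z) (snd z) * (u (fst z) * u (snd z))) \<partial>?W) =
      2 * (\<integral>z. edge (fst z) (snd z) * (u (fst z) * u (snd z)) \<partial>?W)"
    by (rule integral_mult_right_zero)
  finally show "energy u = 2 * (\<integral>z. edge (fst z) (snd z) * (u (fst z))\<^sup>2 \<partial>?W)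
    - 2 * (\<integral>z. edge (fst z) (snd z) * (u (fst z) * u (snd z)) \<partial>?W)" .
qed

lemma metropolis_op_measurable: "metropolis_op p Q u \<in> borel_measurable borel"
  unfolding metropolis_op_def metropolis_accept_def by measurable

text \<open>Accepted moves give the cross term of the energy, the holding probability gives the
  square term. Both double integrals exist separately, so they can be matched with the expansion of
  \<open>energy u\<close>.\<close>

lemma dirichlet_form:
  "(\<integral>x. p x * (u x * metropolis_op p Q u x) \<partial>lborel) = (\<integral>x. p x * (u x)\<^sup>2 \<partial>lborel) - energy u / 2"
proof -
  have eq: "p x * (u x * metropolis_op p Q u x) =
      (\<integral>y. edge x y * (u x * u y) \<partial>lborel) + (p x * (u x)\<^sup>2 - (\<integral>y. edge x y * (u x)\<^sup>2 \<partial>lborel))" for x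
  proof -
    let ?K = "\<lambda>y. metropolis_accept p Q x y * Q x y"
    have 1: "(\<integral>y. edge x y * (u x * u y) \<partial>lborel) = p x * u x * (\<integral>y. ?K y * u y \<partial>lborel)"
      by (subst integral_mult_right_zero[symmetric]) (simp only: p_accept[symmetric] mult_ac)
    have "(\<integral>y. edge x y * (u x)\<^sup>2 \<partial>lborel) = p x * (u x)\<^sup>2 * (\<integral>y. ?K y \<partial>lborel)"
      by (subst integral_mult_right_zero[symmetric]) (simp only: p_accept[symmetric] mult_ac)
    with 1 show ?thesis by (simp add: metropolis_op_def power2_eq_square algebra_simps)
  qed
  have i1: "integrable lborel (\<lambda>x. \<integral>y. edge x y * (u x * u y) \<partial>lborel)"
    and e1: "(\<integral>x. (\<integral>y. edge x y * (u x * u y) \<partial>lborel) \<partial>lborel) =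
      (\<integral>z. edge (fst z) (snd z) * (u (fst z) * u (snd z)) \<partial>(lborel \<Otimes>\<^sub>M lborel))"
    using lborel_pair.integrable_fst'[OF edge_cross_integrable] lborel_pair.integral_fst'[OF edge_cross_integrable]
    by simp_all
  have i2: "integrable lborel (\<lambda>x. \<integral>y. edge x y * (u x)\<^sup>2 \<partial>lborel)"
    and e2: "(\<integral>x. (\<integral>y. edge x y * (u x)\<^sup>2 \<partial>lborel) \<partial>lborel) =
      (\<integral>z. edge (fst z) (snd z) * (u (fst z))\<^sup>2 \<partial>(lborel \<Otimes>\<^sub>M lborel))"
    using lborel_pair.integrable_fst'[OF edge_square_integrable(1)] lborel_pair.integral_fst'[OF edge_square_integrable(1)]
    by simp_all
  show ?thesis
    unfolding eq energy_expand
    by (subst Bochner_Integration.integral_add[OF i1 Bochner_Integration.integrable_diff[OF u_L2 i2]],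
        subst Bochner_Integration.integral_diff[OF u_L2 i2]) (simp only: e1 e2, argo)
qed

lemma energy_iterated:
  "energy u = (\<integral>x. (\<integral>y. edge x y * (u y - u x)\<^sup>2 \<partial>lborel) \<partial>lborel)"
  unfolding energy_def using lborel_pair.integral_fst'[OF energy_integrable] by simp

lemma integrable_p_mult: "integrable lborel (\<lambda>x. p x * u x)"
proof (rule Bochner_Integration.integrable_bound[OF Bochner_Integration.integrable_add[OF p_int u_L2]])
  have "\<bar>p x * u x\<bar> \<le> \<bar>p x + p x * (u x)\<^sup>2\<bar>" for x
  proof -
    have "0 \<le> (\<bar>u x\<bar> - 1)\<^sup>2" by simp
    then have "\<bar>u x\<bar> \<le> 1 + (u x)\<^sup>2" by (simp add: power2_diff)
    then have "p x * \<bar>u x\<bar> \<le> p x * (1 + (u x)\<^sup>2)" using p_pos[of x] by (intro mult_left_mono) auto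
    then show ?thesis using p_pos[of x] by (simp add: abs_mult distrib_left)
  qed
  then show "AE x in lborel. norm (p x * u x) \<le> norm (p x + p x * (u x)\<^sup>2)" by simp
qed measurable

end

definition truncate_at :: "real \<Rightarrow> real \<Rightarrow> real" where
  "truncate_at b x = max (- b) (min b x)"

lemma truncate_at_measurable [measurable]:
  assumes [measurable]: "a \<in> borel_measurable M"
  shows "(\<lambda>w. truncate_at b (a w)) \<in> borel_measurable M"
  unfolding truncate_at_def by measurable

text \<open>Truncation is a contraction and so cannot increase the energy. Therefore the limit is
  needed only on the variance side.\<close>

lemma poincare_from_bounded:
  assumes bdd: "\<And>u c. u \<in> borel_measurable borel \<Longrightarrow> (\<And>x. \<bar>u x\<bar> \<le> c) \<Longrightarrow>
      k * ((\<integral>x. p x * (u x)\<^sup>2 \<partial>lborel) - (\<integral>x. p x * u x \<partial>lborel)\<^sup>2) \<le> energy u"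
    and [measurable]: "u \<in> borel_measurable borel" and L2: "integrable lborel (\<lambda>x. p x * (u x)\<^sup>2)"
  shows "k * ((\<integral>x. p x * (u x)\<^sup>2 \<partial>lborel) - (\<integral>x. p x * u x \<partial>lborel)\<^sup>2) \<le> energy u"
proof -
  let ?u = "\<lambda>n x. truncate_at (real n) (u x)"
  have abs_le: "\<bar>?u n x\<bar> \<le> \<bar>u x\<bar>" for n x by (auto simp: truncate_at_def)
  have sq_le: "(?u n x)\<^sup>2 \<le> (u x)\<^sup>2" for n x using abs_le by (simp add: abs_le_square_iff)
  have lim: "(\<lambda>n. ?u n x) \<longlonglongrightarrow> u x" for x
  proof (rule tendsto_eventually)
    obtain N :: nat where N: "\<bar>u x\<bar> \<le> N" using real_arch_simple by blast
    show "eventually (\<lambda>n. ?u n x = u x) sequentially"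
      using eventually_ge_at_top[of N] by eventually_elim (use N in \<open>auto simp: truncate_at_def\<close>)
  qed
  have L2n: "integrable lborel (\<lambda>x. p x * (?u n x)\<^sup>2)" for n
    by (rule Bochner_Integration.integrable_bound[OF L2])
       (use sq_le p_pos in \<open>auto intro!: AE_I2 mult_left_mono simp: abs_mult less_imp_le\<close>)
  have le: "k * ((\<integral>x. p x * (?u n x)\<^sup>2 \<partial>lborel) - (\<integral>x. p x * ?u n x \<partial>lborel)\<^sup>2) \<le> energy u" for n
  proof -
    have "k * ((\<integral>x. p x * (?u n x)\<^sup>2 \<partial>lborel) - (\<integral>x. p x * ?u n x \<partial>lborel)\<^sup>2) \<le> energy (?u n)"
      by (rule bdd[where c = "real n"]) (auto simp: truncate_at_def)
    also have "\<dots> \<le> energy u"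
      unfolding energy_def
    proof (rule integral_mono)
      fix z :: "'a \<times> 'a"
      have "\<bar>?u n (snd z) - ?u n (fst z)\<bar> \<le> \<bar>u (snd z) - u (fst z)\<bar>" by (auto simp: truncate_at_def)
      then show "edge (fst z) (snd z) * (?u n (snd z) - ?u n (fst z))\<^sup>2 \<le> edge (fst z) (snd z) * (u (snd z) - u (fst z))\<^sup>2"
        by (intro mult_left_mono) (auto simp: abs_le_square_iff)
    qed (intro energy_integrable L2 L2n; measurable)+
    finally show ?thesis .
  qed
  have l1: "(\<lambda>n. \<integral>x. p x * (?u n x)\<^sup>2 \<partial>lborel) \<longlonglongrightarrow> (\<integral>x. p x * (u x)\<^sup>2 \<partial>lborel)"
  proof (rule integral_dominated_convergence[OF _ _ L2])
    show "AE x in lborel. norm (p x * (?u n x)\<^sup>2) \<le> p x * (u x)\<^sup>2" for n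
      using sq_le p_pos by (auto intro!: AE_I2 mult_left_mono simp: abs_mult less_imp_le)
    show "AE x in lborel. (\<lambda>n. p x * (?u n x)\<^sup>2) \<longlonglongrightarrow> p x * (u x)\<^sup>2"
      by (intro AE_I2 tendsto_intros lim)
  qed measurable
  have l2: "(\<lambda>n. \<integral>x. p x * ?u n x \<partial>lborel) \<longlonglongrightarrow> (\<integral>x. p x * u x \<partial>lborel)"
  proof (rule integral_dominated_convergence[OF _ _ integrable_abs[OF integrable_p_mult[OF _ L2]]])
    show "AE x in lborel. norm (p x * ?u n x) \<le> \<bar>p x * u x\<bar>" for n
      using abs_le p_pos by (auto intro!: AE_I2 mult_left_mono simp: abs_mult less_imp_le)
    show "AE x in lborel. (\<lambda>n. p x * ?u n x) \<longlonglongrightarrow> p x * u x"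
      by (intro AE_I2 tendsto_intros lim)
  qed measurable
  show ?thesis
  proof (rule LIMSEQ_le_const2)
    show "(\<lambda>n. k * ((\<integral>x. p x * (?u n x)\<^sup>2 \<partial>lborel) - (\<integral>x. p x * ?u n x \<partial>lborel)\<^sup>2))
      \<longlonglongrightarrow> k * ((\<integral>x. p x * (u x)\<^sup>2 \<partial>lborel) - (\<integral>x. p x * u x \<partial>lborel)\<^sup>2)"
      by (intro tendsto_intros l1 l2)
  qed (use le in blast)
qed

text \<open>The infimum in \<open>spectral_gap\<close> is unspecified on the empty set.\<close>

lemma ex_centered_nonzero:
  "\<exists>u. u \<in> borel_measurable borel \<and> integrable lborel (\<lambda>x. p x * (u x)\<^sup>2) \<and>
    (\<integral>x. p x * u x \<partial>lborel) = 0 \<and> (\<integral>x. p x * (u x)\<^sup>2 \<partial>lborel) \<noteq> 0"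
proof -
  define A :: "'a set" where "A = box 0 One"
  have A_sets [measurable]: "A \<in> sets borel" by (simp add: A_def)
  have A1: "emeasure lborel A = 1" by (simp add: A_def emeasure_lborel_box_eq inner_sum_left inner_Basis)
  define a where "a = (\<integral>x. p x * indicator A x \<partial>lborel)"
  define u where "u x = indicator A x - a" for x
  have [measurable]: "u \<in> borel_measurable borel" unfolding u_def by measurable
  have iA: "integrable lborel (\<lambda>x. p x * indicator A x)"
    using integrable_mult_indicator[OF _ p_int, of A] by (simp add: mult.commute)
  have "(\<integral>x. p x * u x \<partial>lborel) = (\<integral>x. p x * indicator A x - a * p x \<partial>lborel)"
    by (simp add: u_def algebra_simps)
  also have "\<dots> = 0" using iA p_int by (simp add: a_def p_one)
  finally have mean: "(\<integral>x. p x * u x \<partial>lborel) = 0" .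
  have eq: "p x * (u x)\<^sup>2 = p x * indicator A x * (1 - 2 * a) + a\<^sup>2 * p x" for x
    by (auto simp: u_def indicator_def power2_eq_square algebra_simps)
  have int: "integrable lborel (\<lambda>x. p x * (u x)\<^sup>2)"
    unfolding eq by (intro Bochner_Integration.integrable_add integrable_mult_left integrable_mult_right iA p_int)
  have "(\<integral>x. p x * (u x)\<^sup>2 \<partial>lborel) \<noteq> 0"
  proof
    assume "(\<integral>x. p x * (u x)\<^sup>2 \<partial>lborel) = 0"
    then have "AE x in lborel. p x * (u x)\<^sup>2 = 0"
      using p_pos by (subst (asm) integral_nonneg_eq_0_iff_AE[OF int]) (auto simp: less_imp_le)
    then have ae: "AE x in lborel. indicator A x = a"
      by eventually_elim (use p_pos in \<open>auto simp: u_def less_imp_neq[symmetric]\<close>)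
    \<comment> \<open>Zero variance would make the unit cube either of full measure or null, but its
      measure is 1 and that of the space is infinite.\<close>
    show False
    proof (cases "a = 1")
      case True
      have "AE x in lborel. x \<in> A" using ae by eventually_elim (use True in \<open>auto simp: indicator_def split: if_splits\<close>)
      then have "emeasure lborel A = emeasure lborel (UNIV :: 'a set)"
        by (intro emeasure_eq_AE) auto
      then show False using A1 by simp
    next
      case False
      have "AE x in lborel. x \<notin> A" using ae by eventually_elim (use False in \<open>auto simp: indicator_def split: if_splits\<close>)
      then have "emeasure lborel A = emeasure lborel ({} :: 'a set)"
        by (intro emeasure_eq_AE) auto
      then show False using A1 by simp
    qed
  qed
  then show ?thesis using mean int by (intro exI[of _ u]) auto
qed

text \<open>For a centred \<open>u\<close> the quotient in the infimum equals
  \<open>energy u / 2\<close> divided by the variance; the halving stems from the energy being twice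
  the Dirichlet form.\<close>

lemma spectral_gap_ge:
  assumes poincare: "\<And>u. u \<in> borel_measurable borel \<Longrightarrow> integrable lborel (\<lambda>x. p x * (u x)\<^sup>2) \<Longrightarrow>
      k * ((\<integral>x. p x * (u x)\<^sup>2 \<partial>lborel) - (\<integral>x. p x * u x \<partial>lborel)\<^sup>2) \<le> energy u"
  shows "k / 2 \<le> spectral_gap (dens_measure p) (metropolis_op p Q)"
  unfolding spectral_gap_def
proof (rule cInf_greatest)
  let ?\<mu> = "dens_measure p"
  have p0: "AE x in lborel. 0 \<le> p x" using p_pos by (simp add: less_imp_le)
  have meas: "borel_measurable ?\<mu> = borel_measurable borel"
    by (intro measurable_cong_sets) (simp_all add: dens_measure_def)
  have int_eq: "integrable ?\<mu> F \<longleftrightarrow> integrable lborel (\<lambda>x. p x * F x)"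
    "(\<integral>x. F x \<partial>?\<mu>) = (\<integral>x. p x * F x \<partial>lborel)" if "F \<in> borel_measurable borel" for F :: "'a \<Rightarrow> real"
    unfolding dens_measure_def using that p0 by (simp_all add: integrable_density integral_density)
  let ?S = "{1 - (\<integral>x. u x * metropolis_op p Q u x \<partial>?\<mu>) / (\<integral>x. (u x)\<^sup>2 \<partial>?\<mu>) | u.
      u \<in> borel_measurable ?\<mu> \<and> integrable ?\<mu> (\<lambda>x. (u x)\<^sup>2) \<and> (\<integral>x. u x \<partial>?\<mu>) = 0 \<and> (\<integral>x. (u x)\<^sup>2 \<partial>?\<mu>) \<noteq> 0}"
  obtain u where "u \<in> borel_measurable borel" "integrable lborel (\<lambda>x. p x * (u x)\<^sup>2)"
    "(\<integral>x. p x * u x \<partial>lborel) = 0" "(\<integral>x. p x * (u x)\<^sup>2 \<partial>lborel) \<noteq> 0"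
    using ex_centered_nonzero by blast
  then have "u \<in> borel_measurable ?\<mu> \<and> integrable ?\<mu> (\<lambda>x. (u x)\<^sup>2) \<and> (\<integral>x. u x \<partial>?\<mu>) = 0 \<and> (\<integral>x. (u x)\<^sup>2 \<partial>?\<mu>) \<noteq> 0"
    by (simp add: meas int_eq)
  then show "?S \<noteq> {}" by blast
  fix r assume "r \<in> ?S"
  then obtain u where r: "r = 1 - (\<integral>x. u x * metropolis_op p Q u x \<partial>?\<mu>) / (\<integral>x. (u x)\<^sup>2 \<partial>?\<mu>)"
    and um: "u \<in> borel_measurable ?\<mu>" and u2: "integrable ?\<mu> (\<lambda>x. (u x)\<^sup>2)"
    and u0: "(\<integral>x. u x \<partial>?\<mu>) = 0" and un: "(\<integral>x. (u x)\<^sup>2 \<partial>?\<mu>) \<noteq> 0" by blast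
  have [measurable]: "u \<in> borel_measurable borel" using um by (simp add: meas)
  have L2: "integrable lborel (\<lambda>x. p x * (u x)\<^sup>2)" using u2 by (simp add: int_eq)
  note [measurable] = metropolis_op_measurable[of u]
  define V where "V = (\<integral>x. p x * (u x)\<^sup>2 \<partial>lborel)"
  have "0 \<le> V" unfolding V_def using p_pos
    by (intro Bochner_Integration.integral_nonneg) (simp add: less_imp_le)
  moreover have "V \<noteq> 0" using un by (simp add: V_def int_eq)
  ultimately have V: "0 < V" by simp
  have "r = 1 - (V - energy u / 2) / V"
    unfolding r V_def using L2 by (simp add: int_eq dirichlet_form)
  also have "\<dots> = energy u / 2 / V" using V by (simp add: field_simps)
  finally have r: "r = energy u / 2 / V" .
  have "k * V \<le> energy u" using poincare[OF _ L2] u0 by (simp add: V_def int_eq)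
  then show "k / 2 \<le> r" unfolding r using V by (simp add: field_simps)
qed

end

section \<open>Rescaling to unit step size\<close>

lemma lborel_integral_scale:
  fixes F :: "'a::euclidean_space \<Rightarrow> real"
  assumes [measurable]: "F \<in> borel_measurable borel" and h: "0 < h"
  shows "h ^ DIM('a) * (\<integral>x. F (h *\<^sub>R x) \<partial>lborel) = (\<integral>x. F x \<partial>lborel)"
proof -
  have "(\<integral>x. F x \<partial>lborel) = (\<integral>x. F x \<partial>density (distr lborel borel (\<lambda>x. 0 + h *\<^sub>R x)) (\<lambda>_. ennreal (\<bar>h\<bar> ^ DIM('a))))"
    using h by (subst lborel_affine[of h "0::'a"]) simp_all
  also have "\<dots> = h ^ DIM('a) * (\<integral>x. F (h *\<^sub>R x) \<partial>lborel)"
    using h by (simp add: integral_density integral_distr)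
  finally show ?thesis by simp
qed

lemma lborel_integrable_scale:
  fixes F :: "'a::euclidean_space \<Rightarrow> real"
  assumes F: "integrable lborel F" and h: "0 < h"
  shows "integrable lborel (\<lambda>x. F (h *\<^sub>R x))"
proof -
  have [measurable]: "F \<in> borel_measurable borel" using F by auto
  have "integrable (density (distr lborel borel (\<lambda>x. 0 + h *\<^sub>R x)) (\<lambda>_. ennreal (\<bar>h\<bar> ^ DIM('a)))) F"
    using F h by (subst lborel_affine[of h "0::'a", symmetric]) simp_all
  then show ?thesis using h by (simp add: integrable_density integrable_distr_eq)
qed

lemma gauss_scale:
  fixes x :: "'a::euclidean_space"
  assumes h: "0 < h"
  shows "h ^ DIM('a) * rwm_proposal h z (z + h *\<^sub>R x) = gauss x"
proof -
  have "(2 * pi * h\<^sup>2) powr (- real DIM('a) / 2) = (2 * pi) powr (- real DIM('a) / 2) * (h\<^sup>2) powr (- real DIM('a) / 2)"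
    by (simp add: powr_mult)
  also have "(h\<^sup>2) powr (- real DIM('a) / 2) = inverse (h ^ DIM('a))"
    using h by (simp add: powr_power powr_minus powr_realpow[symmetric] powr_powr flip: powr_numeral)
  finally show ?thesis
    using h by (simp add: rwm_proposal_def gauss_def power_mult_distrib field_simps)
qed


text \<open>The Jacobian factors in the quotient are left uncancelled so that the left side is the
  unfolded local energy of the rescaled target.\<close>

lemma rwm_scaled_energy:
  fixes p u :: "'a::euclidean_space \<Rightarrow> real"
  assumes h: "0 < h" and [measurable]: "p \<in> borel_measurable borel" "u \<in> borel_measurable borel"
    and p_pos: "\<And>x. 0 < p x"
  shows "(\<integral>x. min 1 (h ^ DIM('a) * p (h *\<^sub>R (z + x)) / (h ^ DIM('a) * p (h *\<^sub>R z))) * gauss x *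
      (u (h *\<^sub>R (z + x)) - u (h *\<^sub>R z))\<^sup>2 \<partial>lborel) =
    (\<integral>y. min 1 (p y / p (h *\<^sub>R z)) * rwm_proposal h (h *\<^sub>R z) y * (u y - u (h *\<^sub>R z))\<^sup>2 \<partial>lborel)"
proof -
  let ?z = "h *\<^sub>R z"
  define F where "F y = min 1 (p y / p ?z) * rwm_proposal h ?z y * (u y - u ?z)\<^sup>2" for y
  have [measurable]: "F \<in> borel_measurable borel" unfolding F_def rwm_proposal_def by measurable
  have "min 1 (h ^ DIM('a) * p (h *\<^sub>R (z + x)) / (h ^ DIM('a) * p ?z)) * gauss x * (u (h *\<^sub>R (z + x)) - u ?z)\<^sup>2
      = h ^ DIM('a) * F (?z + h *\<^sub>R x)" for x
    using h unfolding F_def by (simp add: gauss_scale[symmetric, of h x ?z] scaleR_right_distrib)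
  then have "(\<integral>x. min 1 (h ^ DIM('a) * p (h *\<^sub>R (z + x)) / (h ^ DIM('a) * p ?z)) * gauss x *
      (u (h *\<^sub>R (z + x)) - u ?z)\<^sup>2 \<partial>lborel) = h ^ DIM('a) * (\<integral>x. F (?z + h *\<^sub>R x) \<partial>lborel)"
    by simp
  also have "\<dots> = (\<integral>x. F (?z + x) \<partial>lborel)"
    by (rule lborel_integral_scale[of "\<lambda>x. F (?z + x)", OF _ h]) measurable
  also have "\<dots> = (\<integral>y. F y \<partial>lborel)" by (rule lborel_integral_shift) measurable
  finally show ?thesis by (simp add: F_def)
qed

lemma rwm_symmetric_metropolis:
  fixes p :: "'a::euclidean_space \<Rightarrow> real"
  assumes "p \<in> borel_measurable borel" "\<And>x. 0 < p x" "integrable lborel p" "(\<integral>x. p x \<partial>lborel) = 1"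
    and h: "0 < h"
  shows "symmetric_metropolis p (rwm_proposal h)"
proof
  show "(\<lambda>z. rwm_proposal h (fst z) (snd z)) \<in> borel_measurable (borel \<Otimes>\<^sub>M borel)"
    unfolding rwm_proposal_def by measurable
  show "0 < rwm_proposal h x y" for x y using h by (simp add: rwm_proposal_def)
  show "rwm_proposal h x y = rwm_proposal h y x" for x y by (simp add: rwm_proposal_def norm_minus_commute)
  have g: "gauss ((1 / h) *\<^sub>R (- x + y)) = h ^ DIM('a) * rwm_proposal h x y" for x y :: 'a
    using gauss_scale[OF h, of x "(1 / h) *\<^sub>R (- x + y)"] h by simp
  have gi: "integrable lborel (\<lambda>y. gauss ((1 / h) *\<^sub>R (- x + y)))" for x :: 'a
    by (intro lborel_integrable_shift[of "\<lambda>y. gauss ((1 / h) *\<^sub>R y)"] lborel_integrable_scale)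
       (use gauss_integral[where 'a = 'a] h in \<open>auto simp: has_bochner_integral_iff\<close>)
  show "integrable lborel (rwm_proposal h x)" for x :: 'a
    using gi[of x] h unfolding g by simp
  show "(\<integral>y. rwm_proposal h x y \<partial>lborel) = 1" for x :: 'a
  proof -
    have "h ^ DIM('a) * (\<integral>y. rwm_proposal h x y \<partial>lborel) = (\<integral>y. gauss ((1 / h) *\<^sub>R (- x + y)) \<partial>lborel)"
      unfolding g by (simp only: integral_mult_right_zero)
    also have "\<dots> = (\<integral>y. gauss ((1 / h) *\<^sub>R (y::'a)) \<partial>lborel)"
      by (rule lborel_integral_shift[of "\<lambda>y. gauss ((1 / h) *\<^sub>R y)"]) measurable
    also have "\<dots> = h ^ DIM('a) * ((1 / h) ^ DIM('a) * (\<integral>y. gauss ((1 / h) *\<^sub>R (y::'a)) \<partial>lborel))"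
      using h by (simp add: power_one_over)
    also have "(1 / h) ^ DIM('a) * (\<integral>y. gauss ((1 / h) *\<^sub>R (y::'a)) \<partial>lborel) = (\<integral>y. gauss (y::'a) \<partial>lborel)"
      using h by (intro lborel_integral_scale) auto
    finally show ?thesis using h gauss_integral[where 'a = 'a] by (simp add: has_bochner_integral_iff)
  qed
qed (use assms in auto)

lemma strongly_log_concave_rescale:
  fixes p :: "'a::euclidean_space \<Rightarrow> real"
  assumes slc: "strongly_log_concave m p" and p_pos: "\<And>x. 0 < p x" and c: "0 < c" and h: "0 < h"
  shows "strongly_log_concave (m * h\<^sup>2) (\<lambda>x. c * p (h *\<^sub>R x))"
  unfolding strongly_log_concave_def
proof (intro allI impI)
  fix x y :: 'a and t :: real assume t: "0 < t \<and> t < 1"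
  have "t * ln (p (h *\<^sub>R x)) + (1 - t) * ln (p (h *\<^sub>R y)) + m / 2 * t * (1 - t) * (norm (h *\<^sub>R x - h *\<^sub>R y))\<^sup>2
      \<le> ln (p (t *\<^sub>R h *\<^sub>R x + (1 - t) *\<^sub>R h *\<^sub>R y))"
    using slc t unfolding strongly_log_concave_def by blast
  moreover have "norm (h *\<^sub>R x - h *\<^sub>R y) = h * norm (x - y)"
    using h by (simp flip: scaleR_right_diff_distrib)
  moreover have "t *\<^sub>R h *\<^sub>R x + (1 - t) *\<^sub>R h *\<^sub>R y = h *\<^sub>R (t *\<^sub>R x + (1 - t) *\<^sub>R y)"
    by (simp add: scaleR_right_distrib mult.commute)
  moreover have "ln (c * p x) = ln c + ln (p x)" for x using c p_pos by (simp add: ln_mult_pos)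
  ultimately show "t * ln (c * p (h *\<^sub>R x)) + (1 - t) * ln (c * p (h *\<^sub>R y)) + m * h\<^sup>2 / 2 * t * (1 - t) * (norm (x - y))\<^sup>2
      \<le> ln (c * p (h *\<^sub>R (t *\<^sub>R x + (1 - t) *\<^sub>R y)))"
    by (simp add: power_mult_distrib algebra_simps)
qed

text \<open>The step size condition is stated as two products, so that it imposes nothing through
  \<open>L\<close> when \<open>L = 0\<close>; a quotient by 0 would have the value 0 and exclude
  every \<open>h\<close>.\<close>

theorem mainTheorem4:
  fixes p f g :: "'a::euclidean_space \<Rightarrow> real"
    and gradf :: "'a \<Rightarrow> 'a"
    and M L m h :: real
  assumes dens_meas: "p \<in> borel_measurable lborel"
    and dens_pos: "\<And>x. p x > 0"
    and dens_int: "integrable lborel p"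
    and dens_one: "(LINT x|lborel. p x) = 1"
    and decomp: "\<And>x. ln (p x) = f x + g x"
    and f_grad: "\<And>x. (f has_derivative (\<lambda>v. gradf x \<bullet> v)) (at x)"
    and f_smooth: "\<And>x y. norm (gradf x - gradf y) \<le> M * norm (x - y)"
    and g_lip: "\<And>x y. \<bar>g x - g y\<bar> \<le> L * norm (x - y)"
    and m_pos: "m > 0"
    and slc: "strongly_log_concave m p"
    and h_pos: "0 < h"
    and h_M: "h * sqrt (real DIM('a)) * (2 * sqrt M) \<le> 1"
    and h_L: "h * sqrt (real DIM('a)) * (16 * L) \<le> 1"
  shows "spectral_gap (dens_measure p) (metropolis_op p (rwm_proposal h))
           \<ge> (1 / (2 ^ 13 * pi)) * m * h\<^sup>2"
proof -
  \<comment> \<open>The Jacobian keeps the rescaled density normalized; its logarithm is absorbed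
    into the smooth part.\<close>
  define c where "c = h ^ DIM('a)"
  define p' where "p' x = c * p (h *\<^sub>R x)" for x
  have c: "0 < c" using h_pos by (simp add: c_def)
  have pm [measurable]: "p \<in> borel_measurable borel" using dens_meas by simp
  obtain e :: 'a where e: "norm e = 1" using vector_choose_size[of 1] by auto
  \<comment> \<open>Nonnegativity of \<open>M\<close> is what allows squaring the condition on
    \<open>sqrt M\<close>.\<close>
  have "0 \<le> M * norm (e - 0)" by (rule order_trans[OF norm_ge_zero f_smooth])
  then have M0: "0 \<le> M" using e by simp
  interpret S: rwm_target p' "\<lambda>x. f (h *\<^sub>R x) + ln c" "\<lambda>x. g (h *\<^sub>R x)" "\<lambda>x. h *\<^sub>R gradf (h *\<^sub>R x)" "h\<^sup>2 * M" "h * L"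
  proof
    show "p' \<in> borel_measurable borel" unfolding p'_def by measurable
    show "0 < p' x" for x using c dens_pos by (simp add: p'_def)
    show "integrable lborel p'" unfolding p'_def using lborel_integrable_scale[OF dens_int h_pos] by simp
    show "(\<integral>x. p' x \<partial>lborel) = 1"
      unfolding p'_def using lborel_integral_scale[OF pm h_pos] dens_one by (simp add: c_def)
    show "ln (p' x) = f (h *\<^sub>R x) + ln c + g (h *\<^sub>R x)" for x
      unfolding p'_def using c dens_pos decomp by (simp add: ln_mult_pos)
    show "((\<lambda>x. f (h *\<^sub>R x) + ln c) has_derivative (\<lambda>v. h *\<^sub>R gradf (h *\<^sub>R x) \<bullet> v)) (at x)" for x
    proof -
      have "((\<lambda>x. f (h *\<^sub>R x)) has_derivative (\<lambda>v. gradf (h *\<^sub>R x) \<bullet> (h *\<^sub>R v))) (at x)"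
        by (rule has_derivative_compose[OF _ f_grad]) (auto intro!: derivative_eq_intros)
      from has_derivative_add_const[OF this, of "ln c"] show ?thesis by simp
    qed
    show "norm (h *\<^sub>R gradf (h *\<^sub>R x) - h *\<^sub>R gradf (h *\<^sub>R y)) \<le> h\<^sup>2 * M * norm (x - y)" for x y
    proof -
      have "norm (h *\<^sub>R gradf (h *\<^sub>R x) - h *\<^sub>R gradf (h *\<^sub>R y)) = h * norm (gradf (h *\<^sub>R x) - gradf (h *\<^sub>R y))"
        using h_pos by (simp flip: scaleR_right_diff_distrib)
      also have "\<dots> \<le> h * (M * norm (h *\<^sub>R x - h *\<^sub>R y))" using h_pos by (intro mult_left_mono f_smooth) auto
      also have "norm (h *\<^sub>R x - h *\<^sub>R y) = h * norm (x - y)" using h_pos by (simp flip: scaleR_right_diff_distrib)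
      finally show ?thesis by (simp add: power2_eq_square mult_ac)
    qed
    show "\<bar>g (h *\<^sub>R x) - g (h *\<^sub>R y)\<bar> \<le> h * L * norm (x - y)" for x y
    proof -
      have "\<bar>g (h *\<^sub>R x) - g (h *\<^sub>R y)\<bar> \<le> L * norm (h *\<^sub>R x - h *\<^sub>R y)" by (rule g_lip)
      also have "norm (h *\<^sub>R x - h *\<^sub>R y) = h * norm (x - y)" using h_pos by (simp flip: scaleR_right_diff_distrib)
      finally show ?thesis by (simp add: mult_ac)
    qed
    have "(h * sqrt (real DIM('a)) * (2 * sqrt M))\<^sup>2 \<le> 1"
      using h_M h_pos M0 by (intro power_le_one) auto
    then show "h\<^sup>2 * M * real DIM('a) \<le> 1 / 4" using M0 by (simp add: power_mult_distrib mult_ac)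
    show "h * L * sqrt (real DIM('a)) \<le> 1 / 16" using h_L by (simp add: mult_ac)
  qed
  interpret R: symmetric_metropolis p "rwm_proposal h"
    using pm dens_pos dens_int dens_one h_pos by (rule rwm_symmetric_metropolis)
  have bounded: "m * h\<^sup>2 / 8900 * ((\<integral>x. p x * (u x)\<^sup>2 \<partial>lborel) - (\<integral>x. p x * u x \<partial>lborel)\<^sup>2) \<le> R.energy u"
    if um: "u \<in> borel_measurable borel" and ub: "\<And>x. \<bar>u x\<bar> \<le> b" for u :: "'a \<Rightarrow> real" and b
  proof -
    note [measurable] = um
    define u' where "u' x = u (h *\<^sub>R x)" for x
    have [measurable]: "u' \<in> borel_measurable borel" unfolding u'_def by measurable
    have L2: "integrable lborel (\<lambda>x. p x * (u x)\<^sup>2)"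
    proof (rule Bochner_Integration.integrable_bound)
      show "integrable lborel (\<lambda>x. b\<^sup>2 * p x)" using dens_int by simp
      have "(u x)\<^sup>2 \<le> b\<^sup>2" for x using power_mono[OF ub abs_ge_zero, of x 2] by simp
      then show "AE x in lborel. norm (p x * (u x)\<^sup>2) \<le> norm (b\<^sup>2 * p x)"
        using dens_pos by (auto simp: abs_mult less_imp_le mult.commute intro!: AE_I2 mult_left_mono)
    qed measurable
    have scale: "(\<integral>x. p' x * F (h *\<^sub>R x) \<partial>lborel) = (\<integral>x. p x * F x \<partial>lborel)"
      if [measurable]: "F \<in> borel_measurable borel" for F :: "'a \<Rightarrow> real"
      using lborel_integral_scale[of "\<lambda>x. p x * F x", OF _ h_pos]
      by (simp add: p'_def c_def mult.assoc)
    define D where "D x = (\<integral>y. min 1 (p y / p x) * rwm_proposal h x y * (u y - u x)\<^sup>2 \<partial>lborel)" for x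
    have [measurable]: "D \<in> borel_measurable borel" unfolding D_def rwm_proposal_def by measurable
    have D: "S.energy_density u' z = D (h *\<^sub>R z)" for z
      unfolding S.energy_density_def S.accept_kernel_def D_def u'_def p'_def c_def
      by (rule rwm_scaled_energy[OF h_pos pm um dens_pos])
    have pD: "p x * D x = (\<integral>y. R.edge x y * (u y - u x)\<^sup>2 \<partial>lborel)" for x
    proof -
      have "p x * (min 1 (p y / p x) * rwm_proposal h x y) = R.edge x y" for y
        using R.p_accept[of x y] R.Q_pos[of x y] unfolding metropolis_accept_def R.Q_sym[of y x] by simp
      then show ?thesis unfolding D_def
        by (subst integral_mult_right_zero[symmetric]) (simp only: mult.assoc[symmetric])
    qed
    have "(\<integral>x. p' x * S.energy_density u' x \<partial>lborel) = R.energy u"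
      unfolding D R.energy_iterated[OF um L2] by (simp add: scale pD)
    moreover have "(\<integral>x. p' x * (u' x)\<^sup>2 \<partial>lborel) = (\<integral>x. p x * (u x)\<^sup>2 \<partial>lborel)"
      "(\<integral>x. p' x * u' x \<partial>lborel) = (\<integral>x. p x * u x \<partial>lborel)"
      using scale[of "\<lambda>x. (u x)\<^sup>2"] scale[of u] by (simp_all add: u'_def)
    moreover have "strongly_log_concave (m * h\<^sup>2) p'"
      unfolding p'_def by (rule strongly_log_concave_rescale[OF slc dens_pos c h_pos])
    then have "m * h\<^sup>2 * ((\<integral>x. p' x * (u' x)\<^sup>2 \<partial>lborel) - (\<integral>x. p' x * u' x \<partial>lborel)\<^sup>2)
        \<le> 8900 * (\<integral>x. p' x * S.energy_density u' x \<partial>lborel)"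
      using m_pos h_pos ub by (intro S.rwm_poincare_bounded[where c = b]) (simp_all add: u'_def)
    ultimately show ?thesis by simp
  qed
  have "m * h\<^sup>2 / 8900 / 2 \<le> spectral_gap (dens_measure p) (metropolis_op p (rwm_proposal h))"
  proof (rule R.spectral_gap_ge)
    fix u :: "'a \<Rightarrow> real"
    assume "u \<in> borel_measurable borel" "integrable lborel (\<lambda>x. p x * (u x)\<^sup>2)"
    then show "m * h\<^sup>2 / 8900 * ((\<integral>x. p x * (u x)\<^sup>2 \<partial>lborel) - (\<integral>x. p x * u x \<partial>lborel)\<^sup>2) \<le> R.energy u"
      by (rule R.poincare_from_bounded[rotated]) (rule bounded)
  qed
  moreover have "(1 / (2 ^ 13 * pi)) * m * h\<^sup>2 \<le> m * h\<^sup>2 / 8900 / 2"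
  proof -
    \<comment> \<open>Here 17800 = 2 (8900), while 2^13 pi exceeds 3 (8192) = 24576.\<close>
    have "1 / (2 ^ 13 * pi) \<le> 1 / 17800" using pi_gt3 by (intro divide_left_mono) auto
    then have "1 / (2 ^ 13 * pi) * (m * h\<^sup>2) \<le> 1 / 17800 * (m * h\<^sup>2)"
      using m_pos by (intro mult_right_mono) auto
    then show ?thesis by simp
  qed
  ultimately show ?thesis by linarith
qed

end
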